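(* Let $X_1, X_2$ be complex Banach spaces and let $\mathcal{A}_1,\mathcal{A}_2$ be standard operator algebras on $X_1,X_2$, respectively. Let $k\ge 2$ be an integer, let $(i_1,\dots,i_m)$ be a finite sequence with $\{i_1,\dots,i_m\}=\{1,\dots,k\}$ such that there is an index $p$ with $i_p\neq i_q$ for all $q\ne p$, and let $$T_1\circ\cdots\circ T_k = T_{i_1}\cdots T_{i_m}+T_{i_m}\cdots T_{i_1}$$ be the associated generalized Jordan product. Suppose a map $\Phi:\mathcal{A}_1\to\mathcal{A}_2$ (not assumed linear, additive or continuous) satisfies $$\sigma(\Phi(A_1)\circ\cdots\circ\Phi(A_k))=\sigma(A_1\circ\cdots\circ A_k)$$ whenever $A_1,\dots,A_k\in\mathcal{A}_1$ and at least one of $A_1,\dots,A_k$ has rank at most $1$. Suppose also that the range of $\Phi$ contains all operators in $\mathcal{A}_2$ of rank at most $3$. Then one of the following conditions holds. (1) There exist a scalar $\lambda$ with $\lambda^m=1$ and an invertible operator $T\in\mathcal{B}(X_1,X_2)$ such that $$\Phi(A)=\lambda TAT^{-1}\quad\text{for all } A\in\mathcal{A}_1.$$ (2) The spaces $X_1$ and $X_2$ are reflexive, and there exist a scalar $\lambda$ with $\lambda^m=1$ and an invertible operator $T\in\mathcal{B}(X_1^*,X_2)$ such that $$\Phi(A)=\lambda TA^*T^{-1}\quad\text{for all } A\in\mathcal{A}_1.$$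
   Context: For Banach spaces $X,Y$, $\mathcal{B}(X,Y)$ denotes the bounded linear operators from $X$ to $Y$, and $\mathcal{B}(X)=\mathcal{B}(X,X)$. A standard operator algebra on a complex Banach space $X$ is a subalgebra of $\mathcal{B}(X)$ containing all continuous finite rank operators on $X$; it is not assumed to be unital or closed in any topology. $\sigma(A)$ denotes the spectrum of the operator $A$. $X^*$ is the dual space of $X$, and $A^*\in\mathcal{B}(X^* )$ is the dual (adjoint) operator of $A\in\mathcal{B}(X)$. *)

theory Defs
  imports "HOL-Analysis.Analysis"
begin

section \<open>Complex normed and Banach spaces\<close>

text \<open>The real scalar multiplication, which \<^class>\<open>real_normed_vector\<close> already provides, is
  required to be the restriction of the complex one.\<close>

class complex_normed_vector = real_normed_vector +
  fixes scaleC :: "complex \<Rightarrow> 'a \<Rightarrow> 'a"  (infixr "*\<^sub>C" 75)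
  assumes scaleC_add_right: "c *\<^sub>C (x + y) = c *\<^sub>C x + c *\<^sub>C y"
    and scaleC_add_left: "(c + d) *\<^sub>C x = c *\<^sub>C x + d *\<^sub>C x"
    and scaleC_scaleC: "c *\<^sub>C d *\<^sub>C x = (c * d) *\<^sub>C x"
    and scaleR_scaleC: "r *\<^sub>R x = complex_of_real r *\<^sub>C x"
    and norm_scaleC: "norm (c *\<^sub>C x) = cmod c * norm x"

class complex_banach = complex_normed_vector + banach

instantiation complex :: complex_banach
begin

definition scaleC_complex :: "complex \<Rightarrow> complex \<Rightarrow> complex"
  where "scaleC_complex c x = c * x"

instance
  by standard (auto simp: scaleC_complex_def algebra_simps norm_mult scaleR_conv_of_real)

end

lemma scaleC_one [simp]: "1 *\<^sub>C x = (x :: 'a::complex_normed_vector)"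
  using scaleR_scaleC[of 1 x] by simp

global_interpretation cvec: vector_space "scaleC :: complex \<Rightarrow> 'a \<Rightarrow> 'a::complex_normed_vector"
  by standard (auto simp: scaleC_add_right scaleC_add_left scaleC_scaleC)

lemma bounded_linear_scaleC: "bounded_linear (\<lambda>x. c *\<^sub>C (x :: 'a::complex_normed_vector))"
  by (rule bounded_linear_intro[where K = "cmod c"])
    (auto simp: scaleC_add_right scaleR_scaleC scaleC_scaleC norm_scaleC mult.commute)


section \<open>Bounded complex-linear operators\<close>

definition bounded_clinear :: "('a::complex_normed_vector \<Rightarrow> 'b::complex_normed_vector) \<Rightarrow> bool"
  where "bounded_clinear f \<longleftrightarrow> bounded_linear f \<and> (\<forall>c x. f (c *\<^sub>C x) = c *\<^sub>C f x)"

typedef (overloaded) ('a, 'b) cblinfun (infixr "\<Rightarrow>\<^sub>C\<^sub>L" 22) =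
  "{f :: 'a::complex_normed_vector \<Rightarrow> 'b::complex_normed_vector. bounded_clinear f}"
  morphisms cblinfun_apply CBlinfun
  by (rule exI[where x = "\<lambda>_. 0"]) (simp add: bounded_clinear_def)

setup_lifting type_definition_cblinfun

lemma cblinfun_eqI: "(\<And>x. cblinfun_apply f x = cblinfun_apply g x) \<Longrightarrow> f = g"
  by transfer auto

text \<open>The norm is the operator norm.\<close>

instantiation cblinfun :: (complex_normed_vector, complex_normed_vector) complex_normed_vector
begin

lift_definition norm_cblinfun :: "'a \<Rightarrow>\<^sub>C\<^sub>L 'b \<Rightarrow> real" is onorm .

lift_definition minus_cblinfun :: "'a \<Rightarrow>\<^sub>C\<^sub>L 'b \<Rightarrow> 'a \<Rightarrow>\<^sub>C\<^sub>L 'b \<Rightarrow> 'a \<Rightarrow>\<^sub>C\<^sub>L 'b"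
  is "\<lambda>f g x. f x - g x"
  by (auto simp: bounded_clinear_def bounded_linear_sub cvec.scale_right_diff_distrib)

definition dist_cblinfun :: "'a \<Rightarrow>\<^sub>C\<^sub>L 'b \<Rightarrow> 'a \<Rightarrow>\<^sub>C\<^sub>L 'b \<Rightarrow> real"
  where "dist_cblinfun f g = norm (f - g)"

definition uniformity_cblinfun :: "(('a \<Rightarrow>\<^sub>C\<^sub>L 'b) \<times> ('a \<Rightarrow>\<^sub>C\<^sub>L 'b)) filter"
  where [code del]: "uniformity_cblinfun = (INF e\<in>{0 <..}. principal {(f, g). dist f g < e})"

definition open_cblinfun :: "('a \<Rightarrow>\<^sub>C\<^sub>L 'b) set \<Rightarrow> bool"
  where [code del]: "open_cblinfun S = (\<forall>f\<in>S. \<forall>\<^sub>F (f', g) in uniformity. f' = f \<longrightarrow> g \<in> S)"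

lift_definition uminus_cblinfun :: "'a \<Rightarrow>\<^sub>C\<^sub>L 'b \<Rightarrow> 'a \<Rightarrow>\<^sub>C\<^sub>L 'b" is "\<lambda>f x. - f x"
  by (auto simp: bounded_clinear_def bounded_linear_minus)

lift_definition zero_cblinfun :: "'a \<Rightarrow>\<^sub>C\<^sub>L 'b" is "\<lambda>x. 0"
  by (auto simp: bounded_clinear_def)

lift_definition plus_cblinfun :: "'a \<Rightarrow>\<^sub>C\<^sub>L 'b \<Rightarrow> 'a \<Rightarrow>\<^sub>C\<^sub>L 'b \<Rightarrow> 'a \<Rightarrow>\<^sub>C\<^sub>L 'b"
  is "\<lambda>f g x. f x + g x"
  by (auto simp: bounded_clinear_def bounded_linear_add scaleC_add_right)

lift_definition scaleC_cblinfun :: "complex \<Rightarrow> 'a \<Rightarrow>\<^sub>C\<^sub>L 'b \<Rightarrow> 'a \<Rightarrow>\<^sub>C\<^sub>L 'b" is "\<lambda>c f x. c *\<^sub>C f x"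
  by (auto simp: bounded_clinear_def scaleC_scaleC mult.commute
      intro: bounded_linear_compose[OF bounded_linear_scaleC])

definition scaleR_cblinfun :: "real \<Rightarrow> 'a \<Rightarrow>\<^sub>C\<^sub>L 'b \<Rightarrow> 'a \<Rightarrow>\<^sub>C\<^sub>L 'b"
  where "scaleR_cblinfun r f = complex_of_real r *\<^sub>C f"

definition sgn_cblinfun :: "'a \<Rightarrow>\<^sub>C\<^sub>L 'b \<Rightarrow> 'a \<Rightarrow>\<^sub>C\<^sub>L 'b"
  where "sgn_cblinfun f = scaleR (inverse (norm f)) f"

instance
proof
  fix f g h :: "'a \<Rightarrow>\<^sub>C\<^sub>L 'b" and r s :: real and c d :: complex and S :: "('a \<Rightarrow>\<^sub>C\<^sub>L 'b) set"
  show norm_C: "norm (c *\<^sub>C f) = cmod c * norm f" for c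
  proof transfer
    fix c :: complex and f :: "'a \<Rightarrow> 'b"
    assume "bounded_clinear f"
    then have f: "bounded_linear f" by (simp add: bounded_clinear_def)
    have eq: "onorm (\<lambda>x. c *\<^sub>C f x) = onorm (\<lambda>x. cmod c *\<^sub>R f x)"
      unfolding onorm_def by (simp add: norm_scaleC)
    show "onorm (\<lambda>x. c *\<^sub>C f x) = cmod c * onorm f"
      unfolding eq using f by (simp add: onorm_scaleR)
  qed
  show "f + g + h = f + (g + h)" "f + g = g + f" "0 + f = f" "- f + f = 0" "f - g = f + - g"
    by (transfer, simp add: algebra_simps)+
  show "r *\<^sub>R (f + g) = r *\<^sub>R f + r *\<^sub>R g" "(r + s) *\<^sub>R f = r *\<^sub>R f + s *\<^sub>R f"
    "r *\<^sub>R s *\<^sub>R f = (r * s) *\<^sub>R f" "1 *\<^sub>R f = f"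
    unfolding scaleR_cblinfun_def
    by (transfer, simp add: scaleC_add_right scaleC_add_left scaleC_scaleC)+
  show "c *\<^sub>C (f + g) = c *\<^sub>C f + c *\<^sub>C g" "(c + d) *\<^sub>C f = c *\<^sub>C f + d *\<^sub>C f"
    "c *\<^sub>C d *\<^sub>C f = (c * d) *\<^sub>C f"
    by (transfer, simp add: scaleC_add_right scaleC_add_left scaleC_scaleC)+
  show "r *\<^sub>R f = complex_of_real r *\<^sub>C f"
    by (simp add: scaleR_cblinfun_def)
  show "norm (r *\<^sub>R f) = \<bar>r\<bar> * norm f"
    by (simp add: scaleR_cblinfun_def norm_C)
  show "norm f = 0 \<longleftrightarrow> f = 0"
    by transfer (auto simp: bounded_clinear_def onorm_eq_0)
  show "norm (f + g) \<le> norm f + norm g"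
    by transfer (auto simp: bounded_clinear_def intro: onorm_triangle)
qed (simp_all add: dist_cblinfun_def sgn_cblinfun_def uniformity_cblinfun_def open_cblinfun_def)

end

lift_definition cblinfun_id :: "'a::complex_normed_vector \<Rightarrow>\<^sub>C\<^sub>L 'a" is "\<lambda>x. x"
  by (simp add: bounded_clinear_def bounded_linear_ident)

lift_definition cblinfun_compose ::
  "'b::complex_normed_vector \<Rightarrow>\<^sub>C\<^sub>L 'c \<Rightarrow> 'a \<Rightarrow>\<^sub>C\<^sub>L 'b
    \<Rightarrow> 'a::complex_normed_vector \<Rightarrow>\<^sub>C\<^sub>L 'c::complex_normed_vector"
  (infixl "o\<^sub>C\<^sub>L" 67)
  is "\<lambda>f g x. f (g x)"
  by (auto simp: bounded_clinear_def bounded_linear_compose)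

definition cblinfun_invertible ::
  "('a::complex_normed_vector \<Rightarrow>\<^sub>C\<^sub>L 'b::complex_normed_vector) \<Rightarrow> bool"
  where "cblinfun_invertible T \<longleftrightarrow> (\<exists>S. S o\<^sub>C\<^sub>L T = cblinfun_id \<and> T o\<^sub>C\<^sub>L S = cblinfun_id)"

definition cblinfun_inv ::
  "('a::complex_normed_vector \<Rightarrow>\<^sub>C\<^sub>L 'b::complex_normed_vector) \<Rightarrow> 'b \<Rightarrow>\<^sub>C\<^sub>L 'a"
  where "cblinfun_inv T = (THE S. S o\<^sub>C\<^sub>L T = cblinfun_id \<and> T o\<^sub>C\<^sub>L S = cblinfun_id)"

definition spectrum :: "('a::complex_normed_vector \<Rightarrow>\<^sub>C\<^sub>L 'a) \<Rightarrow> complex set"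
  where "spectrum A = {z. \<not> cblinfun_invertible (A - z *\<^sub>C cblinfun_id)}"


section \<open>Rank and standard operator algebras\<close>

definition finite_rank :: "('a::complex_normed_vector \<Rightarrow>\<^sub>C\<^sub>L 'b::complex_normed_vector) \<Rightarrow> bool"
  where "finite_rank A \<longleftrightarrow> (\<exists>B. finite B \<and> range (cblinfun_apply A) \<subseteq> cvec.span B)"

text \<open>The \<^const>\<open>finite_rank\<close> conjunct is needed because the library dimension of an
  infinite-dimensional space is \<open>0\<close>.\<close>

definition rank_at_most :: "nat \<Rightarrow> ('a::complex_normed_vector \<Rightarrow>\<^sub>C\<^sub>L 'b::complex_normed_vector) \<Rightarrow> bool"
  where "rank_at_most n A \<longleftrightarrow> finite_rank A \<and> cvec.dim (range (cblinfun_apply A)) \<le> n"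

definition standard_operator_algebra :: "('a::complex_normed_vector \<Rightarrow>\<^sub>C\<^sub>L 'a) set \<Rightarrow> bool"
  where "standard_operator_algebra \<A> \<longleftrightarrow>
    cvec.subspace \<A> \<and> (\<forall>A\<in>\<A>. \<forall>B\<in>\<A>. A o\<^sub>C\<^sub>L B \<in> \<A>) \<and> {A. finite_rank A} \<subseteq> \<A>"


section \<open>Duality\<close>

type_synonym 'a cdual = "('a, complex) cblinfun"

text \<open>Banach-space adjoint \<open>f \<mapsto> f \<circ> A\<close>; it is linear, not conjugate-linear, in \<open>A\<close>.\<close>

lift_definition cadjoint ::
  "'a \<Rightarrow>\<^sub>C\<^sub>L 'b \<Rightarrow> 'b::complex_normed_vector cdual \<Rightarrow>\<^sub>C\<^sub>L 'a::complex_normed_vector cdual"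
  is "\<lambda>A f. f o\<^sub>C\<^sub>L A"
proof -
  fix A :: "'a \<Rightarrow>\<^sub>C\<^sub>L 'b"
  have "norm (f o\<^sub>C\<^sub>L A) \<le> norm f * norm A" for f :: "'b cdual"
    by transfer (auto simp: bounded_clinear_def o_def dest: onorm_compose)
  moreover have "(f + g) o\<^sub>C\<^sub>L A = f o\<^sub>C\<^sub>L A + g o\<^sub>C\<^sub>L A" "(c *\<^sub>C f) o\<^sub>C\<^sub>L A = c *\<^sub>C (f o\<^sub>C\<^sub>L A)"
    for f g :: "'b cdual" and c
    by (transfer, simp)+
  ultimately show "bounded_clinear (\<lambda>f :: 'b cdual. f o\<^sub>C\<^sub>L A)"
    unfolding bounded_clinear_def
    by (auto simp: scaleR_scaleC intro!: bounded_linear_intro[where K = "norm A"])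
qed

lift_definition canonical_embedding :: "'a::complex_normed_vector \<Rightarrow> 'a cdual cdual"
  is "\<lambda>x f. cblinfun_apply f x"
proof -
  fix x :: 'a
  have "norm (cblinfun_apply f x) \<le> norm f * norm x" for f :: "'a cdual"
    by transfer (auto simp: bounded_clinear_def intro: onorm)
  moreover have "cblinfun_apply (f + g) x = cblinfun_apply f x + cblinfun_apply g x"
    "cblinfun_apply (c *\<^sub>C f) x = c *\<^sub>C cblinfun_apply f x" for f g :: "'a cdual" and c
    by (transfer, simp)+
  ultimately show "bounded_clinear (\<lambda>f :: 'a cdual. cblinfun_apply f x)"
    unfolding bounded_clinear_def
    by (auto simp: scaleR_scaleC intro!: bounded_linear_intro[where K = "norm x"])
qed

definition creflexive :: "'a::complex_banach itself \<Rightarrow> bool"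
  where "creflexive _ \<longleftrightarrow> surj (canonical_embedding :: 'a \<Rightarrow> 'a cdual cdual)"


section \<open>Generalized Jordan products\<close>

definition cblinfun_prod :: "('a::complex_normed_vector \<Rightarrow>\<^sub>C\<^sub>L 'a) list \<Rightarrow> 'a \<Rightarrow>\<^sub>C\<^sub>L 'a"
  where "cblinfun_prod Ts = foldr (o\<^sub>C\<^sub>L) Ts cblinfun_id"

text \<open>\<open>idx\<close> is the index sequence \<open>(i\<^sub>1, \<dots>, i\<^sub>m)\<close>; only the values of \<open>T\<close> at indices occurring in
  it matter.\<close>

definition jordan_product ::
  "nat list \<Rightarrow> (nat \<Rightarrow> 'a::complex_normed_vector \<Rightarrow>\<^sub>C\<^sub>L 'a) \<Rightarrow> 'a \<Rightarrow>\<^sub>C\<^sub>L 'a"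
  where "jordan_product idx T = cblinfun_prod (map T idx) + cblinfun_prod (map T (rev idx))"

end

theory Submission
  imports Defs
begin

text \<open>
The index that occurs once in the product singles out one factor. Give that factor the value \<open>A\<close>
and all other factors the value \<open>B\<close>: the product becomes
\<open>J(A,B) = B\<^sup>r A B\<^sup>s + B\<^sup>s A B\<^sup>r\<close>, where \<open>r \<ge> s\<close> and \<open>r + s + 1\<close> is the length \<open>m\<close> of the index
sequence. All information that the proof uses is the equality of the spectra of \<open>J(A,P)\<close> and
\<open>J(\<Phi> A, \<Phi> P)\<close>, where \<open>A\<close> is arbitrary and \<open>P = x \<otimes> f\<close> is an idempotent of rank one. For such \<open>P\<close>
the operator \<open>J(A,P)\<close> has rank at most two, and its nonzero spectrum consists of the nonzero roots
\<open>c\<close> of \<open>(c - f (A x))\<^sup>2 = q\<close>, where \<open>q\<close> is \<open>f (A (A x))\<close> if \<open>s = 0\<close> and \<open>(f (A x))\<^sup>2\<close> otherwise. These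
sets for all \<open>P\<close> determine \<open>A\<close> (\<open>jordan_pair_determines_operator\<close>); in particular \<open>\<Phi> 0 = 0\<close>.

The first step concerns \<open>S = \<Phi> P\<close>. Every operator \<open>C\<close> of rank at most three is some \<open>\<Phi> A\<close>, so
\<open>J(C,S)\<close> has at most two nonzero spectral values, and at most one if \<open>s > 0\<close>. Testing with well
chosen \<open>C\<close> shows that \<open>S\<^bsup>m-1\<^esup>\<close> has rank one and that its trace is an \<open>m\<close>-th root of unity
(\<open>power_rank_one\<close>). The operator \<open>S\<close> itself need not yet have rank one, because a nilpotent
summand is invisible to these tests.

The second step is a trace identity. If \<open>C = z \<otimes> h = \<Phi> A\<close>, then the sum of the two roots gives
\<open>f (A x) = h (S\<^bsup>m-1\<^esup> z)\<close>, at least for generic \<open>z\<close> and \<open>h\<close>; an ambiguity arises only because a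
set of spectral values does not show multiplicities. The left side is bilinear in \<open>(x, f)\<close>, and rank-one
operators \<open>z \<otimes> h\<close> in general position separate operators, so \<open>P \<mapsto> (\<Phi> P)\<^bsup>m-1\<^esup>\<close> extends to a bilinear
map \<open>G\<close> of \<open>(x, f)\<close> whose values have rank at most one. By a general fact on such maps
(\<open>factorization\<close>) either \<open>G x f = T x \<otimes> S f\<close> or \<open>G x f = T f \<otimes> S x\<close> with linear \<open>T\<close> and \<open>S\<close>.

In both cases the traces of the values of \<open>G\<close> on idempotents are \<open>m\<close>-th roots of unity that depend
polynomially on the idempotent; hence they have a common value \<open>\<kappa>\<close>, and \<open>1 / \<kappa>\<close> will be the scalar of the theorem. The trace
identity then recovers \<open>A\<close> from \<open>\<Phi> A = z \<otimes> h\<close>. This makes \<open>T\<close> surjective, bounded (by weak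
boundedness and Baire's theorem) and boundedly invertible, yields reflexivity of both spaces in the
second case, and shows \<open>\<Phi> P = T P T\<^bsup>-1\<^esup> / \<kappa>\<close> or \<open>\<Phi> P = T P\<^sup>* T\<^bsup>-1\<^esup> / \<kappa>\<close> for idempotents \<open>P\<close> of rank
one. Since these determine an operator, the formula holds on the whole algebra. Spaces of dimension
at most one carry only scalar operators and are treated directly.
\<close>

declare [[coercion cblinfun_apply]]

section \<open>Operators as functions\<close>

lemmas cblinfun_rep [simp] =
  plus_cblinfun.rep_eq minus_cblinfun.rep_eq uminus_cblinfun.rep_eq zero_cblinfun.rep_eq
  scaleC_cblinfun.rep_eq cblinfun_id.rep_eq cblinfun_compose.rep_eq

lemma bounded_clinear_apply: "bounded_clinear (cblinfun_apply A)"
  using cblinfun_apply[of A] by simp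

lemma bounded_linear_apply: "bounded_linear (cblinfun_apply A)"
  using bounded_clinear_apply[of A] by (simp add: bounded_clinear_def)

lemma cblinfun_apply_simps [simp]:
  fixes A :: "'a::complex_normed_vector \<Rightarrow>\<^sub>C\<^sub>L 'b::complex_normed_vector"
  shows "A (x + y) = A x + A y" "A (x - y) = A x - A y" "A (- x) = - A x" "A 0 = 0"
  "A (c *\<^sub>C x) = c *\<^sub>C A x"
  using bounded_linear_apply[of A] bounded_clinear_apply[of A]
  by (simp_all add: linear_simps bounded_clinear_def)

lemma scaleC_complex_eq [simp]: "c *\<^sub>C (z :: complex) = c * z"
  by (simp add: scaleC_complex_def)

lemmas cvec_simps =
  scaleC_add_left scaleC_add_right scaleC_scaleC cvec.scale_left_diff_distrib
  cvec.scale_right_diff_distrib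

lemma scaleC_eq_0_iff: "c *\<^sub>C x = 0 \<longleftrightarrow> c = 0 \<or> (x :: 'a::complex_normed_vector) = 0"
  by (rule cvec.scale_eq_0_iff)

lemma cblinfun_bound: "\<exists>K\<ge>0. \<forall>x. norm (cblinfun_apply A x) \<le> K * norm x"
  using bounded_linear.nonneg_bounded[OF bounded_linear_apply[of A]] by (auto simp: mult.commute)

lemma bounded_clinearI:
  fixes F :: "'a::complex_normed_vector \<Rightarrow> 'b::complex_normed_vector"
  assumes "\<And>x y. F (x + y) = F x + F y" and "\<And>c x. F (c *\<^sub>C x) = c *\<^sub>C F x"
    and "\<And>x. norm (F x) \<le> K * norm x"
  shows "bounded_clinear F"
  unfolding bounded_clinear_def
  using assms
  by (auto intro!: bounded_linear_intro[where K = K] simp: scaleR_scaleC mult.commute)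

lemma ex_cblinfunI:
  assumes "bounded_clinear F"
  shows "\<exists>T. \<forall>x. cblinfun_apply T x = F x"
  using assms by (metis CBlinfun_inverse mem_Collect_eq)

lift_definition tensor ::
  "'b::complex_normed_vector \<Rightarrow> 'a::complex_normed_vector cdual \<Rightarrow> 'a \<Rightarrow>\<^sub>C\<^sub>L 'b"
  is "\<lambda>v f x. cblinfun_apply f x *\<^sub>C v"
proof -
  fix v :: 'b and f :: "'a cdual"
  obtain K where K: "K \<ge> 0" "\<And>x. norm (cblinfun_apply f x) \<le> K * norm x"
    using cblinfun_bound[of f] by auto
  show "bounded_clinear (\<lambda>x. cblinfun_apply f x *\<^sub>C v)"
  proof (rule bounded_clinearI[where K = "K * norm v"])
    show "norm (cblinfun_apply f x *\<^sub>C v) \<le> K * norm v * norm x" for x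
      using mult_right_mono[OF K(2)[of x] norm_ge_zero[of v]]
      by (simp add: norm_scaleC mult.assoc mult.commute[of "norm v"])
  qed (auto simp: cvec_simps)
qed

declare tensor.rep_eq [simp]

definition opow :: "('a::complex_normed_vector \<Rightarrow>\<^sub>C\<^sub>L 'a) \<Rightarrow> nat \<Rightarrow> 'a \<Rightarrow>\<^sub>C\<^sub>L 'a"
  where "opow A n = cblinfun_prod (replicate n A)"

lemma opow_apply: "cblinfun_apply (opow A n) = (cblinfun_apply A ^^ n)"
  by (induction n) (auto simp: opow_def cblinfun_prod_def fun_eq_iff)

lemma opow_0 [simp]: "opow A 0 = cblinfun_id"
  by (auto intro!: cblinfun_eqI simp: opow_apply)

lemma opow_apply_0 [simp]: "opow A 0 x = x"
  by simp

lemma opow_Suc: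
  fixes A :: "'a::complex_normed_vector \<Rightarrow>\<^sub>C\<^sub>L 'a"
  shows "opow A (Suc n) x = A (opow A n x)"
  by (simp add: opow_apply)

lemma opow_add: "opow A (i + j) x = opow A i (opow A j x)"
  by (simp add: opow_apply funpow_add)

lemma opow_1 [simp]: "opow A (Suc 0) = A"
  by (auto intro!: cblinfun_eqI simp: opow_Suc)

lemma opow_commute: "opow A i (opow A j x) = opow A j (opow A i x)"
  by (metis add.commute opow_add)

lemma opow_commute1:
  fixes A :: "'a::complex_normed_vector \<Rightarrow>\<^sub>C\<^sub>L 'a"
  shows "opow A i (A x) = A (opow A i x)"
  using opow_commute[of A i 1 x] by simp

lemma opow_mult: "opow A (i * j) x = opow (opow A i) j x"
proof (induction j arbitrary: x)
  case (Suc j)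
  have "opow A (i * Suc j) x = opow A i (opow A (i * j) x)"
    by (simp add: opow_add)
  then show ?case by (simp add: Suc opow_Suc)
qed simp

lemma opow_eigen:
  fixes A :: "'a::complex_normed_vector \<Rightarrow>\<^sub>C\<^sub>L 'a"
  shows "A x = c *\<^sub>C x \<Longrightarrow> opow A n x = c ^ n *\<^sub>C x"
  by (induction n) (auto simp: opow_Suc scaleC_scaleC mult.commute)

lemma opow_scaleC: "opow (c *\<^sub>C A) n x = c ^ n *\<^sub>C opow A n x"
  by (induction n arbitrary: x) (auto simp: opow_Suc scaleC_scaleC mult.commute)

lemma opow_idempotent_tensor:
  fixes f :: "'a::complex_normed_vector cdual"
  assumes "f x = 1" "n \<ge> 1"
  shows "opow (tensor x f) n = tensor x f"
proof -
  have "opow (tensor x f) (Suc k) y = tensor x f y" for k y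
    by (induction k arbitrary: y) (simp_all add: opow_Suc assms)
  then show ?thesis
    using assms(2) by (intro cblinfun_eqI) (metis Suc_le_D One_nat_def)
qed

lemma cblinfun_invertibleI:
  assumes "\<And>x. cblinfun_apply S (cblinfun_apply T x) = x"
    and "\<And>x. cblinfun_apply T (cblinfun_apply S x) = x"
  shows "cblinfun_invertible T"
  unfolding cblinfun_invertible_def
  using assms by (intro exI[of _ S]) (auto intro!: cblinfun_eqI)

lemma cblinfun_inv_eqI:
  assumes "\<And>x. cblinfun_apply S (cblinfun_apply T x) = x"
    and "\<And>x. cblinfun_apply T (cblinfun_apply S x) = x"
  shows "cblinfun_inv T = S"
  unfolding cblinfun_inv_def
proof (rule the_equality)
  show "S o\<^sub>C\<^sub>L T = cblinfun_id \<and> T o\<^sub>C\<^sub>L S = cblinfun_id"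
    using assms by (auto intro!: cblinfun_eqI)
  fix S' assume S': "S' o\<^sub>C\<^sub>L T = cblinfun_id \<and> T o\<^sub>C\<^sub>L S' = cblinfun_id"
  show "S' = S"
  proof (rule cblinfun_eqI)
    fix x
    have "S' (T (S x)) = S x"
      using S' by (metis cblinfun_compose.rep_eq cblinfun_id.rep_eq)
    then show "S' x = S x" by (simp add: assms)
  qed
qed

section \<open>Spectra of operators of rank at most two\<close>

lemma eigenvalue_in_spectrum:
  assumes "cblinfun_apply A x = c *\<^sub>C x" "x \<noteq> 0"
  shows "c \<in> spectrum A"
proof (rule ccontr)
  assume "c \<notin> spectrum A"
  then obtain S where S: "S o\<^sub>C\<^sub>L (A - c *\<^sub>C cblinfun_id) = cblinfun_id"
    by (auto simp: spectrum_def cblinfun_invertible_def)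
  have "x = S ((A - c *\<^sub>C cblinfun_id) x)"
    using S by (metis cblinfun_compose.rep_eq cblinfun_id.rep_eq)
  also have "\<dots> = 0" using assms by simp
  finally show False using assms by simp
qed

text \<open>Zero is left out because its membership depends on the dimension: a finite-rank operator is
  never invertible on an infinite-dimensional space, but may be on a finite-dimensional one.\<close>

definition nzspec :: "('a::complex_normed_vector \<Rightarrow>\<^sub>C\<^sub>L 'a) \<Rightarrow> complex set"
  where "nzspec A = spectrum A - {0}"

text \<open>The nonzero spectral values are the eigenvalues of the Gram matrix with rows \<open>(f x, f y)\<close> and
  \<open>(g x, g y)\<close>. A null vector \<open>(a, b)\<close> of the shifted matrix gives the eigenvector \<open>a x + b y\<close>, and if
  the shifted matrix is invertible, so is the shifted operator.\<close>

lemma nzspec_rank_two: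
  fixes f g :: "'a::complex_normed_vector cdual"
  assumes "c \<noteq> 0"
  shows "c \<in> spectrum (tensor x f + tensor y g) \<longleftrightarrow>
    c\<^sup>2 - (f x + g y) * c + (f x * g y - f y * g x) = 0"
    (is "_ \<in> spectrum ?K \<longleftrightarrow> ?D = 0")
proof
  assume D: "?D = 0"
  obtain a b where ab: "(f x - c) * a + f y * b = 0" "g x * a + (g y - c) * b = 0"
    "a \<noteq> 0 \<or> b \<noteq> 0"
  proof (cases "f x = c \<and> f y = 0")
    case True
    show ?thesis
    proof (cases "g x = 0 \<and> g y = c")
      case True
      with \<open>f x = c \<and> f y = 0\<close> show ?thesis using that[of 1 0] by auto
    next
      case False
      with \<open>f x = c \<and> f y = 0\<close> show ?thesis using that[of "c - g y" "g x"]
        by (auto simp: algebra_simps)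
    qed
  next
    case False
    then show ?thesis using that[of "- f y" "f x - c"] D
      by (auto simp: algebra_simps power2_eq_square)
  qed
  define v where "v = a *\<^sub>C x + b *\<^sub>C y"
  have fv: "f v = c * a" and gv: "g v = c * b"
    using ab(1,2) by (auto simp: v_def algebra_simps)
  then have "v \<noteq> 0" using ab(3) assms by auto
  moreover have "?K v = c *\<^sub>C v"
    by (simp only: cblinfun_rep tensor.rep_eq fv gv) (simp add: v_def cvec_simps)
  ultimately show "c \<in> spectrum ?K" by (rule eigenvalue_in_spectrum[rotated])
next
  assume c: "c \<in> spectrum ?K"
  show "?D = 0"
  proof (rule ccontr)
    assume D: "?D \<noteq> 0"
    define d where "d = ?D"
    have d: "d \<noteq> 0" using D by (simp add: d_def)
    \<comment> \<open>Cramer's rule for the two coefficients of the solution.\<close>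
    define F where "F = inverse d *\<^sub>C ((g y - c) *\<^sub>C f - f y *\<^sub>C g)"
    define G where "G = inverse d *\<^sub>C ((f x - c) *\<^sub>C g - g x *\<^sub>C f)"
    define S where "S = inverse c *\<^sub>C (tensor x F + tensor y G - cblinfun_id)"
    have Fz: "F z = inverse d * ((g y - c) * f z - f y * g z)" for z
      by (simp add: F_def)
    have Gz: "G z = inverse d * ((f x - c) * g z - g x * f z)" for z
      by (simp add: G_def)
    have d_alt: "d = (f x - c) * (g y - c) - f y * g x"
      by (simp add: d_def algebra_simps power2_eq_square)
    have row1: "(f x - c) * F z + f y * G z = f z" for z
    proof -
      have "(f x - c) * F z + f y * G z = inverse d * (d * f z)"
        unfolding Fz Gz d_alt by (simp only: algebra_simps)
      then show ?thesis using d by simp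
    qed
    have row2: "g x * F z + (g y - c) * G z = g z" for z
    proof -
      have "g x * F z + (g y - c) * G z = inverse d * (d * g z)"
        unfolding Fz Gz d_alt by (simp only: algebra_simps)
      then show ?thesis using d by simp
    qed
    have FK: "F (?K z - c *\<^sub>C z) = f z" for z
    proof -
      have "F (?K z - c *\<^sub>C z) = inverse d * (d * f z)"
        unfolding Fz d_alt by (simp add: algebra_simps)
      then show ?thesis using d by simp
    qed
    have GK: "G (?K z - c *\<^sub>C z) = g z" for z
    proof -
      have "G (?K z - c *\<^sub>C z) = inverse d * (d * g z)"
        unfolding Gz d_alt by (simp add: algebra_simps)
      then show ?thesis using d by simp
    qed
    have Sz: "S z = inverse c *\<^sub>C (F z *\<^sub>C x + G z *\<^sub>C y - z)" for z
      by (simp add: S_def)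
    have "cblinfun_invertible (?K - c *\<^sub>C cblinfun_id)"
    proof (rule cblinfun_invertibleI[of S])
      fix z
      have e: "(?K - c *\<^sub>C cblinfun_id) z = ?K z - c *\<^sub>C z" for z by simp
      show "S ((?K - c *\<^sub>C cblinfun_id) z) = z"
        unfolding Sz e FK GK using assms by (simp add: scaleC_scaleC)
      have fS: "f (S z) = F z"
        unfolding Sz using row1[of z] assms by (simp add: field_simps)
      have gS: "g (S z) = G z"
        unfolding Sz using row2[of z] assms by (simp add: field_simps)
      have "?K (S z) = F z *\<^sub>C x + G z *\<^sub>C y"
        by (simp add: fS gS)
      then show "(?K - c *\<^sub>C cblinfun_id) (S z) = z"
        unfolding e unfolding Sz using assms by (simp add: scaleC_scaleC)
    qed
    with c show False by (simp add: spectrum_def)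
  qed
qed

lemma nzspec_rank_one:
  fixes f :: "'a::complex_normed_vector cdual"
  assumes "c \<noteq> 0"
  shows "c \<in> spectrum (tensor x f) \<longleftrightarrow> c = f x"
proof -
  have "tensor x f = tensor x f + tensor 0 f"
    by (rule cblinfun_eqI) simp
  then have "c \<in> spectrum (tensor x f) \<longleftrightarrow> c\<^sup>2 - f x * c = 0"
    using nzspec_rank_two[OF assms, of x f 0 f] by simp
  also have "\<dots> \<longleftrightarrow> c * (c - f x) = 0" by (simp add: algebra_simps power2_eq_square)
  finally show ?thesis using assms by simp
qed

section \<open>The Hahn-Banach theorem\<close>

definition sublinear :: "('a::real_normed_vector \<Rightarrow> real) \<Rightarrow> bool"
  where "sublinear q \<longleftrightarrow> (\<forall>x y. q (x + y) \<le> q x + q y) \<and> (\<forall>t\<ge>0. \<forall>x. q (t *\<^sub>R x) = t * q x)"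

lemma sublinear_add: "sublinear q \<Longrightarrow> q (x + y) \<le> q x + q y"
  by (simp add: sublinear_def)

lemma sublinear_scale: "sublinear q \<Longrightarrow> t \<ge> 0 \<Longrightarrow> q (t *\<^sub>R x) = t * q x"
  by (simp add: sublinear_def)

lemma sublinear_0: "sublinear q \<Longrightarrow> q 0 = 0"
  using sublinear_scale[of q 0 0] by simp

lemma sublinear_minus: "sublinear q \<Longrightarrow> - q (- x) \<le> q x"
  using sublinear_add[of q x "- x"] sublinear_0[of q] by simp

text \<open>For sublinear \<open>q\<close>, the greatest sublinear functional below \<open>q\<close> whose value at \<open>- y\<close> is at most
  \<open>- q y\<close>.\<close>

definition push :: "('a::real_normed_vector \<Rightarrow> real) \<Rightarrow> 'a \<Rightarrow> 'a \<Rightarrow> real"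
  where "push q y x = (INF t\<in>{0..}. q (x + t *\<^sub>R y) - t * q y)"

lemma push_lower:
  assumes "sublinear q" "t \<ge> 0"
  shows "- q (- x) \<le> q (x + t *\<^sub>R y) - t * q y"
proof -
  have "q (t *\<^sub>R y) \<le> q (x + t *\<^sub>R y) + q (- x)"
    using sublinear_add[OF assms(1), of "x + t *\<^sub>R y" "- x"] by simp
  then show ?thesis using sublinear_scale[OF assms, of y] by simp
qed

lemma push_le:
  assumes "sublinear q" "t \<ge> 0"
  shows "push q y x \<le> q (x + t *\<^sub>R y) - t * q y"
  unfolding push_def
proof (rule cINF_lower)
  show "bdd_below ((\<lambda>t. q (x + t *\<^sub>R y) - t * q y) ` {0..})"
    by (rule bdd_belowI2[where m = "- q (- x)"]) (use push_lower[OF assms(1)] in auto)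
qed (use assms in auto)

lemma push_greatest:
  assumes "\<And>t. t \<ge> 0 \<Longrightarrow> c \<le> q (x + t *\<^sub>R y) - t * q y"
  shows "c \<le> push q y x"
  unfolding push_def by (rule cINF_greatest) (use assms in auto)

lemma sublinear_push:
  assumes q: "sublinear q"
  shows "sublinear (push q y)"
proof -
  have add: "push q y (x + z) \<le> push q y x + push q y z" for x z
  proof -
    have "push q y (x + z) - (q (z + t *\<^sub>R y) - t * q y) \<le> push q y x" if t: "t \<ge> 0" for t
    proof (rule push_greatest)
      fix s :: real assume s: "s \<ge> 0"
      have "push q y (x + z) \<le> q (x + z + (s + t) *\<^sub>R y) - (s + t) * q y"
        by (rule push_le[OF q]) (use s t in simp)
      also have "x + z + (s + t) *\<^sub>R y = (x + s *\<^sub>R y) + (z + t *\<^sub>R y)"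
        by (simp add: algebra_simps)
      also have "q \<dots> \<le> q (x + s *\<^sub>R y) + q (z + t *\<^sub>R y)"
        by (rule sublinear_add[OF q])
      finally show "push q y (x + z) - (q (z + t *\<^sub>R y) - t * q y) \<le> q (x + s *\<^sub>R y) - s * q y"
        by (simp add: algebra_simps)
    qed
    then have "push q y (x + z) - push q y x \<le> q (z + t *\<^sub>R y) - t * q y" if "t \<ge> 0" for t
      using that by (simp add: algebra_simps)
    then have "push q y (x + z) - push q y x \<le> push q y z"
      by (rule push_greatest)
    then show ?thesis by simp
  qed
  have le: "push q y (c *\<^sub>R x) \<le> c * push q y x" if c: "c > 0" for c x
  proof -
    have "push q y (c *\<^sub>R x) / c \<le> push q y x"
    proof (rule push_greatest)
      fix t :: real assume t: "t \<ge> 0"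
      have "push q y (c *\<^sub>R x) \<le> q (c *\<^sub>R x + (c * t) *\<^sub>R y) - c * t * q y"
        by (rule push_le[OF q]) (use c t in simp)
      also have "c *\<^sub>R x + (c * t) *\<^sub>R y = c *\<^sub>R (x + t *\<^sub>R y)"
        by (simp add: algebra_simps)
      also have "q \<dots> = c * q (x + t *\<^sub>R y)"
        by (rule sublinear_scale[OF q]) (use c in simp)
      finally show "push q y (c *\<^sub>R x) / c \<le> q (x + t *\<^sub>R y) - t * q y"
        using c by (simp add: field_simps)
    qed
    then show ?thesis using c by (simp add: field_simps)
  qed
  have eq: "push q y (c *\<^sub>R x) = c * push q y x" if c: "c \<ge> 0" for c x
  proof (cases "c = 0")
    case True
    have "push q y 0 \<le> 0"
      using push_le[OF q, of 0 y 0] sublinear_0[OF q] by simp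
    moreover have "0 \<le> push q y 0"
      by (rule push_greatest) (use sublinear_scale[OF q] in simp)
    ultimately show ?thesis using True by simp
  next
    case False
    then have c: "c > 0" using that by simp
    have "push q y (inverse c *\<^sub>R (c *\<^sub>R x)) \<le> inverse c * push q y (c *\<^sub>R x)"
      by (rule le) (use c in simp)
    then have "c * push q y x \<le> push q y (c *\<^sub>R x)"
      using c by (simp add: field_simps)
    with le[OF c, of x] show ?thesis by simp
  qed
  show ?thesis unfolding sublinear_def using add eq by blast
qed

text \<open>Zorn's lemma applies because the pointwise infimum of a chain is finite: each member \<open>q\<close>
  satisfies \<open>- p (- x) \<le> - q (- x) \<le> q x\<close>.\<close>

lemma minimal_sublinear:
  assumes p: "sublinear p"
  shows "\<exists>q. sublinear q \<and> (\<forall>x. q x \<le> p x) \<and>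
    (\<forall>q'. sublinear q' \<longrightarrow> (\<forall>x. q' x \<le> q x) \<longrightarrow> q' = q)"
proof -
  define A where "A = {q. sublinear q \<and> (\<forall>x. q x \<le> p x)}"
  have "\<exists>m\<in>A. \<forall>a\<in>A. (\<forall>x. a x \<le> m x) \<longrightarrow> a = m"
  proof (rule predicate_Zorn)
    show "partial_order_on A (relation_of (\<lambda>q1 q2. \<forall>x. q2 x \<le> q1 x) A)"
      by (rule partial_order_on_relation_ofI) (auto intro: order_trans simp: fun_eq_iff antisym)
    fix C assume C: "C \<in> Chains (relation_of (\<lambda>q1 q2. \<forall>x. q2 x \<le> q1 x) A)"
    show "\<exists>u\<in>A. \<forall>a\<in>C. \<forall>x. u x \<le> a x"
    proof (cases "C = {}")
      case True
      then show ?thesis using p by (auto simp: A_def)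
    next
      case False
      have CA: "C \<subseteq> A" and chain: "\<And>q r. q \<in> C \<Longrightarrow> r \<in> C \<Longrightarrow> (\<forall>x. q x \<le> r x) \<or> (\<forall>x. r x \<le> q x)"
        using C by (auto simp: Chains_def relation_of_def)
      define u where "u x = (INF q\<in>C. q x)" for x
      have lower: "- p (- x) \<le> q x" if "q \<in> C" for q x
      proof -
        have "sublinear q" "q (- x) \<le> p (- x)" using that CA by (auto simp: A_def)
        then show ?thesis using sublinear_minus[of q x] by linarith
      qed
      have u_le: "u x \<le> q x" if "q \<in> C" for q x
        unfolding u_def
        by (rule cINF_lower[OF bdd_belowI2[where m = "- p (- x)"] that]) (rule lower)
      have u_ge: "c \<le> u x" if "\<And>q. q \<in> C \<Longrightarrow> c \<le> q x" for c x
        unfolding u_def by (rule cINF_greatest[OF False that])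
      have "u (x + y) \<le> u x + u y" for x y
      proof -
        have *: "u (x + y) \<le> q x + r y" if qr: "q \<in> C" "r \<in> C" for q r
        proof -
          obtain s where s: "s \<in> C" "s x \<le> q x" "s y \<le> r y"
            using chain[OF qr] qr by blast
          have "sublinear s" using s CA by (auto simp: A_def)
          then show ?thesis
            using u_le[OF s(1), of "x + y"] sublinear_add[of s x y] s by linarith
        qed
        have "u (x + y) - r y \<le> u x" if "r \<in> C" for r
          by (rule u_ge) (use *[OF _ that] in \<open>simp add: algebra_simps\<close>)
        then have "u (x + y) - u x \<le> u y"
          by (intro u_ge) (simp add: algebra_simps)
        then show ?thesis by simp
      qed
      moreover have "u (t *\<^sub>R x) = t * u x" if t: "t \<ge> 0" for t x
      proof (cases "t = 0")
        case True
        obtain q where q: "q \<in> C" using False by auto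
        have z: "r 0 = 0" if "r \<in> C" for r
          using that CA sublinear_0[of r] by (auto simp: A_def)
        have "u 0 \<le> 0" using u_le[OF q, of 0] z[OF q] by simp
        moreover have "0 \<le> u 0" by (rule u_ge) (simp add: z)
        ultimately have "u 0 = 0" by simp
        then show ?thesis using True by simp
      next
        case nz: False
        have sc: "r (t *\<^sub>R x) = t * r x" if "r \<in> C" for r x
          using that CA sublinear_scale[OF _ t, of r] by (auto simp: A_def)
        have "t * u x \<le> u (t *\<^sub>R x)"
        proof (rule u_ge)
          fix r assume r: "r \<in> C"
          show "t * u x \<le> r (t *\<^sub>R x)"
            unfolding sc[OF r] by (rule mult_left_mono[OF u_le[OF r] t])
        qed
        moreover have "u (t *\<^sub>R x) / t \<le> u x"
        proof (rule u_ge)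
          fix r assume r: "r \<in> C"
          show "u (t *\<^sub>R x) / t \<le> r x"
            using u_le[OF r, of "t *\<^sub>R x"] t nz unfolding sc[OF r]
            by (simp add: divide_le_eq mult.commute)
        qed
        ultimately show ?thesis using t nz by (simp add: field_simps)
      qed
      ultimately have "sublinear u" by (simp add: sublinear_def)
      moreover have "u x \<le> p x" for x
      proof -
        obtain q where q: "q \<in> C" using False by auto
        then have "q x \<le> p x" using CA by (auto simp: A_def)
        with u_le[OF q, of x] show ?thesis by simp
      qed
      ultimately have "u \<in> A" by (simp add: A_def)
      then show ?thesis using u_le by blast
    qed
  qed
  then show ?thesis unfolding A_def by (auto intro: order_trans) (meson order_trans)
qed

text \<open>A minimal sublinear functional \<open>q\<close> equals \<open>push q y\<close> for every \<open>y\<close>, so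
  \<open>q x \<le> q (x + y) - q y\<close>, and \<open>q\<close> is additive. Starting the descent below \<open>push norm x0\<close> instead of
  the norm forces the value at \<open>x0\<close>.\<close>

lemma norming_real_functional:
  fixes x0 :: "'a::real_normed_vector"
  shows "\<exists>q. (\<forall>x y. q (x + y) = q x + q y) \<and> (\<forall>(t::real) x. q (t *\<^sub>R x) = t * q x) \<and>
    (\<forall>x. q x \<le> norm x) \<and> q x0 = norm x0"
proof -
  have n: "sublinear (norm :: 'a \<Rightarrow> real)"
    by (simp add: sublinear_def norm_triangle_ineq)
  obtain q where q: "sublinear q" "\<And>x. q x \<le> push norm x0 x"
    and min: "\<And>q'. sublinear q' \<Longrightarrow> (\<And>x. q' x \<le> q x) \<Longrightarrow> q' = q"
    using minimal_sublinear[OF sublinear_push[OF n, of x0]] by auto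
  have q_norm: "q x \<le> norm x" for x
    using q(2)[of x] push_le[OF n, of 0 x0 x] by simp
  have add: "q (x + y) = q x + q y" for x y
  proof -
    have "push q y = q"
      by (rule min[OF sublinear_push[OF q(1)]]) (use push_le[OF q(1), of 0 y] in simp)
    then have "q x \<le> q (x + y) - q y"
      using push_le[OF q(1), of 1 y x] by simp
    with sublinear_add[OF q(1), of x y] show ?thesis by simp
  qed
  have minus: "q (- x) = - q x" for x
    using add[of x "- x"] sublinear_0[OF q(1)] by simp
  have scale: "q (t *\<^sub>R x) = t * q x" for t x
  proof (cases "t \<ge> 0")
    case False
    then have "q ((- t) *\<^sub>R x) = (- t) * q x"
      by (intro sublinear_scale[OF q(1)]) simp
    then show ?thesis using minus[of "t *\<^sub>R x"] by simp
  qed (use sublinear_scale[OF q(1)] in simp)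
  have "q (- x0) \<le> - norm x0"
    using q(2)[of "- x0"] push_le[OF n, of 1 x0 "- x0"] by simp
  then have "q x0 = norm x0" using q_norm[of x0] minus[of x0] by simp
  then show ?thesis using add scale q_norm by blast
qed

text \<open>The real functional \<open>q\<close> is the real part of the complex-linear \<open>x \<mapsto> q x - \<i> q (\<i> x)\<close>; rotating
  the argument so that the value becomes real transfers the norm bound.\<close>

theorem norming_functional:
  fixes x0 :: "'a::complex_normed_vector"
  obtains f :: "'a cdual" where "\<And>x. cmod (f x) \<le> norm x" "f x0 = norm x0"
proof -
  obtain q where add: "\<And>x y. q (x + y) = q x + q y" and scale: "\<And>t x. q (t *\<^sub>R x) = t * q x"
    and le: "\<And>x. q x \<le> norm x" and eq: "q x0 = norm (x0 :: 'a)"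
    using norming_real_functional[of x0] by auto
  define F where "F x = Complex (q x) (- q (\<i> *\<^sub>C x))" for x
  have minus: "q (- x) = - q x" for x
    using scale[of "-1" x] by simp
  have Fadd: "F (x + y) = F x + F y" for x y
    by (simp add: F_def add scaleC_add_right complex_eq_iff)
  have Fr: "F (complex_of_real t *\<^sub>C x) = complex_of_real t * F x" for t x
  proof -
    have "\<i> *\<^sub>C (complex_of_real t *\<^sub>C x) = t *\<^sub>R (\<i> *\<^sub>C x)"
      by (simp add: scaleR_scaleC scaleC_scaleC mult.commute)
    then show ?thesis
      by (simp add: F_def scale complex_eq_iff flip: scaleR_scaleC)
  qed
  have Fi: "F (\<i> *\<^sub>C x) = \<i> * F x" for x
  proof -
    have "\<i> *\<^sub>C (\<i> *\<^sub>C x) = - x"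
      by (simp add: scaleC_scaleC)
    then show ?thesis by (simp add: F_def minus complex_eq_iff)
  qed
  have Fc: "F (c *\<^sub>C x) = c * F x" for c x
  proof -
    have "c = complex_of_real (Re c) + complex_of_real (Im c) * \<i>"
      by (simp add: complex_eq_iff)
    then have "c *\<^sub>C x = complex_of_real (Re c) *\<^sub>C x + complex_of_real (Im c) *\<^sub>C (\<i> *\<^sub>C x)"
      by (metis scaleC_add_left scaleC_scaleC)
    then have "F (c *\<^sub>C x) = (complex_of_real (Re c) + complex_of_real (Im c) * \<i>) * F x"
      by (simp only: Fadd Fr Fi) (simp add: algebra_simps)
    then show ?thesis by (simp add: complex_eq_iff)
  qed
  have Re_F: "Re (F x) = q x" for x by (simp add: F_def)
  have bound: "cmod (F x) \<le> norm x" for x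
  proof (cases "F x = 0")
    case False
    \<comment> \<open>The rotation that makes the value of \<open>F\<close> real and nonnegative.\<close>
    define c where "c = cnj (F x) / cmod (F x)"
    have "F (c *\<^sub>C x) = cmod (F x)"
      using False unfolding Fc c_def
      by (simp add: complex_norm_square[symmetric] power2_eq_square mult.commute)
    then have "cmod (F x) = q (c *\<^sub>C x)" using Re_F[of "c *\<^sub>C x"] by simp
    also have "\<dots> \<le> norm (c *\<^sub>C x)" by (rule le)
    also have "\<dots> = norm x" using False by (simp add: norm_scaleC c_def norm_divide)
    finally show ?thesis .
  qed simp
  have "bounded_clinear F"
    by (rule bounded_clinearI[where K = 1]) (use Fadd Fc bound in auto)
  then obtain f :: "'a cdual" where f: "\<And>x. f x = F x"
    using ex_cblinfunI by blast
  have "F x0 = norm x0"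
  proof -
    have "(Re (F x0))\<^sup>2 + (Im (F x0))\<^sup>2 \<le> (norm x0)\<^sup>2"
      using bound[of x0] by (metis cmod_power2 norm_ge_zero power_mono)
    then have "Im (F x0) = 0" using Re_F[of x0] eq by simp
    then show ?thesis using Re_F[of x0] eq by (simp add: complex_eq_iff)
  qed
  then show ?thesis using that[of f] bound f by simp
qed

corollary separating_functional:
  fixes x :: "'a::complex_normed_vector"
  assumes "x \<noteq> 0"
  obtains f :: "'a cdual" where "f x = 1"
proof -
  obtain f :: "'a cdual" where f: "f x = norm x"
    using norming_functional[of x] by metis
  show ?thesis
    by (rule that[of "inverse (complex_of_real (norm x)) *\<^sub>C f"]) (use assms f in simp)
qed

lemma eq_0_if_functionals_0:
  fixes x :: "'a::complex_normed_vector"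
  assumes "\<And>f :: 'a cdual. f x = 0"
  shows "x = 0"
  using separating_functional[of x] assms by (metis zero_neq_one)

lemma eq_if_functionals_eq:
  fixes x :: "'a::complex_normed_vector"
  assumes "\<And>f :: 'a cdual. f x = f y"
  shows "x = y"
  using eq_0_if_functionals_0[of "x - y"] assms by simp

definition indep2 :: "'a::complex_normed_vector \<Rightarrow> 'a \<Rightarrow> bool"
  where "indep2 x y \<longleftrightarrow> (\<forall>a b. a *\<^sub>C x + b *\<^sub>C y = 0 \<longrightarrow> a = 0 \<and> b = 0)"

definition indep3 :: "'a::complex_normed_vector \<Rightarrow> 'a \<Rightarrow> 'a \<Rightarrow> bool"
  where "indep3 x y z \<longleftrightarrow>
    (\<forall>a b c. a *\<^sub>C x + b *\<^sub>C y + c *\<^sub>C z = 0 \<longrightarrow> a = 0 \<and> b = 0 \<and> c = 0)"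

lemma indep2D: "indep2 x y \<Longrightarrow> a *\<^sub>C x + b *\<^sub>C y = 0 \<Longrightarrow> a = 0 \<and> b = 0"
  by (simp add: indep2_def)

lemma indep3D: "indep3 x y z \<Longrightarrow> a *\<^sub>C x + b *\<^sub>C y + c *\<^sub>C z = 0 \<Longrightarrow> a = 0 \<and> b = 0 \<and> c = 0"
  by (simp add: indep3_def)

lemma indep2_nonzero: "indep2 x y \<Longrightarrow> x \<noteq> 0" "indep2 x y \<Longrightarrow> y \<noteq> 0"
  using indep2D[of x y 1 0] indep2D[of x y 0 1] by auto

lemma indep2_sym: "indep2 x y \<Longrightarrow> indep2 y x"
  unfolding indep2_def by (metis add.commute)

lemma not_indep2:
  assumes "\<not> indep2 x y" "x \<noteq> 0"
  obtains c where "y = c *\<^sub>C x"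
proof -
  obtain a b where ab: "a *\<^sub>C x + b *\<^sub>C y = 0" "a \<noteq> 0 \<or> b \<noteq> 0"
    using assms(1) by (auto simp: indep2_def)
  have b: "b \<noteq> 0"
    using ab assms(2) by (auto simp: scaleC_eq_0_iff)
  have "b *\<^sub>C y = - (a *\<^sub>C x)" using ab(1) by (simp add: eq_neg_iff_add_eq_0 add.commute)
  then have "y = (- a / b) *\<^sub>C x"
    using b by (metis (no_types, lifting) cvec.scale_minus_left divide_inverse_commute
        left_inverse scaleC_one scaleC_scaleC)
  then show ?thesis by (rule that)
qed

lemma not_indep3:
  assumes "\<not> indep3 x y z" "indep2 x y"
  obtains a b where "z = a *\<^sub>C x + b *\<^sub>C y"
proof -
  obtain a b c where abc: "a *\<^sub>C x + b *\<^sub>C y + c *\<^sub>C z = 0" "a \<noteq> 0 \<or> b \<noteq> 0 \<or> c \<noteq> 0"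
    using assms(1) by (auto simp: indep3_def)
  have c: "c \<noteq> 0"
    using abc indep2D[OF assms(2), of a b] by auto
  have "c *\<^sub>C z = - (a *\<^sub>C x + b *\<^sub>C y)"
    using abc(1) by (metis add.commute eq_neg_iff_add_eq_0)
  then have "z = inverse c *\<^sub>C (- (a *\<^sub>C x + b *\<^sub>C y))"
    using c by (metis left_inverse scaleC_one scaleC_scaleC)
  also have "\<dots> = (- a / c) *\<^sub>C x + (- b / c) *\<^sub>C y"
    by (simp add: cvec_simps divide_inverse_commute)
  finally show ?thesis by (rule that)
qed

lemma indep3_iff: "indep3 x y z \<longleftrightarrow> indep2 x y \<and> (\<forall>a b. z \<noteq> a *\<^sub>C x + b *\<^sub>C y)"
proof
  assume i: "indep3 x y z"
  have "indep2 x y"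
    unfolding indep2_def using indep3D[OF i, of _ _ 0] by auto
  moreover have "z \<noteq> a *\<^sub>C x + b *\<^sub>C y" for a b
    using indep3D[OF i, of a b "-1"] by (metis add.right_inverse cvec.scale_minus_left scaleC_one zero_neq_neg_one)
  ultimately show "indep2 x y \<and> (\<forall>a b. z \<noteq> a *\<^sub>C x + b *\<^sub>C y)" by blast
next
  assume "indep2 x y \<and> (\<forall>a b. z \<noteq> a *\<^sub>C x + b *\<^sub>C y)"
  then show "indep3 x y z" using not_indep3[of x y z] by blast
qed

text \<open>Gaussian elimination turns separating functionals into a biorthogonal system.\<close>

lemma dual_pair:
  fixes x y :: "'a::complex_normed_vector"
  assumes "indep2 x y"
  obtains f g :: "'a cdual"
  where "f x = 1" "f y = 0" "g x = 0" "g y = 1"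
proof -
  have ex: "\<exists>f :: 'a cdual. f x = 1 \<and> f y = 0" if i: "indep2 x y" for x y
  proof -
    obtain g :: "'a cdual" where g: "g y = 1"
      using separating_functional indep2_nonzero(2)[OF i] by metis
    have "x - g x *\<^sub>C y \<noteq> 0"
      using indep2D[OF i, of 1 "- g x"] by auto
    then obtain h :: "'a cdual" where h: "h (x - g x *\<^sub>C y) = 1"
      using separating_functional by metis
    show ?thesis
      by (rule exI[of _ "h - h y *\<^sub>C g"]) (use g h in \<open>simp add: mult.commute\<close>)
  qed
  show ?thesis using ex[OF assms] ex[OF indep2_sym[OF assms]] that by metis
qed

lemma dual_triple:
  fixes x y z :: "'a::complex_normed_vector"
  assumes i: "indep3 x y z"
  obtains f g h :: "'a cdual"
  where "f x = 1" "f y = 0" "f z = 0" "g x = 0" "g y = 1" "g z = 0" "h x = 0" "h y = 0" "h z = 1"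
proof -
  obtain f g :: "'a cdual" where fg: "f x = 1" "f y = 0" "g x = 0" "g y = 1"
    using dual_pair i indep3_iff by metis
  have "z - f z *\<^sub>C x - g z *\<^sub>C y \<noteq> 0"
    using indep3D[OF i, of "- f z" "- g z" 1] by (auto simp: algebra_simps)
  then obtain k :: "'a cdual" where k: "k (z - f z *\<^sub>C x - g z *\<^sub>C y) = 1"
    using separating_functional by metis
  define h where "h = k - k x *\<^sub>C f - k y *\<^sub>C g"
  have h: "h x = 0" "h y = 0" "h z = 1"
    using fg k by (simp_all add: h_def algebra_simps)
  show ?thesis
    by (rule that[of "f - f z *\<^sub>C h" "g - g z *\<^sub>C h" h]) (use fg h in simp_all)
qed

section \<open>Completeness of the dual and weak boundedness\<close>

lemma norm_cblinfun_bound: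
  assumes "K \<ge> 0" "\<And>x. norm (cblinfun_apply A x) \<le> K * norm x"
  shows "norm A \<le> K"
  using assms by transfer (rule onorm_bound)

lemma norm_cblinfun_apply: "norm (cblinfun_apply A x) \<le> norm A * norm x"
  by transfer (auto simp: bounded_clinear_def intro: onorm)

text \<open>A limit in the complete space of bounded real-linear maps is a pointwise limit, hence again
  complex-linear. The instance is needed for the dual space, on which the isomorphism of the second
  form is defined.\<close>

instance cblinfun :: (complex_normed_vector, complex_banach) complex_banach
proof
  fix X :: "nat \<Rightarrow> 'a \<Rightarrow>\<^sub>C\<^sub>L 'b"
  assume X: "Cauchy X"
  define B where "B A = Blinfun (cblinfun_apply A)" for A :: "'a \<Rightarrow>\<^sub>C\<^sub>L 'b"
  have B: "blinfun_apply (B A) = cblinfun_apply A" for A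
    unfolding B_def by (rule bounded_linear_Blinfun_apply[OF bounded_linear_apply])
  have norm_B: "norm (B A - B A') = norm (A - A')" for A A'
  proof -
    have "blinfun_apply (B A - B A') = cblinfun_apply (A - A')"
      by (simp add: fun_eq_iff B minus_blinfun.rep_eq)
    then show ?thesis by (simp add: norm_blinfun.rep_eq norm_cblinfun.rep_eq)
  qed
  have "Cauchy (\<lambda>n. B (X n))"
    using X by (simp add: Cauchy_iff norm_B)
  then obtain L where L: "(\<lambda>n. B (X n)) \<longlonglongrightarrow> L"
    using Cauchy_convergent_iff convergent_def by blast
  have ptw: "(\<lambda>n. X n x) \<longlonglongrightarrow> blinfun_apply L x" for x
    using blinfun.tendsto[OF L tendsto_const[of x]] by (simp add: B)
  have "blinfun_apply L (c *\<^sub>C x) = c *\<^sub>C blinfun_apply L x" for c x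
  proof (rule LIMSEQ_unique[OF ptw])
    show "(\<lambda>n. X n (c *\<^sub>C x)) \<longlonglongrightarrow> c *\<^sub>C blinfun_apply L x"
      using bounded_linear.tendsto[OF bounded_linear_scaleC ptw, of c x] by simp
  qed
  then have "bounded_clinear (blinfun_apply L)"
    by (simp add: bounded_clinear_def blinfun.bounded_linear_right)
  then obtain A :: "'a \<Rightarrow>\<^sub>C\<^sub>L 'b" where A: "\<And>x. A x = blinfun_apply L x"
    using ex_cblinfunI by blast
  have "B A = L" by (rule blinfun_eqI) (simp add: B A)
  then have "(\<lambda>n. norm (X n - A)) \<longlonglongrightarrow> 0"
    using tendsto_norm_zero[OF LIM_zero[OF L]] by (simp flip: norm_B)
  then have "X \<longlonglongrightarrow> A"
    by (rule LIM_zero_cancel[OF tendsto_norm_zero_cancel])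
  then show "convergent X" by (auto simp: convergent_def)
qed

text \<open>The sets of all \<open>x\<close> with \<open>norm (F x) \<le> n\<close> are closed, since the norm is tested by the bounded
  functionals \<open>h \<circ> F\<close>, and they cover the space. By Baire's theorem one of them contains a ball, and the
  differences of points of this ball bound \<open>F\<close> on the unit ball.\<close>

lemma bounded_if_tested:
  fixes F :: "'a::complex_banach \<Rightarrow> 'b::complex_normed_vector" and N :: "'b cdual set"
  assumes add: "\<And>x y. F (x + y) = F x + F y" and scale: "\<And>c x. F (c *\<^sub>C x) = c *\<^sub>C F x"
    and norming: "\<And>y K. K \<ge> 0 \<Longrightarrow> (\<And>h. h \<in> N \<Longrightarrow> cmod (cblinfun_apply h y) \<le> K) \<Longrightarrow> norm y \<le> K"
    and contraction: "\<And>h y. h \<in> N \<Longrightarrow> cmod (cblinfun_apply h y) \<le> norm y"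
    and weak: "\<And>h. h \<in> N \<Longrightarrow> \<exists>k :: 'a cdual. \<forall>x. cblinfun_apply h (F x) = k x"
  shows "bounded_clinear F"
proof -
  define E where "E n = {x. norm (F x) \<le> real n}" for n :: nat
  have E_alt: "E n = (\<Inter>h \<in> N. {x. cmod (cblinfun_apply h (F x)) \<le> real n})" for n
  proof (intro set_eqI iffI)
    fix x assume "x \<in> E n"
    then have "cmod (cblinfun_apply h (F x)) \<le> real n" if "h \<in> N" for h
      using contraction[OF that, of "F x"] by (simp add: E_def)
    then show "x \<in> (\<Inter>h \<in> N. {x. cmod (cblinfun_apply h (F x)) \<le> real n})" by simp
  next
    fix x assume "x \<in> (\<Inter>h \<in> N. {x. cmod (cblinfun_apply h (F x)) \<le> real n})"
    then show "x \<in> E n" unfolding E_def using norming[of "real n" "F x"] by simp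
  qed
  have closed: "closed (E n)" for n
    unfolding E_alt
  proof (intro closed_INT ballI)
    fix h :: "'b cdual" assume "h \<in> N"
    then obtain k :: "'a cdual" where k: "\<forall>x. h (F x) = k x" using weak by blast
    have "continuous_on UNIV (cblinfun_apply k)"
      by (rule linear_continuous_on[OF bounded_linear_apply])
    then show "closed {x. cmod (h (F x)) \<le> real n}"
      using k by (auto intro!: closed_Collect_le continuous_intros)
  qed
  have "(\<Union>n. E n) = UNIV"
    by (auto simp: E_def real_arch_simple)
  have "\<exists>n. interior (E n) \<noteq> {}"
  proof (rule ccontr)
    assume "\<not> ?thesis"
    then have empty: "interior (E n) = {}" for n by blast
    have "Met_TC.mtopology interior_of (\<Union>(range E)) = {}"
    proof (rule Met_TC.metric_Baire_category_alt)
      show "Met_TC.mcomplete TYPE('a)"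
        by (simp add: complete_UNIV)
      fix T assume "T \<in> range E"
      then show "closedin Met_TC.mtopology T \<and> Met_TC.mtopology interior_of T = {}"
        using closed empty by (auto simp: closed_closedin[symmetric])
    qed simp
    then show False using \<open>(\<Union>n. E n) = UNIV\<close> by simp
  qed
  then obtain n x0 e where e: "e > 0" "ball x0 e \<subseteq> E n"
    by (metis all_not_in_conv mem_interior)
  have F0: "F 0 = 0" using scale[of 0 0] by simp
  have "norm (F x) \<le> (4 * real n / e) * norm x" for x
  proof (cases "x = 0")
    case False
    define t where "t = e / (2 * norm x)"
    have t: "t > 0" using False e by (simp add: t_def)
    define y where "y = complex_of_real t *\<^sub>C x"
    have "norm y < e" using False e t by (simp add: y_def norm_scaleC) (simp add: t_def)
    then have "x0 + y \<in> E n" "x0 \<in> E n"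
      using e by (auto simp: dist_norm subset_iff)
    then have "norm (F (x0 + y) - F x0) \<le> real n + real n"
      unfolding E_def by (intro order_trans[OF norm_triangle_ineq4]) simp
    then have "t * norm (F x) \<le> 2 * real n"
      using t by (simp add: add y_def scale norm_scaleC)
    then show ?thesis using False e by (simp add: t_def field_simps)
  qed (simp add: F0)
  then show ?thesis using add scale by (rule bounded_clinearI[rotated 2])
qed

corollary weakly_bounded_imp_bounded:
  fixes F :: "'a::complex_banach \<Rightarrow> 'b::complex_normed_vector"
  assumes add: "\<And>x y. F (x + y) = F x + F y" and scale: "\<And>c x. F (c *\<^sub>C x) = c *\<^sub>C F x"
    and weak: "\<And>h :: 'b cdual. \<exists>k :: 'a cdual. \<forall>x. h (F x) = k x"
  shows "bounded_clinear F"
proof (rule bounded_if_tested[OF add scale, where N = "{h. \<forall>y. cmod (cblinfun_apply h y) \<le> norm y}"])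
  fix y :: 'b and K :: real
  assume *: "\<And>h. h \<in> {h. \<forall>y. cmod (cblinfun_apply h y) \<le> norm y} \<Longrightarrow> cmod (cblinfun_apply h y) \<le> K"
  obtain h :: "'b cdual" where h: "\<And>y. cmod (h y) \<le> norm y" "h y = norm y"
    using norming_functional[of y] by metis
  show "norm y \<le> K" using *[of h] h by simp
qed (use weak in auto)

text \<open>For maps into a dual space the evaluations at unit vectors suffice as test functionals.\<close>

corollary pointwise_bounded_imp_bounded:
  fixes F :: "'a::complex_banach \<Rightarrow> 'b::complex_normed_vector cdual"
  assumes add: "\<And>x y. F (x + y) = F x + F y" and scale: "\<And>c x. F (c *\<^sub>C x) = c *\<^sub>C F x"
    and pointwise: "\<And>y. \<exists>k :: 'a cdual. \<forall>x. F x y = k x"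
  shows "bounded_clinear F"
proof (rule bounded_if_tested[OF add scale, where N = "canonical_embedding ` {y. norm y \<le> 1}"])
  fix f :: "'b cdual" and K :: real
  assume K: "K \<ge> 0"
    and *: "\<And>h. h \<in> canonical_embedding ` {y. norm y \<le> 1} \<Longrightarrow> cmod (cblinfun_apply h f) \<le> K"
  have unit: "cmod (f y) \<le> K" if "norm y \<le> 1" for y
    using *[of "canonical_embedding y"] that by (simp add: canonical_embedding.rep_eq)
  show "norm f \<le> K"
  proof (rule norm_cblinfun_bound[OF K])
    fix y
    show "cmod (f y) \<le> K * norm y"
    proof (cases "y = 0")
      case False
      define c where "c = complex_of_real (inverse (norm y))"
      have "cmod (f (c *\<^sub>C y)) \<le> K" by (rule unit) (simp add: c_def norm_scaleC norm_inverse False)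
      then have "inverse (norm y) * cmod (f y) \<le> K" by (simp add: c_def norm_mult norm_inverse)
      then show ?thesis using False by (simp add: field_simps)
    qed simp
  qed
next
  fix h :: "'b cdual cdual" and f :: "'b cdual"
  assume "h \<in> canonical_embedding ` {y. norm y \<le> 1}"
  then obtain y where y: "norm y \<le> 1" "cblinfun_apply h f = cblinfun_apply f y"
    by (auto simp: canonical_embedding.rep_eq)
  have "cmod (f y) \<le> norm f * norm y" by (rule norm_cblinfun_apply)
  also have "\<dots> \<le> norm f * 1" by (rule mult_left_mono) (use y in auto)
  finally show "cmod (h f) \<le> norm f" using y by simp
qed (use pointwise in \<open>auto simp: canonical_embedding.rep_eq\<close>)

section \<open>Common non-zeros of finitely many linear maps\<close>

text \<open>Linearity without boundedness, for maps that are only afterwards shown to be bounded.\<close>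

definition clin :: "('v::complex_normed_vector \<Rightarrow> 'w::complex_normed_vector) \<Rightarrow> bool"
  where "clin L \<longleftrightarrow> (\<forall>x y. L (x + y) = L x + L y) \<and> (\<forall>c x. L (c *\<^sub>C x) = c *\<^sub>C L x)"

definition bilin ::
  "('v::complex_normed_vector \<Rightarrow> 'w::complex_normed_vector \<Rightarrow> complex) \<Rightarrow> bool"
  where "bilin e \<longleftrightarrow> (\<forall>y. clin (\<lambda>x. e x y)) \<and> (\<forall>x. clin (e x))"

lemma clin_simps:
  assumes "clin L"
  shows "L (x + y) = L x + L y" "L (c *\<^sub>C x) = c *\<^sub>C L x" "L 0 = 0" "L (x - y) = L x - L y"
    "L (- x) = - L x"
proof -
  show add: "L (x + y) = L x + L y" for x y using assms by (simp add: clin_def)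
  show sc: "L (c *\<^sub>C x) = c *\<^sub>C L x" for c x using assms by (simp add: clin_def)
  show "L 0 = 0" using sc[of 0 0] by simp
  show m: "L (- x) = - L x" for x using sc[of "-1" x] by simp
  show "L (x - y) = L x - L y" using add[of x "- y"] m[of y] by simp
qed

lemma clin_apply [simp]: "clin (cblinfun_apply A)"
  by (simp add: clin_def)

lemma bilinD: "bilin e \<Longrightarrow> clin (\<lambda>x. e x y)" "bilin e \<Longrightarrow> clin (e x)"
  by (auto simp: bilin_def)

text \<open>If \<open>v\<close> works for all maps but the last and \<open>u\<close> for the last one, then on the line \<open>v + t u\<close>
  each of the maps vanishes for at most one \<open>t\<close>.\<close>

lemma common_nonzero:
  fixes L :: "'i \<Rightarrow> 'v::complex_normed_vector \<Rightarrow> 'w::complex_normed_vector"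
  assumes "finite I" "\<And>i. i \<in> I \<Longrightarrow> clin (L i)" "\<And>i. i \<in> I \<Longrightarrow> \<exists>v. L i v \<noteq> 0"
  shows "\<exists>v. \<forall>i\<in>I. L i v \<noteq> 0"
  using assms
proof (induction I rule: finite_induct)
  case (insert j I)
  obtain v where v: "\<And>i. i \<in> I \<Longrightarrow> L i v \<noteq> 0" using insert by auto
  obtain u where u: "L j u \<noteq> 0" using insert.prems(2)[of j] by auto
  define bad where "bad i = {t. L i (v + t *\<^sub>C u) = 0}" for i
  have "finite (bad i)" if "i \<in> insert j I" for i
  proof -
    have lin: "clin (L i)" using insert.prems that by auto
    have "s = t" if st: "s \<in> bad i" "t \<in> bad i" for s t
    proof (rule ccontr)
      assume ne: "s \<noteq> t"
      have s: "L i v + s *\<^sub>C L i u = 0" and t: "L i v + t *\<^sub>C L i u = 0"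
        using st by (auto simp: bad_def clin_simps[OF lin])
      have "s *\<^sub>C L i u = t *\<^sub>C L i u"
        using s t by (metis add_left_imp_eq)
      then have "(s - t) *\<^sub>C L i u = 0" by (simp add: cvec_simps)
      then have "L i u = 0" using ne by (simp add: scaleC_eq_0_iff)
      with s have "L i v = 0" by simp
      with v u \<open>L i u = 0\<close> \<open>i \<in> insert j I\<close> show False by auto
    qed
    then show ?thesis
      by (metis finite.simps finite_subset insert_iff subsetI)
  qed
  then have "finite (\<Union>i\<in>insert j I. bad i)"
    using insert.hyps by blast
  then obtain t where "t \<notin> (\<Union>i\<in>insert j I. bad i)"
    using ex_new_if_finite infinite_UNIV_char_0 by blast
  then show ?case by (auto simp: bad_def)
qed simp

lemma common_nonzero_bilin:
  assumes "finite E" "\<And>e. e \<in> E \<Longrightarrow> bilin e" "\<And>e. e \<in> E \<Longrightarrow> \<exists>x y. e x y \<noteq> 0"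
  shows "\<exists>x y. \<forall>e\<in>E. e x y \<noteq> 0"
proof -
  obtain y where y: "\<And>e. e \<in> E \<Longrightarrow> \<exists>x. e x (y e) \<noteq> 0"
    using assms(3) by metis
  have "\<exists>x. \<forall>e\<in>E. e x (y e) \<noteq> 0"
    using assms(1) y by (intro common_nonzero) (auto intro: bilinD assms(2))
  then obtain x where x: "\<And>e. e \<in> E \<Longrightarrow> e x (y e) \<noteq> 0" by blast
  have "\<exists>y. \<forall>e\<in>E. e x y \<noteq> 0"
    using assms(1) x by (intro common_nonzero) (auto intro: bilinD assms(2))
  then show ?thesis by blast
qed

lemma common_nonzero_functional:
  fixes V :: "'a::complex_normed_vector set"
  assumes "finite V" "0 \<notin> V"
  obtains h :: "'a cdual" where "\<And>v. v \<in> V \<Longrightarrow> h v \<noteq> 0"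
proof -
  have "\<exists>h :: 'a cdual. \<forall>v\<in>V. h v \<noteq> 0"
  proof (rule common_nonzero[OF assms(1)])
    fix v assume v: "v \<in> V"
    show "clin (\<lambda>h :: 'a cdual. h v)" by (simp add: clin_def)
    have "v \<noteq> 0" using v assms(2) by auto
    then show "\<exists>h :: 'a cdual. h v \<noteq> 0"
      using separating_functional by (metis zero_neq_one)
  qed
  then show ?thesis using that by blast
qed

lemma quadratic_zero:
  fixes a b c :: complex
  assumes "finite F" "\<And>t. t \<notin> F \<Longrightarrow> a + b * t + c * t\<^sup>2 = 0"
  shows "a = 0 \<and> b = 0 \<and> c = 0"
proof -
  have "poly [:a, b, c:] t = 0" if "t \<notin> F" for t
    using assms(2)[OF that] by (simp add: algebra_simps power2_eq_square)
  then have "- F \<subseteq> {t. poly [:a, b, c:] t = 0}" by auto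
  moreover have "infinite (- F)"
    using assms(1) infinite_UNIV_char_0 by (metis Compl_eq_Diff_UNIV Diff_infinite_finite)
  ultimately have "[:a, b, c:] = 0"
    using poly_roots_finite infinite_super by blast
  then show ?thesis by simp
qed

text \<open>If \<open>h y0 * h y2 = (h y1)\<^sup>2\<close> holds for the functionals \<open>h\<close> that do not vanish on \<open>V\<close>, it holds
  for all, because along a line of functionals it is a polynomial identity. A functional that kills
  \<open>y0\<close> then kills \<open>y1\<close>, so the three vectors are in geometric progression.\<close>

lemma conic_functionals:
  fixes y0 y1 y2 :: "'a::complex_normed_vector"
  assumes V: "finite V" "0 \<notin> V" and y0: "y0 \<noteq> 0"
    and conic: "\<And>h :: 'a cdual. (\<And>v. v \<in> V \<Longrightarrow> h v \<noteq> 0) \<Longrightarrow> h y0 * h y2 = (h y1)\<^sup>2"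
  obtains \<mu> where "y1 = \<mu> *\<^sub>C y0" "y2 = \<mu>\<^sup>2 *\<^sub>C y0"
proof -
  obtain k :: "'a cdual" where k: "\<And>v. v \<in> V \<Longrightarrow> k v \<noteq> 0"
    using common_nonzero_functional[OF V] by metis
  have all: "h y0 * h y2 = (h y1)\<^sup>2" for h :: "'a cdual"
  proof -
    define F where "F = (\<lambda>v. - h v / k v) ` V"
    have *: "(h y0 * h y2 - (h y1)\<^sup>2) + (h y0 * k y2 + k y0 * h y2 - 2 * h y1 * k y1) * t
        + (k y0 * k y2 - (k y1)\<^sup>2) * t\<^sup>2 = 0" if t: "t \<notin> F" for t
    proof -
      have "(h + t *\<^sub>C k) v \<noteq> 0" if v: "v \<in> V" for v
      proof
        assume "(h + t *\<^sub>C k) v = 0"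
        then have "t = - h v / k v" using k[OF v] by (simp add: field_simps eq_neg_iff_add_eq_0)
        then show False using t v by (auto simp: F_def)
      qed
      from conic[OF this] show ?thesis by (simp add: algebra_simps power2_eq_square)
    qed
    have "finite F" using V(1) by (simp add: F_def)
    from quadratic_zero[OF this *] show ?thesis by simp
  qed
  have "\<not> indep2 y0 y1"
  proof
    assume "indep2 y0 y1"
    then obtain f g :: "'a cdual" where "g y0 = 0" "g y1 = 1" using dual_pair by metis
    with all[of g] show False by simp
  qed
  then obtain \<mu> where \<mu>: "y1 = \<mu> *\<^sub>C y0" using not_indep2 y0 by metis
  have "y2 = \<mu>\<^sup>2 *\<^sub>C y0"
  proof (rule ccontr)
    assume ne: "y2 \<noteq> \<mu>\<^sup>2 *\<^sub>C y0"
    obtain h :: "'a cdual" where h: "\<And>v. v \<in> {y0, y2 - \<mu>\<^sup>2 *\<^sub>C y0} \<Longrightarrow> h v \<noteq> 0"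
      using common_nonzero_functional[of "{y0, y2 - \<mu>\<^sup>2 *\<^sub>C y0}"] ne y0 by auto
    have "h y0 * h (y2 - \<mu>\<^sup>2 *\<^sub>C y0) = 0"
      using all[of h] by (simp add: \<mu> algebra_simps power2_eq_square)
    with h[of y0] h[of "y2 - \<mu>\<^sup>2 *\<^sub>C y0"] show False by simp
  qed
  with \<mu> show ?thesis by (rule that)
qed

section \<open>Generalized Jordan products with an operator of rank one\<close>

text \<open>The generalized Jordan product whose distinguished factor is \<open>A\<close> and whose other factors are
  all \<open>B\<close>.\<close>

definition jordan_pair :: "nat \<Rightarrow> nat \<Rightarrow> ('a::complex_normed_vector \<Rightarrow>\<^sub>C\<^sub>L 'a) \<Rightarrow> ('a \<Rightarrow>\<^sub>C\<^sub>L 'a) \<Rightarrow> 'a \<Rightarrow>\<^sub>C\<^sub>L 'a"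
  where "jordan_pair r s A B =
    opow B r o\<^sub>C\<^sub>L A o\<^sub>C\<^sub>L opow B s + opow B s o\<^sub>C\<^sub>L A o\<^sub>C\<^sub>L opow B r"

lemma jordan_pair_apply:
  "cblinfun_apply (jordan_pair r s A B) x = opow B r (A (opow B s x)) + opow B s (A (opow B r x))"
  by (simp add: jordan_pair_def)

text \<open>The shape of all spectra that occur: two eigenvalues with mean \<open>p\<close> and squared half-difference
  \<open>q\<close>, of which only the nonzero ones are recorded.\<close>

definition root_set :: "complex \<Rightarrow> complex \<Rightarrow> complex set"
  where "root_set p q = {c. c \<noteq> 0 \<and> (c - p)\<^sup>2 = q}"

lemma nzspec_pair:
  fixes f g :: "'a::complex_normed_vector cdual"
  assumes "f x = p" "g y = p" "f y * g x = q"
  shows "nzspec (tensor x f + tensor y g) = root_set p q"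
proof -
  have "c \<in> spectrum (tensor x f + tensor y g) \<longleftrightarrow> (c - p)\<^sup>2 = q" if "c \<noteq> 0" for c
    unfolding nzspec_rank_two[OF that] assms
    by (auto simp: algebra_simps power2_eq_square)
  then show ?thesis by (auto simp: nzspec_def root_set_def)
qed

lemma nzspec_jordan_pair_tensor:
  fixes h :: "'a::complex_normed_vector cdual"
  shows "nzspec (jordan_pair r s (tensor z h) S) =
    root_set (h (opow S (r + s) z)) (h (opow S (2 * s) z) * h (opow S (2 * r) z))"
proof -
  have "jordan_pair r s (tensor z h) S =
      tensor (opow S r z) (h o\<^sub>C\<^sub>L opow S s) + tensor (opow S s z) (h o\<^sub>C\<^sub>L opow S r)"
    by (rule cblinfun_eqI) (simp add: jordan_pair_apply)
  also have "nzspec \<dots> =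
      root_set (h (opow S (r + s) z)) (h (opow S (2 * s) z) * h (opow S (2 * r) z))"
  proof (rule nzspec_pair)
    show "(h o\<^sub>C\<^sub>L opow S s) (opow S r z) = h (opow S (r + s) z)"
      by (simp add: opow_add opow_commute[of S s r])
  qed (simp_all add: opow_add mult_2)
  finally show ?thesis .
qed

text \<open>The squared half-difference: if factors stand on both sides, then one of the two eigenvalues is
  \<open>0\<close> and the other one is \<open>2 p\<close>.\<close>

definition sq_term :: "nat \<Rightarrow> complex \<Rightarrow> complex \<Rightarrow> complex"
  where "sq_term s p q = (if s = 0 then q else p\<^sup>2)"

lemma nzspec_jordan_pair_idempotent:
  fixes f :: "'a::complex_normed_vector cdual"
  assumes fx: "f x = 1" and "r \<ge> 1"
  shows "nzspec (jordan_pair r s A (tensor x f)) = root_set (f (A x)) (sq_term s (f (A x)) (f (A (A x))))"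
proof (cases "s = 0")
  case True
  have "jordan_pair r s A (tensor x f) = tensor x (f o\<^sub>C\<^sub>L A) + tensor (A x) f"
    by (rule cblinfun_eqI)
      (simp add: jordan_pair_apply True opow_idempotent_tensor[of f x, OF fx \<open>r \<ge> 1\<close>])
  also have "nzspec \<dots> = root_set (f (A x)) (f (A (A x)))"
    by (rule nzspec_pair) (simp_all add: fx)
  finally show ?thesis by (simp add: sq_term_def True)
next
  case False
  then have s: "s \<ge> 1" by simp
  have "jordan_pair r s A (tensor x f) = tensor x (f (A x) *\<^sub>C f) + tensor x (f (A x) *\<^sub>C f)"
    by (rule cblinfun_eqI)
      (simp add: jordan_pair_apply opow_idempotent_tensor[of f x, OF fx \<open>r \<ge> 1\<close>]
        opow_idempotent_tensor[of f x, OF fx s] fx scaleC_scaleC mult.commute)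
  also have "nzspec \<dots> = root_set (f (A x)) ((f (A x))\<^sup>2)"
    by (rule nzspec_pair) (simp_all add: fx power2_eq_square)
  finally show ?thesis using False by (simp add: sq_term_def)
qed

text \<open>The set shows both roots up to one ambiguity: a single nonzero value may be a double root or a
  simple root accompanied by the root \<open>0\<close>.\<close>

lemma root_set_eqD:
  assumes "root_set p q = root_set p' q'"
  shows "p = p' \<and> q = q' \<or> p = 2 * p' \<and> q = 0 \<and> q' = p'\<^sup>2 \<or> p' = 2 * p \<and> q' = 0 \<and> q = p\<^sup>2"
proof -
  define w w' where "w = csqrt q" and "w' = csqrt q'"
  have q: "q = w\<^sup>2" "q' = w'\<^sup>2" by (simp_all add: w_def w'_def)
  have rs: "root_set p (w\<^sup>2) = {p + w, p - w} - {0}" for p w :: complex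
    by (auto simp: root_set_def power2_eq_iff algebra_simps)
  define a b a' b' where ab: "a = p + w" "b = p - w" "a' = p' + w'" "b' = p' - w'"
  have eq: "{a, b} - {0} = {a', b'} - {0}"
    using assms by (simp add: q rs ab)
  have p: "2 * p = a + b" "2 * p' = a' + b'" "4 * q = (a - b)\<^sup>2" "4 * q' = (a' - b')\<^sup>2"
    by (simp_all add: ab q algebra_simps power2_eq_square)
  consider "a = a' \<and> b = b' \<or> a = b' \<and> b = a'"
    | "a = b" "a' = a \<and> b' = 0 \<or> a' = 0 \<and> b' = a"
    | "a' = b'" "a = a' \<and> b = 0 \<or> a = 0 \<and> b = a'"
  proof -
    have "a = 0 \<or> a = a' \<or> a = b'" "b = 0 \<or> b = a' \<or> b = b'"
      "a' = 0 \<or> a' = a \<or> a' = b" "b' = 0 \<or> b' = a \<or> b' = b"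
      using eq by blast+
    then have "(a = a' \<and> b = b' \<or> a = b' \<and> b = a') \<or>
        a = b \<and> (a' = a \<and> b' = 0 \<or> a' = 0 \<and> b' = a) \<or>
        a' = b' \<and> (a = a' \<and> b = 0 \<or> a = 0 \<and> b = a')"
      by metis
    then show ?thesis using that by blast
  qed
  then show ?thesis
  proof cases
    case 1
    then have "2 * p = 2 * p'" "4 * q = 4 * q'"
      unfolding p by (auto simp: power2_commute)
    then show ?thesis by simp
  next
    case 2
    then have "2 * p = 2 * (2 * p')" "4 * q = 0" "4 * q' = (2 * p')\<^sup>2"
      unfolding p by (auto simp: power2_commute)
    then show ?thesis by simp
  next
    case 3
    then have "2 * p' = 2 * (2 * p)" "4 * q' = 0" "4 * q = (2 * p)\<^sup>2"
      unfolding p by (auto simp: power2_commute)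
    then show ?thesis by simp
  qed
qed

lemma root_set_no_three:
  assumes "c1 \<in> root_set p q" "c2 \<in> root_set p q" "c3 \<in> root_set p q"
    and "c1 \<noteq> c2" "c1 \<noteq> c3" "c2 \<noteq> c3"
  shows False
proof -
  have "(c1 - p)\<^sup>2 = (c2 - p)\<^sup>2" "(c1 - p)\<^sup>2 = (c3 - p)\<^sup>2"
    using assms by (auto simp: root_set_def)
  then have "c1 - p = - (c2 - p)" "c1 - p = - (c3 - p)"
    using assms by (auto simp: power2_eq_iff)
  then have "c2 = c3" by (metis diff_add_cancel neg_equal_iff_equal)
  with assms show False by simp
qed

lemma root_set_square: "root_set p (p\<^sup>2) = {2 * p} - {0}"
  by (auto simp: root_set_def power2_eq_iff algebra_simps)

text \<open>Up to the ambiguity of the root sets, \<open>f (R x) = f (R' x)\<close> whenever \<open>f x = 1\<close>. If \<open>R x\<close> and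
  \<open>R' x\<close> differed, a functional \<open>f\<close> in general position would leave only \<open>R x = 2 R' x\<close> (or the reverse),
  together with \<open>f (R (R x)) = 0\<close> and \<open>f x * f (R' (R' x)) = (f (R' x))\<^sup>2\<close>. The latter makes \<open>x\<close> an
  eigenvector of \<open>R'\<close> and hence of \<open>R\<close>, with a nonzero eigenvalue, which contradicts the former.\<close>

lemma jordan_pair_determines_operator:
  fixes R R' :: "'a::complex_normed_vector \<Rightarrow>\<^sub>C\<^sub>L 'a"
  assumes r: "r \<ge> 1"
    and eq: "\<And>x f. cblinfun_apply f x = 1 \<Longrightarrow> nzspec (jordan_pair r s R (tensor x f)) = nzspec (jordan_pair r s R' (tensor x f))"
  shows "R = R'"
proof -
  define alt where "alt A B x f \<longleftrightarrow> f (A x) = 2 * f (B x) \<and> s = 0 \<and> f (A (A x)) = 0 \<and>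
    f x * f (B (B x)) = (f (B x))\<^sup>2" for A B :: "'a \<Rightarrow>\<^sub>C\<^sub>L 'a" and x and f :: "'a cdual"
  have cases: "f (R x) = f (R' x) \<or> alt R R' x f \<or> alt R' R x f"
    if fx: "f x \<noteq> 0" for x and f :: "'a cdual"
  proof -
    define g where "g = inverse (f x) *\<^sub>C f"
    have gx: "g x = 1" using fx by (simp add: g_def)
    have f: "f y = f x * g y" for y using fx by (simp add: g_def)
    have "root_set (g (R x)) (sq_term s (g (R x)) (g (R (R x)))) =
        root_set (g (R' x)) (sq_term s (g (R' x)) (g (R' (R' x))))"
      using eq[OF gx] by (simp add: nzspec_jordan_pair_idempotent[of g x, OF gx r])
    from root_set_eqD[OF this] show ?thesis
      unfolding alt_def f[of "_ (_ :: 'a)"]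
      by (auto simp: sq_term_def power2_eq_square gx split: if_splits)
  qed
  have no_double: False
    if d: "A x = 2 *\<^sub>C B x" and nz: "B x \<noteq> 0"
      and c: "\<And>f. cblinfun_apply f x \<noteq> 0 \<Longrightarrow> f (A x) = f (B x) \<or> alt A B x f \<or> alt B A x f"
    for A B :: "'a \<Rightarrow>\<^sub>C\<^sub>L 'a" and x
  proof -
    have x: "x \<noteq> 0" using nz by auto
    have alt: "alt A B x f" if "f x \<noteq> 0" "f (B x) \<noteq> 0" for f :: "'a cdual"
      using c[OF that(1)] that(2) by (auto simp: alt_def d)
    obtain \<mu> where \<mu>: "B x = \<mu> *\<^sub>C x" "B (B x) = \<mu>\<^sup>2 *\<^sub>C x"
    proof (rule conic_functionals[of "{x, B x}" x "B (B x)" "B x"])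
      fix f :: "'a cdual" assume "\<And>v. v \<in> {x, B x} \<Longrightarrow> f v \<noteq> 0"
      then show "f x * f (B (B x)) = (f (B x))\<^sup>2" using alt[of f] by (auto simp: alt_def)
    qed (use x nz in auto)
    obtain f :: "'a cdual" where f: "f x = 1" using separating_functional[OF x] by metis
    have "A (A x) = (4 * \<mu>\<^sup>2) *\<^sub>C x"
      by (simp add: d \<mu>(1) scaleC_scaleC power2_eq_square)
    then have "f (A (A x)) \<noteq> 0" using nz \<mu>(1) f by auto
    then show False using alt[of f] f nz \<mu>(1) by (auto simp: alt_def)
  qed
  show ?thesis
  proof (rule cblinfun_eqI, rule ccontr)
    fix x assume ne: "R x \<noteq> R' x"
    \<comment> \<open>A functional that does not vanish on \<open>V\<close> detects each of these relations between the vectors.\<close>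
    define V where "V = {x, R x - R' x, R x - 2 *\<^sub>C R' x, R' x - 2 *\<^sub>C R x} - {0}"
    obtain f :: "'a cdual" where f: "\<And>v. v \<in> V \<Longrightarrow> f v \<noteq> 0"
      using common_nonzero_functional[of V] by (auto simp: V_def)
    have x: "x \<noteq> 0" using ne by auto
    have fx: "f x \<noteq> 0" using f[of x] x by (auto simp: V_def)
    have "f (R x) \<noteq> f (R' x)" using f[of "R x - R' x"] ne by (auto simp: V_def)
    with cases[OF fx] consider "alt R R' x f" | "alt R' R x f" by blast
    then show False
    proof cases
      case 1
      then have "f (R x - 2 *\<^sub>C R' x) = 0" by (simp add: alt_def)
      then have d: "R x = 2 *\<^sub>C R' x" using f[of "R x - 2 *\<^sub>C R' x"] by (auto simp: V_def)
      show False
      proof (rule no_double[OF d])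
        show "R' x \<noteq> 0" using ne d by auto
      qed (rule cases)
    next
      case 2
      then have "f (R' x - 2 *\<^sub>C R x) = 0" by (simp add: alt_def)
      then have d: "R' x = 2 *\<^sub>C R x" using f[of "R' x - 2 *\<^sub>C R x"] by (auto simp: V_def)
      show False
      proof (rule no_double[OF d])
        show "R x \<noteq> 0" using ne d by auto
        show "f (R' x) = f (R x) \<or> alt R' R x f \<or> alt R R' x f"
          if "cblinfun_apply f x \<noteq> 0" for f
          using cases[OF that] by (elim disjE) simp_all
      qed
    qed
  qed
qed

section \<open>Quadratic operators\<close>

lemma all_eigenvectors_imp_scalar:
  fixes M :: "'a::complex_normed_vector \<Rightarrow>\<^sub>C\<^sub>L 'a"
  assumes "\<And>x. \<not> indep2 x (M x)"
  obtains c where "\<And>x. M x = c *\<^sub>C x"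
proof -
  have ev: "\<exists>c. M x = c *\<^sub>C x" if "x \<noteq> 0" for x
    using not_indep2[OF assms that] by metis
  show ?thesis
  proof (cases "\<exists>x::'a. x \<noteq> 0")
    case False
    then have "M x = 0 *\<^sub>C x" for x by (metis cblinfun_apply_simps(4) cvec.scale_zero_left)
    then show ?thesis by (rule that)
  next
    case True
    then obtain x0 c where x0: "x0 \<noteq> 0" "M x0 = c *\<^sub>C x0" using ev by metis
    have "M x = c *\<^sub>C x" for x
    proof (cases "indep2 x0 x")
      case False
      then obtain a where "x = a *\<^sub>C x0" using not_indep2 x0 by metis
      then show ?thesis by (simp add: x0 scaleC_scaleC mult.commute)
    next
      case True
      then have "x \<noteq> 0" "x0 + x \<noteq> 0"
        using indep2D[OF True, of 0 1] indep2D[OF True, of 1 1] by auto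
      then obtain d e where d: "M x = d *\<^sub>C x" and e: "M (x0 + x) = e *\<^sub>C (x0 + x)"
        using ev by metis
      have "(c - e) *\<^sub>C x0 + (d - e) *\<^sub>C x = 0"
        using e by (simp add: x0 d cvec_simps algebra_simps)
      from indep2D[OF True this] show ?thesis using d by simp
    qed
    then show ?thesis by (rule that)
  qed
qed

lemma det3_zero:
  fixes a1 a2 a3 b1 b2 b3 c1 c2 c3 :: complex
  assumes "p \<noteq> 0 \<or> q \<noteq> 0 \<or> r \<noteq> 0"
    and a: "p * a1 + q * a2 + r * a3 = 0" and b: "p * b1 + q * b2 + r * b3 = 0"
    and c: "p * c1 + q * c2 + r * c3 = 0"
  shows "a1 * (b2 * c3 - b3 * c2) - a2 * (b1 * c3 - b3 * c1) + a3 * (b1 * c2 - b2 * c1) = 0"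
    (is "?D = 0")
proof -
  have "p * ?D = (p * a1 + q * a2 + r * a3) * (b2 * c3 - b3 * c2)
      - (p * b1 + q * b2 + r * b3) * (a2 * c3 - a3 * c2)
      + (p * c1 + q * c2 + r * c3) * (a2 * b3 - a3 * b2)"
    "q * ?D = - (p * a1 + q * a2 + r * a3) * (b1 * c3 - b3 * c1)
      + (p * b1 + q * b2 + r * b3) * (a1 * c3 - a3 * c1)
      - (p * c1 + q * c2 + r * c3) * (a1 * b3 - a3 * b1)"
    "r * ?D = (p * a1 + q * a2 + r * a3) * (b1 * c2 - b2 * c1)
      - (p * b1 + q * b2 + r * b3) * (a1 * c2 - a2 * c1)
      + (p * c1 + q * c2 + r * c3) * (a1 * b2 - a2 * b1)"
    by (simp_all add: algebra_simps)
  then show ?thesis using assms(1) unfolding a b c by auto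
qed

text \<open>For \<open>u = z + t w\<close> the vectors \<open>u\<close>, \<open>M u\<close>, \<open>M (M u)\<close> are dependent, so their determinant against
  three functionals vanishes for every \<open>t\<close>. With functionals dual to \<open>z\<close> and \<open>M z\<close> and a third one that kills
  both, the linear coefficient in \<open>t\<close> is the third functional at \<open>q(M) w\<close>, where \<open>q\<close> is the
  annihilating polynomial of \<open>z\<close>.\<close>

lemma locally_quadratic:
  fixes M :: "'a::complex_normed_vector \<Rightarrow>\<^sub>C\<^sub>L 'a"
  assumes dep: "\<And>x. \<not> indep3 x (M x) (M (M x))"
    and z: "indep2 z (M z)" and quad: "M (M z) = \<alpha> *\<^sub>C z + \<beta> *\<^sub>C M z"
  shows "\<exists>a b. M (M w) - \<beta> *\<^sub>C M w - \<alpha> *\<^sub>C w = a *\<^sub>C z + b *\<^sub>C M z"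
proof -
  define y where "y = M (M w) - \<beta> *\<^sub>C M w - \<alpha> *\<^sub>C w"
  have kills: "k y = 0" if k: "cblinfun_apply k z = 0" "cblinfun_apply k (M z) = 0" for k :: "'a cdual"
  proof -
    obtain f g :: "'a cdual" where fg: "f z = 1" "f (M z) = 0" "g z = 0" "g (M z) = 1"
      using dual_pair[OF z] by metis
    define a0 a1 a2 where "a0 = f w" "a1 = f (M w)" "a2 = f (M (M w))"
    define b0 b1 b2 where "b0 = g w" "b1 = g (M w)" "b2 = g (M (M w))"
    define c0 c1 c2 where "c0 = k w" "c1 = k (M w)" "c2 = k (M (M w))"
    have *: "(c2 - \<beta> * c1 - \<alpha> * c0)
        + (a0 * (c2 - \<beta> * c1) + (b1 * c2 - b2 * c1) + a1 * \<beta> * c0 + \<alpha> * b0 * c1 - \<alpha> * b1 * c0 - a2 * c0) * t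
        + (a0 * (b1 * c2 - b2 * c1) - a1 * (b0 * c2 - b2 * c0) + a2 * (b0 * c1 - b1 * c0)) * t\<^sup>2 = 0"
      if t: "t \<notin> {0}" for t
    proof -
      define u where "u = z + t *\<^sub>C w"
      obtain p q r where pqr: "p *\<^sub>C u + q *\<^sub>C M u + r *\<^sub>C M (M u) = 0" "p \<noteq> 0 \<or> q \<noteq> 0 \<or> r \<noteq> 0"
        using dep[of u] by (auto simp: indep3_def)
      have ap: "p * cblinfun_apply l u + q * l (M u) + r * l (M (M u)) = 0" for l :: "'a cdual"
        using arg_cong[OF pqr(1), of "cblinfun_apply l"] by simp
      have 1: "p * (1 + t * a0) + q * (t * a1) + r * (\<alpha> + t * a2) = 0"
        using ap[of f] by (simp add: u_def fg quad a0_a1_a2_def)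
      have 2: "p * (t * b0) + q * (1 + t * b1) + r * (\<beta> + t * b2) = 0"
        using ap[of g] by (simp add: u_def fg quad b0_b1_b2_def)
      have "t * (p * c0 + q * c1 + r * c2) = 0"
        using ap[of k] by (simp add: u_def k quad c0_c1_c2_def algebra_simps)
      then have 3: "p * c0 + q * c1 + r * c2 = 0" using t by simp
      from det3_zero[OF pqr(2) 1 2 3] show ?thesis
        by (simp add: algebra_simps power2_eq_square)
    qed
    have "finite {0 :: complex}" by simp
    from quadratic_zero[OF this *] have "c2 - \<beta> * c1 - \<alpha> * c0 = 0" by simp
    then show ?thesis by (simp add: y_def c0_c1_c2_def)
  qed
  have "\<not> indep3 z (M z) y"
  proof
    assume "indep3 z (M z) y"
    then obtain f g k :: "'a cdual" where "k z = 0" "k (M z) = 0" "k y = 1"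
      using dual_triple by metis
    with kills[of k] show False by simp
  qed
  then show ?thesis using not_indep3[OF _ z] unfolding y_def by metis
qed

text \<open>A form of Kaplansky's theorem on locally algebraic operators. Let \<open>q\<close> be the quadratic polynomial
  that annihilates \<open>z\<close>. The range of \<open>q(M)\<close> lies in the span of \<open>z\<close> and \<open>M z\<close>, which \<open>q(M)\<close> kills, so
  \<open>q(M)\<^sup>2 = 0\<close>. As \<open>M\<close> is neither invertible nor nilpotent, \<open>q\<close> has the roots \<open>0\<close> and \<open>\<beta> \<noteq> 0\<close>. If
  \<open>q(M) w \<noteq> 0\<close>, then a Jordan chain of length two exists for one of the two eigenvalues; adding to it an
  eigenvector for the other one gives a vector whose first three iterates are independent.\<close>

lemma quadratic_if_locally_dependent:
  fixes M :: "'a::complex_normed_vector \<Rightarrow>\<^sub>C\<^sub>L 'a"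
  assumes dep: "\<And>x. \<not> indep3 x (M x) (M (M x))"
    and z: "indep2 z (M z)"
    and ninv: "\<not> cblinfun_invertible M"
    and nnil: "M (M (M (M x0))) \<noteq> 0"
  obtains \<beta> where "\<beta> \<noteq> 0" "\<And>w. M (M w) = \<beta> *\<^sub>C M w"
proof -
  obtain \<alpha> \<beta> where quad: "M (M z) = \<alpha> *\<^sub>C z + \<beta> *\<^sub>C M z"
    using not_indep3[OF dep z] by metis
  have sq: "M (M (M (M w))) - (\<beta> + \<beta>) *\<^sub>C M (M (M w)) + (\<beta> * \<beta> - \<alpha> - \<alpha>) *\<^sub>C M (M w)
      + (\<alpha> * \<beta> + \<alpha> * \<beta>) *\<^sub>C M w + (\<alpha> * \<alpha>) *\<^sub>C w = 0" for w
  proof -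
    obtain a b where ab: "M (M w) - \<beta> *\<^sub>C M w - \<alpha> *\<^sub>C w = a *\<^sub>C z + b *\<^sub>C M z"
      using locally_quadratic[OF dep z quad] by blast
    define y where "y = M (M w) - \<beta> *\<^sub>C M w - \<alpha> *\<^sub>C w"
    have "M (M y) - \<beta> *\<^sub>C M y - \<alpha> *\<^sub>C y = 0"
      unfolding y_def ab by (simp add: quad cvec_simps mult.commute)
    moreover have "M (M (M (M w))) - (\<beta> + \<beta>) *\<^sub>C M (M (M w)) + (\<beta> * \<beta> - \<alpha> - \<alpha>) *\<^sub>C M (M w)
      + (\<alpha> * \<beta> + \<alpha> * \<beta>) *\<^sub>C M w + (\<alpha> * \<alpha>) *\<^sub>C w = M (M y) - \<beta> *\<^sub>C M y - \<alpha> *\<^sub>C y"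
      by (simp only: y_def cblinfun_apply_simps cvec_simps) (simp add: algebra_simps)
    ultimately show ?thesis by simp
  qed
  have \<alpha>: "\<alpha> = 0"
  proof (rule ccontr)
    assume "\<alpha> \<noteq> 0"
    define N where "N = (- inverse (\<alpha> * \<alpha>)) *\<^sub>C
      (M o\<^sub>C\<^sub>L M o\<^sub>C\<^sub>L M - (\<beta> + \<beta>) *\<^sub>C (M o\<^sub>C\<^sub>L M) + (\<beta> * \<beta> - \<alpha> - \<alpha>) *\<^sub>C M
        + (\<alpha> * \<beta> + \<alpha> * \<beta>) *\<^sub>C cblinfun_id)"
    have "M (M (M (M w))) - (\<beta> + \<beta>) *\<^sub>C M (M (M w)) + (\<beta> * \<beta> - \<alpha> - \<alpha>) *\<^sub>C M (M w)
      + (\<alpha> * \<beta> + \<alpha> * \<beta>) *\<^sub>C M w = (- (\<alpha> * \<alpha>)) *\<^sub>C w" for w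
      using sq[of w] by (simp add: add_eq_0_iff)
    moreover have "inverse \<alpha> * inverse \<alpha> * (\<alpha> * \<alpha>) = 1"
      using \<open>\<alpha> \<noteq> 0\<close> by (simp add: field_simps)
    ultimately have "N (M w) = w" "M (N w) = w" for w
      by (simp_all add: N_def scaleC_scaleC)
    then have "cblinfun_invertible M" by (rule cblinfun_invertibleI)
    with ninv show False ..
  qed
  have \<beta>: "\<beta> \<noteq> 0"
    using sq[of x0] nnil by (auto simp: \<alpha>)
  have sq': "M (M (M (M w))) = (\<beta> + \<beta>) *\<^sub>C M (M (M w)) - (\<beta> * \<beta>) *\<^sub>C M (M w)" for w
    using sq[of w] by (simp add: \<alpha> algebra_simps)
  define e e0 where "e = M z" and "e0 = M z - \<beta> *\<^sub>C z"
  have e: "M e = \<beta> *\<^sub>C e" "e \<noteq> 0"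
    using quad indep2_nonzero[OF z] by (simp_all add: e_def \<alpha>)
  have "e0 \<noteq> 0" using indep2D[OF z, of "- \<beta>" 1] by (auto simp: e0_def algebra_simps)
  have e0: "M e0 = 0" "e0 \<noteq> 0"
    using \<open>e0 \<noteq> 0\<close> quad by (simp_all add: e0_def \<alpha>)
  have "M (M w) = \<beta> *\<^sub>C M w" for w
  proof (rule ccontr)
    assume ne: "M (M w) \<noteq> \<beta> *\<^sub>C M w"
    \<comment> \<open>The component of \<open>w\<close> in the generalized kernel, up to an invertible factor.\<close>
    define a where "a = M (M w) - (\<beta> + \<beta>) *\<^sub>C M w + (\<beta> * \<beta>) *\<^sub>C w"
    have MMa: "M (M a) = 0" unfolding a_def by (simp add: sq')
    show False
    proof (cases "M a = 0")
      case False
      \<comment> \<open>The chain \<open>a\<close>, \<open>M a\<close> of length two belongs to the eigenvalue \<open>0\<close>.\<close>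
      define u where "u = a + e"
      have Mu: "M u = M a + \<beta> *\<^sub>C e" and MMu: "M (M u) = (\<beta> * \<beta>) *\<^sub>C e"
        by (simp_all add: u_def e MMa scaleC_scaleC power2_eq_square)
      have "p = 0 \<and> r = 0 \<and> s = 0" if "p *\<^sub>C u + r *\<^sub>C M u + s *\<^sub>C M (M u) = 0" for p r s
      proof -
        define P where "P = p + r * \<beta> + s * (\<beta> * \<beta>)"
        have 0: "p *\<^sub>C a + r *\<^sub>C M a + P *\<^sub>C e = 0"
          using that unfolding MMu unfolding Mu by (simp add: u_def P_def cvec_simps algebra_simps)
        have 1: "p *\<^sub>C M a + (P * \<beta>) *\<^sub>C e = 0"
          using arg_cong[OF 0, of M] by (simp add: e MMa scaleC_scaleC)
        have "(P * \<beta> * \<beta>) *\<^sub>C e = 0"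
          using arg_cong[OF 1, of M] by (simp add: e MMa scaleC_scaleC)
        then have P: "P = 0" using \<beta> e by (simp add: scaleC_eq_0_iff)
        then have "p = 0" using 1 False by (simp add: scaleC_eq_0_iff)
        moreover from this have "r = 0" using 0 P False by (simp add: scaleC_eq_0_iff)
        ultimately show ?thesis using P \<beta> by (simp add: P_def)
      qed
      then have "indep3 u (M u) (M (M u))" by (simp add: indep3_def)
      with dep show False ..
    next
      case True
      \<comment> \<open>Now the chain \<open>b\<close>, \<open>y\<close> of length two belongs to the eigenvalue \<open>\<beta>\<close>.\<close>
      define b y where "b = M w" and "y = M b - \<beta> *\<^sub>C b"
      have y: "y \<noteq> 0" using ne by (simp add: y_def b_def)
      have Mb: "M b = \<beta> *\<^sub>C b + y" by (simp add: y_def)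
      have My: "M y = \<beta> *\<^sub>C y"
      proof -
        have "M y - \<beta> *\<^sub>C y = M a"
          by (simp only: a_def y_def b_def cblinfun_apply_simps cvec_simps) (simp add: algebra_simps)
        with True show ?thesis by simp
      qed
      define u where "u = b + e0"
      have Mu: "M u = \<beta> *\<^sub>C b + y" by (simp add: u_def e0 Mb)
      have MMu: "M (M u) = (\<beta> * \<beta>) *\<^sub>C b + (\<beta> + \<beta>) *\<^sub>C y"
        unfolding Mu by (simp only: Mb My cblinfun_apply_simps cvec_simps) (simp add: algebra_simps)
      have "p = 0 \<and> r = 0 \<and> s = 0" if "p *\<^sub>C u + r *\<^sub>C M u + s *\<^sub>C M (M u) = 0" for p r s
      proof -
        define P where "P = p + r * \<beta> + s * (\<beta> * \<beta>)"
        define R where "R = r + s * (\<beta> + \<beta>)"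
        have 0: "p *\<^sub>C e0 + P *\<^sub>C b + R *\<^sub>C y = 0"
          using that unfolding MMu unfolding Mu by (simp add: u_def P_def R_def cvec_simps algebra_simps)
        have 1: "(P * \<beta>) *\<^sub>C b + (P + R * \<beta>) *\<^sub>C y = 0"
          using arg_cong[OF 0, of M] by (simp add: e0 Mb My cvec_simps algebra_simps)
        have 2: "((P * \<beta> * \<beta>) *\<^sub>C b + (P * \<beta>) *\<^sub>C y + (R * \<beta> * \<beta>) *\<^sub>C y) + (P * \<beta>) *\<^sub>C y = 0"
          using arg_cong[OF 1, of M] by (simp add: Mb My cvec_simps algebra_simps)
        moreover have "(P * \<beta> * \<beta>) *\<^sub>C b + (P * \<beta>) *\<^sub>C y + (R * \<beta> * \<beta>) *\<^sub>C y = 0"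
          using arg_cong[OF 1, of "\<lambda>v. \<beta> *\<^sub>C v"] by (simp add: cvec_simps algebra_simps)
        ultimately have "(P * \<beta>) *\<^sub>C y = 0" by simp
        then have P: "P = 0" using \<beta> y by (simp add: scaleC_eq_0_iff)
        then have R: "R = 0" using 1 \<beta> y by (simp add: scaleC_eq_0_iff)
        have p: "p = 0" using 0 P R e0 by (simp add: scaleC_eq_0_iff)
        have "(r + s * \<beta>) * \<beta> = 0" using P p by (simp add: P_def algebra_simps power2_eq_square)
        then have "r + s * \<beta> = 0" using \<beta> by simp
        moreover have "s * \<beta> = R - (r + s * \<beta>)" by (simp add: R_def algebra_simps)
        ultimately have "s * \<beta> = 0" using R by simp
        then show ?thesis using \<beta> p R by (simp add: R_def)
      qed
      then have "indep3 u (M u) (M (M u))" by (simp add: indep3_def)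
      with dep show False ..
    qed
  qed
  with \<beta> show ?thesis by (rule that)
qed

lemma rank_one_if_pairwise_dependent:
  fixes M :: "'a::complex_normed_vector \<Rightarrow>\<^sub>C\<^sub>L 'b::complex_normed_vector"
  assumes "v \<noteq> 0" "\<And>x. \<exists>c. M x = c *\<^sub>C v"
  obtains g where "M = tensor v g"
proof -
  obtain k :: "'b cdual" where k: "k v = 1" using separating_functional[OF assms(1)] by metis
  have "M = tensor v (k o\<^sub>C\<^sub>L M)"
  proof (rule cblinfun_eqI)
    fix x
    obtain c where "M x = c *\<^sub>C v" using assms(2) by blast
    then show "M x = tensor v (k o\<^sub>C\<^sub>L M) x" by (simp add: k)
  qed
  then show ?thesis by (rule that)
qed

section \<open>The image of an idempotent of rank one\<close>

text \<open>What is known about \<open>S = \<Phi> P\<close> for an idempotent \<open>P\<close> of rank one: the spectra of the products with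
  operators of rank at most three have the shape that they have for \<open>P\<close>, and the product of \<open>S\<close> with itself
  has the spectrum of \<open>2 P\<close>.\<close>

locale idempotent_image =
  fixes S :: "'a::complex_normed_vector \<Rightarrow>\<^sub>C\<^sub>L 'a" and r s :: nat
  assumes r1: "r \<ge> 1" and s_le_r: "s \<le> r"
    and few_eigenvalues: "\<And>z1 h1 z2 h2 z3 h3.
      \<exists>p q. nzspec (jordan_pair r s (tensor z1 h1 + tensor z2 h2 + tensor z3 h3) S) = root_set p (sq_term s p q)"
    and diagonal: "nzspec (jordan_pair r s S S) = {2}"
    and diagonal_singular: "0 \<in> spectrum (jordan_pair r s S S)"
begin

lemma diagonal_apply: "cblinfun_apply (jordan_pair r s S S) x = 2 *\<^sub>C opow S (r + s + 1) x"
proof -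
  have "opow S s (S (opow S r x)) = opow S (r + s + 1) x"
    "opow S r (S (opow S s x)) = opow S (r + s + 1) x"
    by (simp_all only: opow_add opow_Suc add_0_right opow_apply_0 One_nat_def
        opow_commute1 opow_commute[of S s r] add.commute[of _ "Suc 0"] opow_1)
  then show ?thesis
    by (simp add: jordan_pair_apply scaleC_add_left[of 1 1, simplified])
qed

text \<open>If \<open>Q = S\<^bsup>r+s+1\<^esup>\<close> satisfied \<open>Q\<^sup>4 = 0\<close>, then \<open>2 Q - 2\<close> would be inverted by a finite geometric
  series, although \<open>2\<close> is a spectral value of \<open>2 Q\<close>. The fourth power is the one that
  \<open>quadratic_if_locally_dependent\<close> asks for.\<close>

lemma not_nilpotent: "\<exists>x. opow S (4 * (r + s)) x \<noteq> 0"
proof (rule ccontr)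
  assume "\<not> ?thesis"
  then have nil: "opow S (4 * (r + s)) x = 0" for x by auto
  define Q where "Q = opow S (r + s + 1)"
  have Q4: "Q (Q (Q (Q x))) = 0" for x
  proof -
    have "4 + 4 * (r + s) = (r + s + 1) + ((r + s + 1) + ((r + s + 1) + (r + s + 1)))" by simp
    then have "Q (Q (Q (Q x))) = opow S (4 + 4 * (r + s)) x"
      unfolding Q_def opow_add[symmetric] by metis
    also have "\<dots> = opow S 4 (opow S (4 * (r + s)) x)" by (rule opow_add)
    finally show ?thesis unfolding nil by simp
  qed
  have dQ: "jordan_pair r s S S x = 2 *\<^sub>C Q x" for x
    by (simp only: diagonal_apply Q_def)
  have "cblinfun_invertible (jordan_pair r s S S - 2 *\<^sub>C cblinfun_id)"
    by (rule cblinfun_invertibleI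
        [of "- inverse 2 *\<^sub>C (Q o\<^sub>C\<^sub>L Q o\<^sub>C\<^sub>L Q + Q o\<^sub>C\<^sub>L Q + Q + cblinfun_id)"])
      (simp_all add: dQ Q4 scaleC_scaleC cvec_simps)
  then have "2 \<notin> spectrum (jordan_pair r s S S)" by (simp add: spectrum_def)
  with diagonal show False by (auto simp: nzspec_def)
qed

lemma not_square_zero: "\<exists>x. opow S (2 * (r + s)) x \<noteq> 0"
proof -
  obtain x where "opow S (4 * (r + s)) x \<noteq> 0" using not_nilpotent by blast
  moreover have "4 * (r + s) = 2 * (r + s) + 2 * (r + s)" by simp
  ultimately show ?thesis by (metis opow_add)
qed

lemma few_eigenvalues_1: "\<exists>p q. nzspec (jordan_pair r s (tensor z h) S) = root_set p (sq_term s p q)"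
proof -
  have "tensor z h + tensor 0 h + tensor 0 h = tensor z h"
    by (rule cblinfun_eqI) simp
  then show ?thesis using few_eigenvalues[of z h 0 h 0 h] by (simp only:)
qed

lemma few_eigenvalues_2:
  "\<exists>p q. nzspec (jordan_pair r s (tensor z1 h1 + tensor z2 h2) S) = root_set p (sq_term s p q)"
proof -
  have "tensor z1 h1 + tensor z2 h2 + tensor 0 h1 = tensor z1 h1 + tensor z2 h2"
    by (rule cblinfun_eqI) simp
  then show ?thesis using few_eigenvalues[of z1 h1 z2 h2 0 h1] by (simp only:)
qed

text \<open>\<open>S\<close> commutes with its power \<open>v \<otimes> g\<close>, so \<open>v\<close> is an eigenvector of \<open>S\<close>. Its eigenvalue \<open>w\<close> has
  \<open>2 w\<^bsup>r+s+1\<^esup> = 2\<close> because this is a nonzero spectral value of the diagonal product, and the trace is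
  \<open>w\<^bsup>r+s\<^esup>\<close>.\<close>

lemma trace_root_of_unity:
  assumes M: "opow S (r + s) = tensor v g" and gv: "g v \<noteq> 0"
  shows "(g v) ^ (r + s + 1) = 1"
proof -
  have v: "v \<noteq> 0" using gv by auto
  have "S (tensor v g v) = tensor v g (S v)"
    unfolding M[symmetric] by (simp add: opow_commute1)
  then have "g v *\<^sub>C S v = g (S v) *\<^sub>C v" by simp
  then have "inverse (g v) *\<^sub>C (g v *\<^sub>C S v) = inverse (g v) *\<^sub>C (g (S v) *\<^sub>C v)" by simp
  then have Sv: "S v = (g (S v) / g v) *\<^sub>C v"
    using gv by (simp add: scaleC_scaleC divide_inverse_commute)
  define w where "w = g (S v) / g v"
  have Sv: "S v = w *\<^sub>C v" using Sv by (simp add: w_def)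
  have "w ^ (r + s) *\<^sub>C v = g v *\<^sub>C v"
    using opow_eigen[OF Sv, of "r + s"] unfolding M tensor.rep_eq by (rule sym)
  then have gw: "g v = w ^ (r + s)" by (metis cvec.scale_right_imp_eq v)
  then have "w \<noteq> 0" using gv r1 by auto
  have "jordan_pair r s S S v = (2 * w ^ (r + s + 1)) *\<^sub>C v"
    unfolding diagonal_apply opow_eigen[OF Sv] by (simp add: scaleC_scaleC)
  then have "2 * w ^ (r + s + 1) \<in> spectrum (jordan_pair r s S S)"
    using v by (rule eigenvalue_in_spectrum)
  then have "2 * w ^ (r + s + 1) \<in> {2}"
    using \<open>w \<noteq> 0\<close> unfolding diagonal[symmetric] by (simp add: nzspec_def)
  then have "w ^ (r + s + 1) = 1" by simp
  then show ?thesis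
    unfolding gw by (metis power_commutes power_mult power_one mult.commute)
qed

subsection \<open>Operator factors on both sides\<close>

text \<open>Two independent eigenvectors \<open>u1\<close>, \<open>u2\<close> of \<open>S\<^bsup>r-s\<^esup>\<close> with the same eigenvalue \<open>\<mu>\<close> allow a test
  operator that sends \<open>S\<^bsup>2s\<^esup> u1\<close> to \<open>u1\<close> and \<open>S\<^bsup>2s\<^esup> u2\<close> to \<open>2 u2\<close>. Its product with \<open>S\<close> has the distinct
  nonzero eigenvalues \<open>2 \<mu>\<close> and \<open>4 \<mu>\<close>, one too many.\<close>

lemma no_eigenpair:
  assumes s: "s \<noteq> 0" and \<mu>: "\<mu> \<noteq> 0"
    and u: "opow S (r - s) u1 = \<mu> *\<^sub>C u1" "opow S (r - s) u2 = \<mu> *\<^sub>C u2"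
    and ind: "indep2 (opow S (2 * s) u1) (opow S (2 * s) u2)"
  shows False
proof -
  obtain f1 f2 :: "'a cdual" where f: "f1 (opow S (2 * s) u1) = 1" "f1 (opow S (2 * s) u2) = 0"
    "f2 (opow S (2 * s) u1) = 0" "f2 (opow S (2 * s) u2) = 1"
    using dual_pair[OF ind] by metis
  define C where "C = tensor u1 f1 + tensor (2 *\<^sub>C u2) f2"
  have C: "C (opow S (2 * s) u1) = u1" "C (opow S (2 * s) u2) = 2 *\<^sub>C u2"
    by (simp_all add: C_def f)
  have eig: "(2 * \<mu> * c) \<in> nzspec (jordan_pair r s C S)"
    if Cu: "C (opow S (2 * s) u) = c *\<^sub>C u" and Su: "opow S (r - s) u = \<mu> *\<^sub>C u"
      and nz: "opow S (2 * s) u \<noteq> 0" "c \<noteq> 0" for c u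
  proof -
    define w where "w = opow S s u"
    have Sw: "opow S s w = opow S (2 * s) u" by (simp add: w_def mult_2 opow_add)
    have r: "opow S r x = opow S s (opow S (r - s) x)" for x
      using s_le_r by (simp flip: opow_add)
    have Rw: "opow S r w = \<mu> *\<^sub>C opow S (2 * s) u"
    proof -
      have "opow S r w = opow S s (opow S s (opow S (r - s) u))"
        unfolding r w_def by (simp add: opow_commute)
      then show ?thesis by (simp add: Su mult_2 opow_add)
    qed
    have ru: "opow S r u = \<mu> *\<^sub>C w" unfolding r Su by (simp add: w_def)
    have "jordan_pair r s C S w = (2 * \<mu> * c) *\<^sub>C w"
      unfolding jordan_pair_apply Sw Rw
      by (simp add: Cu ru scaleC_scaleC w_def[symmetric] flip: scaleC_add_left)
    moreover have "w \<noteq> 0" using nz Sw by auto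
    ultimately show ?thesis
      using eigenvalue_in_spectrum[of "jordan_pair r s C S" w "2 * \<mu> * c"] \<mu> nz by (simp add: nzspec_def)
  qed
  obtain p q where pq: "nzspec (jordan_pair r s C S) = root_set p (sq_term s p q)"
    using few_eigenvalues_2 unfolding C_def by blast
  have "2 * \<mu> * 1 \<in> nzspec (jordan_pair r s C S)" "2 * \<mu> * 2 \<in> nzspec (jordan_pair r s C S)"
    using eig[of u1 1] eig[of u2 2] C u indep2_nonzero[OF ind] by simp_all
  then have "2 * \<mu> * 1 = 2 * p" "2 * \<mu> * 2 = 2 * p"
    using s by (auto simp: pq sq_term_def root_set_square)
  then show False using \<mu> by simp
qed

text \<open>The product of \<open>z \<otimes> h\<close> with \<open>S\<close> has at most one nonzero spectral value, which means that
  \<open>h (S\<^bsup>2s\<^esup> z) * h (S\<^bsup>2r\<^esup> z)\<close> is the square of \<open>h (S\<^bsup>r+s\<^esup> z)\<close> for \<open>h\<close> in general position.\<close>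

lemma generic_vector:
  assumes s: "s \<noteq> 0" and z: "opow S (2 * r) z \<noteq> 0"
  obtains \<mu> where "\<mu> \<noteq> 0" "opow S (r + s) z = \<mu> *\<^sub>C opow S (2 * s) z"
    "opow S (2 * r) z = \<mu>\<^sup>2 *\<^sub>C opow S (2 * s) z"
proof -
  have "2 * r = 2 * (r - s) + 2 * s" using s_le_r by simp
  then have "opow S (2 * s) z \<noteq> 0" using z by (metis opow_add cblinfun_apply_simps(4))
  moreover obtain \<mu> where \<mu>: "opow S (r + s) z = \<mu> *\<^sub>C opow S (2 * s) z"
    "opow S (2 * r) z = \<mu>\<^sup>2 *\<^sub>C opow S (2 * s) z"
  proof (rule conic_functionals[of "{opow S (2 * s) z, opow S (2 * r) z}" "opow S (2 * s) z"
        "opow S (2 * r) z" "opow S (r + s) z"])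
    fix h :: "'a cdual"
    assume "\<And>v. v \<in> {opow S (2 * s) z, opow S (2 * r) z} \<Longrightarrow> h v \<noteq> 0"
    then have h: "h (opow S (2 * s) z) \<noteq> 0" "h (opow S (2 * r) z) \<noteq> 0" by auto
    obtain p q where "nzspec (jordan_pair r s (tensor z h) S) = root_set p (sq_term s p q)"
      using few_eigenvalues_1 by blast
    then have "root_set (h (opow S (r + s) z)) (h (opow S (2 * s) z) * h (opow S (2 * r) z)) =
        root_set p (p\<^sup>2)"
      using s by (simp add: nzspec_jordan_pair_tensor sq_term_def)
    from root_set_eqD[OF this] h
    show "h (opow S (2 * s) z) * h (opow S (2 * r) z) = (h (opow S (r + s) z))\<^sup>2" by auto
  qed (use z \<open>opow S (2 * s) z \<noteq> 0\<close> in auto)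
  moreover have "\<mu> \<noteq> 0" using \<mu>(2) z by auto
  ultimately show ?thesis using that by blast
qed

text \<open>On the vectors \<open>S\<^bsup>2s\<^esup> z\<close> with \<open>S\<^bsup>2r\<^esup> z \<noteq> 0\<close> the operator \<open>S\<^bsup>r-s\<^esup>\<close> acts by nonzero scalars, which
  agree for independent vectors. Two independent vectors of this kind would be excluded by
  \<open>no_eigenpair\<close>; hence \<open>S\<^bsup>2s\<^esup>\<close> has rank one, and the higher powers are multiples of it.\<close>

lemma power_rank_one_two_sided:
  assumes s: "s \<noteq> 0"
  obtains v g where "opow S (r + s) = tensor v g" "g v \<noteq> 0"
    "\<And>z h. nzspec (jordan_pair r s (tensor z h) S) = root_set (h (opow S (r + s) z)) ((h (opow S (r + s) z))\<^sup>2)"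
proof -
  obtain z0 where z00: "opow S (2 * (r + s)) z0 \<noteq> 0" using not_square_zero by blast
  have "opow S (2 * (r + s)) z0 = opow S (2 * s) (opow S (2 * r) z0)"
    by (simp flip: opow_add) (simp add: algebra_simps)
  then have z0: "opow S (2 * r) z0 \<noteq> 0" using z00 by auto
  obtain \<mu> where \<mu>: "\<mu> \<noteq> 0" "opow S (r + s) z0 = \<mu> *\<^sub>C opow S (2 * s) z0"
    "opow S (2 * r) z0 = \<mu>\<^sup>2 *\<^sub>C opow S (2 * s) z0"
    using generic_vector[OF s z0] by metis
  define y0 where "y0 = opow S (2 * s) z0"
  have y0: "y0 \<noteq> 0" using z0 \<mu> by (auto simp: y0_def)
  have split: "opow S (r + s) z = opow S (r - s) (opow S (2 * s) z)" for z
    using s_le_r by (simp flip: opow_add) (simp add: add.commute)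
  have generic: "\<not> indep2 y0 (opow S (2 * s) z)" if z: "opow S (2 * r) z \<noteq> 0" for z
  proof
    assume ind: "indep2 y0 (opow S (2 * s) z)"
    define y where "y = opow S (2 * s) z"
    have ind: "indep2 y0 y" using ind by (simp add: y_def)
    show False
    proof (cases "r = s")
      case True
      then show False
        using no_eigenpair[OF s, of 1 z0 z] ind by (simp add: y_def y0_def)
    next
      case False
      obtain \<nu> where \<nu>: "\<nu> \<noteq> 0" "opow S (r + s) z = \<nu> *\<^sub>C y" "opow S (2 * r) z = \<nu>\<^sup>2 *\<^sub>C y"
        using generic_vector[OF s z] y_def by metis
      have "opow S (2 * r) (z0 + z) = \<mu>\<^sup>2 *\<^sub>C y0 + \<nu>\<^sup>2 *\<^sub>C y"
        by (simp add: \<mu> \<nu> y0_def)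
      then have "opow S (2 * r) (z0 + z) \<noteq> 0"
        using indep2D[OF ind, of "\<mu>\<^sup>2" "\<nu>\<^sup>2"] \<mu>(1) by auto
      then obtain \<xi> where "opow S (r + s) (z0 + z) = \<xi> *\<^sub>C opow S (2 * s) (z0 + z)"
        using generic_vector[OF s] by metis
      then have "\<mu> *\<^sub>C y0 + \<nu> *\<^sub>C y = \<xi> *\<^sub>C (y0 + y)"
        by (simp add: \<mu> \<nu> y0_def y_def)
      then have "(\<mu> - \<xi>) *\<^sub>C y0 + (\<nu> - \<xi>) *\<^sub>C y = 0"
        by (simp add: cvec_simps algebra_simps)
      from indep2D[OF ind this] have eq: "\<nu> = \<mu>" by simp
      have ev: "opow S (r - s) y0 = \<mu> *\<^sub>C y0" "opow S (r - s) y = \<mu> *\<^sub>C y"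
        using \<mu>(2) \<nu>(2) split by (simp_all add: eq y0_def y_def)
      \<comment> \<open>\<open>S\<^bsup>2s\<^esup>\<close> is injective on eigenvectors of \<open>S\<^bsup>r-s\<^esup>\<close>, since a power of the latter is divisible by it.\<close>
      have inj: "c = 0" if c: "opow S (2 * s) c = 0" "opow S (r - s) c = \<mu> *\<^sub>C c" for c
      proof -
        have "1 \<le> r - s" using False s_le_r by simp
        then have le: "2 * s \<le> (r - s) * (2 * s)" using mult_le_mono1[of 1 "r - s" "2 * s"] by simp
        have "opow S ((r - s) * (2 * s)) c = \<mu> ^ (2 * s) *\<^sub>C c"
          unfolding opow_mult[of S "r - s" "2 * s"] by (rule opow_eigen[OF c(2)])
        moreover have "opow S ((r - s) * (2 * s)) c = 0"
          using c(1) le by (metis cblinfun_apply_simps(4) le_add_diff_inverse2 opow_add)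
        ultimately show ?thesis using \<mu>(1) by (simp add: scaleC_eq_0_iff)
      qed
      have "indep2 (opow S (2 * s) y0) (opow S (2 * s) y)"
        unfolding indep2_def
      proof (intro allI impI)
        fix a b assume "a *\<^sub>C opow S (2 * s) y0 + b *\<^sub>C opow S (2 * s) y = 0"
        then have "opow S (2 * s) (a *\<^sub>C y0 + b *\<^sub>C y) = 0" by simp
        then have "a *\<^sub>C y0 + b *\<^sub>C y = 0"
          by (rule inj) (simp add: ev cvec_simps mult.commute)
        then show "a = 0 \<and> b = 0" by (rule indep2D[OF ind])
      qed
      then show False using no_eigenpair[OF s \<mu>(1) ev] by blast
    qed
  qed
  have line: "\<exists>c. opow S (2 * s) z = c *\<^sub>C y0" for z
  proof (cases "opow S (2 * r) z = 0")
    case False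
    then show ?thesis using not_indep2[OF generic y0] by metis
  next
    case True
    then have "opow S (2 * r) (z + z0) \<noteq> 0" using z0 by simp
    then obtain c where "opow S (2 * s) (z + z0) = c *\<^sub>C y0"
      using not_indep2[OF generic y0] by metis
    then have "opow S (2 * s) z = (c - 1) *\<^sub>C y0"
      by (simp add: cvec_simps y0_def algebra_simps)
    then show ?thesis by blast
  qed
  obtain g where g: "opow S (2 * s) = tensor y0 g"
    using rank_one_if_pairwise_dependent[OF y0 line] by metis
  have n: "opow S (r - s) y0 = \<mu> *\<^sub>C y0"
    using \<mu>(2) split y0_def by simp
  have M: "opow S (r + s) z = g z *\<^sub>C \<mu> *\<^sub>C y0" for z
    unfolding split g by (simp add: n)
  have M2: "opow S (2 * r) z = g z *\<^sub>C \<mu> *\<^sub>C \<mu> *\<^sub>C y0" for z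
  proof -
    have "2 * r = (r - s) + (r + s)" using s_le_r by simp
    then have "opow S (2 * r) z = opow S (r - s) (opow S (r + s) z)"
      by (metis opow_add)
    then show ?thesis by (simp add: M n)
  qed
  show ?thesis
  proof (rule that)
    show "opow S (r + s) = tensor (\<mu> *\<^sub>C y0) g"
      by (rule cblinfun_eqI) (simp add: M)
    show "g (\<mu> *\<^sub>C y0) \<noteq> 0"
    proof
      assume "g (\<mu> *\<^sub>C y0) = 0"
      then have "opow S (r + s) (opow S (r + s) z0) = 0" by (auto simp: M)
      with z00 show False by (simp only: mult_2 opow_add)
    qed
    show "nzspec (jordan_pair r s (tensor z h) S) =
        root_set (h (opow S (r + s) z)) ((h (opow S (r + s) z))\<^sup>2)" for z h
      unfolding nzspec_jordan_pair_tensor M M2 g by (simp add: power2_eq_square mult_ac)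
  qed
qed

subsection \<open>All operator factors on one side\<close>

text \<open>\<open>S\<close> divides its power, so an inverse of the power would make the diagonal product invertible.\<close>

lemma power_not_invertible:
  assumes s: "s = 0"
  shows "\<not> cblinfun_invertible (opow S r)"
proof
  assume "cblinfun_invertible (opow S r)"
  then obtain N where "N o\<^sub>C\<^sub>L opow S r = cblinfun_id" "opow S r o\<^sub>C\<^sub>L N = cblinfun_id"
    by (auto simp: cblinfun_invertible_def)
  then have N: "N (opow S r x) = x" "opow S r (N x) = x" for x
    by (metis cblinfun_compose.rep_eq cblinfun_id.rep_eq)+
  have NS: "N (S x) = S (N x)" for x
    by (metis N opow_commute1)
  have NSi: "N (opow S i x) = opow S i (N x)" for i x
    by (induction i arbitrary: x) (simp_all add: opow_Suc NS)
  have r: "opow S (r + 1) (opow S (r - 1) x) = opow S r (opow S r x)" for x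
    using r1 by (simp flip: opow_add)
  have dg: "jordan_pair r s S S x = 2 *\<^sub>C opow S (r + 1) x" for x
    unfolding diagonal_apply by (simp add: s)
  have inv: "N (N (opow S (r - 1) (opow S (r + 1) x))) = x" for x
    unfolding opow_commute[of S "r - 1"] r by (simp only: N)
  have inv': "opow S (r + 1) (N (N (opow S (r - 1) x))) = x" for x
    unfolding NSi[symmetric] r by (simp only: N)
  have "cblinfun_invertible (jordan_pair r s S S)"
    by (rule cblinfun_invertibleI[of "inverse 2 *\<^sub>C (N o\<^sub>C\<^sub>L N o\<^sub>C\<^sub>L opow S (r - 1))"];
        simp only: dg cblinfun_rep cblinfun_apply_simps inv inv' scaleC_scaleC)
      simp_all
  with diagonal_singular show False by (simp add: spectrum_def)
qed

lemma not_three_eigenvalues: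
  assumes s: "s = 0" and C: "C = tensor z1 h1 + tensor z2 h2 + tensor z3 h3"
    and e: "\<And>i. i \<in> {1::nat, 2, 3} \<Longrightarrow>
      opow S r (C (w i)) + C (opow S r (w i)) = c i *\<^sub>C w i \<and> w i \<noteq> 0 \<and> c i \<noteq> 0"
    and ne: "c 1 \<noteq> c 2" "c 1 \<noteq> c 3" "c 2 \<noteq> c 3"
  shows False
proof -
  have "c i \<in> nzspec (jordan_pair r s C S)" if "i \<in> {1, 2, 3}" for i
  proof -
    have "jordan_pair r s C S (w i) = c i *\<^sub>C w i"
      using e[OF that] by (simp add: jordan_pair_apply s)
    then have "c i \<in> spectrum (jordan_pair r s C S)"
      by (rule eigenvalue_in_spectrum) (use e[OF that] in simp)
    then show ?thesis using e[OF that] by (simp add: nzspec_def)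
  qed
  moreover obtain p q where "nzspec (jordan_pair r s C S) = root_set p (sq_term s p q)"
    using few_eigenvalues unfolding C by blast
  ultimately show False using root_set_no_three[of "c 1" p _ "c 2" "c 3"] ne by auto
qed

text \<open>On independent \<open>x\<close>, \<open>M x\<close>, \<open>M (M x)\<close> with \<open>M = S\<^sup>r\<close> a test operator \<open>C\<close> of rank two can be
  prescribed freely. The choice \<open>0\<close>, \<open>x\<close>, \<open>2 M x\<close> makes the map \<open>M C + C M\<close> triangular on the span of
  these vectors, with diagonal \<open>1\<close>, \<open>3\<close>, \<open>2\<close>.\<close>

lemma power_locally_dependent:
  assumes s: "s = 0"
  shows "\<not> indep3 x (opow S r x) (opow S r (opow S r x))"
proof
  define M where "M = opow S r"
  assume "indep3 x (opow S r x) (opow S r (opow S r x))"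
  then have ind: "indep3 x (M x) (M (M x))" by (simp add: M_def)
  obtain f g h :: "'a cdual" where d: "g x = 0" "g (M x) = 1" "g (M (M x)) = 0"
    "h x = 0" "h (M x) = 0" "h (M (M x)) = 1"
    using dual_triple[OF ind] by metis
  define C where "C = tensor x g + tensor (2 *\<^sub>C M x) h + tensor 0 h"
  define a b where "a = g (M (M (M x)))" and "b = 2 * h (M (M (M x)))"
  have C: "C x = 0" "C (M x) = x" "C (M (M x)) = 2 *\<^sub>C M x" "C (M (M (M x))) = a *\<^sub>C x + b *\<^sub>C M x"
    by (simp_all add: C_def d a_def b_def scaleC_scaleC mult.commute)
  define w where "w i = (if i = (1::nat) then x else if i = 2 then M x
    else M (M x) + a *\<^sub>C x - b *\<^sub>C M x)" for i
  \<comment> \<open>The third eigenvector corrects \<open>M (M x)\<close> by the off-diagonal entries \<open>a\<close> and \<open>- b\<close>.\<close>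
  define c where "c i = (if i = (1::nat) then 1 else if i = 2 then 3 else 2 :: complex)" for i
  have w3: "w 3 \<noteq> 0" using indep3D[OF ind, of a "- b" 1] by (auto simp: w_def algebra_simps)
  have w12: "w 1 \<noteq> 0" "w 2 \<noteq> 0"
    using indep3D[OF ind, of 1 0 0] indep3D[OF ind, of 0 1 0] by (auto simp: w_def)
  have three: "3 *\<^sub>C y = y + y + y" and two: "2 *\<^sub>C y = y + y" for y :: 'a
    using scaleC_add_left[of 1 1 y] scaleC_add_left[of 2 1 y] by simp_all
  have "M (C (w i)) + C (M (w i)) = c i *\<^sub>C w i" if "i \<in> {1, 2, 3}" for i
  proof -
    have "M (C (w 1)) + C (M (w 1)) = c 1 *\<^sub>C w 1" by (simp add: w_def c_def C)
    moreover have "M (C (w 2)) + C (M (w 2)) = c 2 *\<^sub>C w 2"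
      by (simp add: w_def c_def C three two)
    moreover have "M (C (w 3)) + C (M (w 3)) = c 3 *\<^sub>C w 3"
    proof -
      have "c 3 *\<^sub>C w 3 = w 3 + w 3" by (simp add: c_def two)
      then show ?thesis by (simp add: w_def C two scaleC_add_right)
    qed
    ultimately show ?thesis using that by auto
  qed
  then show False
    using w3 w12 by (intro not_three_eigenvalues[OF s C_def, of w c]) (auto simp: M_def c_def)
qed

text \<open>By \<open>quadratic_if_locally_dependent\<close> the power \<open>M = S\<^sup>r\<close> is a multiple \<open>d E\<close> of an idempotent, with a
  vector \<open>v3\<close> in its kernel. If its range contained independent vectors \<open>v1\<close>, \<open>v2\<close>, the test operator with
  \<open>v1 \<mapsto> v1\<close>, \<open>v2 \<mapsto> 2 v2 - 3 v3\<close>, \<open>v3 \<mapsto> v2\<close> would produce the three eigenvalues \<open>2 d\<close>, \<open>3 d\<close>, \<open>d\<close>.\<close>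

lemma power_rank_one_one_sided:
  assumes s: "s = 0"
  obtains v g where "opow S r = tensor v g" "g v \<noteq> 0"
proof -
  define M where "M = opow S r"
  obtain x0 where "opow S (2 * (r + s)) x0 \<noteq> 0" using not_square_zero by blast
  then have MM: "M (M x0) \<noteq> 0" by (simp add: s mult_2 opow_add M_def)
  have M4: "\<exists>x. M (M (M (M x))) \<noteq> 0"
  proof -
    obtain x where "opow S (4 * (r + s)) x \<noteq> 0" using not_nilpotent by blast
    moreover have "4 * (r + s) = r + (r + (r + r))" by (simp add: s)
    ultimately show ?thesis by (metis M_def opow_add)
  qed
  have dep: "\<not> indep3 x (M x) (M (M x))" for x
    using power_locally_dependent[OF s] by (simp add: M_def)
  have ninv: "\<not> cblinfun_invertible M"
    using power_not_invertible[OF s] by (simp add: M_def)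
  have "\<exists>z. indep2 z (M z)"
  proof (rule ccontr)
    assume "\<not> ?thesis"
    then obtain c where c: "\<And>x. M x = c *\<^sub>C x"
      using all_eigenvectors_imp_scalar[of M] by blast
    then have "c \<noteq> 0" using MM by auto
    then have "cblinfun_invertible M"
      by (intro cblinfun_invertibleI[of "inverse c *\<^sub>C cblinfun_id"]) (simp_all add: c scaleC_scaleC)
    with ninv show False ..
  qed
  then obtain z where z: "indep2 z (M z)" ..
  obtain d where d: "d \<noteq> 0" "\<And>w. M (M w) = d *\<^sub>C M w"
    using quadratic_if_locally_dependent[OF dep z ninv] M4 by metis
  define v3 where "v3 = M z - d *\<^sub>C z"
  have v3: "M v3 = 0" "v3 \<noteq> 0"
    using indep2D[OF z, of "- d" 1] by (auto simp: v3_def d algebra_simps)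
  define v1 where "v1 = M z"
  have v1: "M v1 = d *\<^sub>C v1" "v1 \<noteq> 0"
    using indep2_nonzero[OF z] by (simp_all add: v1_def d)
  have "\<exists>c. M x = c *\<^sub>C v1" for x
  proof (rule ccontr)
    assume no: "\<not> ?thesis"
    define v2 where "v2 = M x"
    have v2: "M v2 = d *\<^sub>C v2" by (simp add: v2_def d)
    have i2: "indep2 v1 v2"
      using no not_indep2[of v1 v2] v1(2) unfolding v2_def by metis
    have ind: "indep3 v1 v2 v3"
      unfolding indep3_def
    proof (intro allI impI)
      fix a b c assume 0: "a *\<^sub>C v1 + b *\<^sub>C v2 + c *\<^sub>C v3 = 0"
      have "(a * d) *\<^sub>C v1 + (b * d) *\<^sub>C v2 = 0"
        using arg_cong[OF 0, of M] by (simp add: v1 v2 v3 scaleC_scaleC)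
      from indep2D[OF i2 this] have "a = 0" "b = 0" using d by auto
      with 0 v3 show "a = 0 \<and> b = 0 \<and> c = 0" by (simp add: scaleC_eq_0_iff)
    qed
    obtain f1 f2 f3 :: "'a cdual" where f: "f1 v1 = 1" "f1 v2 = 0" "f1 v3 = 0"
      "f2 v1 = 0" "f2 v2 = 1" "f2 v3 = 0" "f3 v1 = 0" "f3 v2 = 0" "f3 v3 = 1"
      using dual_triple[OF ind] by metis
    define C where "C = tensor v1 f1 + tensor (2 *\<^sub>C v2 - 3 *\<^sub>C v3) f2 + tensor v2 f3"
    have C: "C v1 = v1" "C v2 = 2 *\<^sub>C v2 - 3 *\<^sub>C v3" "C v3 = v2"
      by (simp_all add: C_def f)
    define w where "w i = (if i = (1::nat) then v1 else if i = 2 then v2 - v3 else v2 - 3 *\<^sub>C v3)" for i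
    define c where "c i = (if i = (1::nat) then 2 * d else if i = 2 then 3 * d else d)" for i
    have w: "w 2 \<noteq> 0" "w 3 \<noteq> 0" "w 1 \<noteq> 0"
      using indep3D[OF ind, of 0 1 "-1"] indep3D[OF ind, of 0 1 "-3"] v1 by (auto simp: w_def)
    have "M (C (w i)) + C (M (w i)) = c i *\<^sub>C w i" if "i \<in> {1, 2, 3}" for i
    proof -
      have "M (C (w 1)) + C (M (w 1)) = (2 * d) *\<^sub>C v1"
        by (simp add: w_def C v1 flip: scaleC_add_left)
      moreover have "M (C (w 2)) + C (M (w 2)) = (2 * d + 2 * d - d) *\<^sub>C v2 - (3 * d) *\<^sub>C v3"
        by (simp only: scaleC_add_left cvec.scale_left_diff_distrib)
          (simp add: w_def C v1 v2 v3 cvec_simps mult.commute)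
      moreover have "M (C (w 3)) + C (M (w 3)) = (2 * d + 2 * d - 3 * d) *\<^sub>C v2 - (3 * d) *\<^sub>C v3"
        by (simp only: scaleC_add_left cvec.scale_left_diff_distrib)
          (simp add: w_def C v1 v2 v3 cvec_simps mult.commute)
      ultimately show ?thesis
        using that by (auto simp: c_def w_def cvec_simps)
    qed
    then show False
      using w d(1) by (intro not_three_eigenvalues[OF s C_def, of w c]) (auto simp: M_def c_def)
  qed
  then obtain g where g: "M = tensor v1 g"
    using rank_one_if_pairwise_dependent[OF v1(2)] by metis
  have "g v1 *\<^sub>C v1 = d *\<^sub>C v1" using v1(1) by (simp add: g)
  then have "g v1 \<noteq> 0" using v1(2) d(1) by simp
  then show ?thesis using that g by (simp add: M_def)
qed

text \<open>In both cases the nonzero spectrum of a product with \<open>z \<otimes> h\<close> depends on \<open>S\<close> only through the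
  rank-one power, in the same way as the product with an idempotent does.\<close>

lemma power_rank_one:
  obtains v g where "opow S (r + s) = tensor v g" "(g v) ^ (r + s + 1) = 1"
    "\<And>z h. nzspec (jordan_pair r s (tensor z h) S) =
      root_set (h (opow S (r + s) z)) (sq_term s (h (opow S (r + s) z)) (g v * h z * h (opow S (r + s) z)))"
proof (cases "s = 0")
  case False
  obtain v g where M: "opow S (r + s) = tensor v g" "g v \<noteq> 0"
    and sp: "\<And>z h. nzspec (jordan_pair r s (tensor z h) S) =
      root_set (h (opow S (r + s) z)) ((h (opow S (r + s) z))\<^sup>2)"
    using power_rank_one_two_sided[OF False] by metis
  show ?thesis
    by (rule that[OF M(1) trace_root_of_unity[OF M]]) (simp add: sp sq_term_def False)
next
  case True
  obtain v g where M: "opow S r = tensor v g" "g v \<noteq> 0"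
    using power_rank_one_one_sided[OF True] by metis
  have M2: "opow S (2 * r) z = g v *\<^sub>C opow S r z" for z
  proof -
    have "opow S (2 * r) z = opow S r (opow S r z)" by (simp only: mult_2 opow_add)
    then show ?thesis by (simp add: M scaleC_scaleC mult.commute)
  qed
  show ?thesis
  proof (rule that)
    show "opow S (r + s) = tensor v g" using M by (simp add: True)
    then show "(g v) ^ (r + s + 1) = 1" using M(2) by (rule trace_root_of_unity)
    show "nzspec (jordan_pair r s (tensor z h) S) = root_set (h (opow S (r + s) z))
        (sq_term s (h (opow S (r + s) z)) (g v * h z * h (opow S (r + s) z)))" for z h
      unfolding nzspec_jordan_pair_tensor M2 by (simp add: True sq_term_def mult_ac)
  qed
qed

end

section \<open>Quadrilinear forms of rank at most one\<close>

lemma covered_by_two_subspaces: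
  fixes P Q :: "'v::ab_group_add \<Rightarrow> bool"
  assumes "\<And>x. P x \<or> Q x"
    and "\<And>x y. P x \<Longrightarrow> P y \<Longrightarrow> P (x - y)" and "\<And>x y. Q x \<Longrightarrow> Q y \<Longrightarrow> Q (x - y)"
  shows "(\<forall>x. P x) \<or> (\<forall>x. Q x)"
proof (rule ccontr)
  assume "\<not> ?thesis"
  then obtain x y where xy: "\<not> P x" "\<not> Q y" by blast
  then have "Q x" "P y" using assms(1) by blast+
  have "\<not> P (x + y)"
    using assms(2)[of "x + y" y] xy \<open>P y\<close> by auto
  moreover have "\<not> Q (x + y)"
    using assms(3)[of "x + y" x] xy \<open>Q x\<close> by auto
  ultimately show False using assms(1) by blast
qed

text \<open>The value of \<open>G x f\<close> is described by the form \<open>h (G x f z)\<close>; as a form it has a symmetry between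
  \<open>z\<close> and \<open>h\<close> that reduces one of the two final factorizations to the other. For fixed \<open>(x, f)\<close> the rank
  is at most one by \<open>rank_one\<close>; the two kernel conditions say that the last two spaces have dimension at
  least two.\<close>

locale rank_one_forms =
  fixes a :: "'x::complex_normed_vector \<Rightarrow> 'f::complex_normed_vector \<Rightarrow>
    'z::complex_normed_vector \<Rightarrow> 'h::complex_normed_vector \<Rightarrow> complex"
  assumes lin_x: "\<And>f z h. clin (\<lambda>x. a x f z h)" and lin_f: "\<And>x z h. clin (\<lambda>f. a x f z h)"
    and lin_z: "\<And>x f h. clin (\<lambda>z. a x f z h)" and lin_h: "\<And>x f z. clin (a x f z)"
    and rank_one: "\<And>x f z h z' h'. a x f z h * a x f z' h' = a x f z h' * a x f z' h"
    and nondegenerate: "\<And>z h. z \<noteq> 0 \<Longrightarrow> h \<noteq> 0 \<Longrightarrow> \<exists>x f. a x f z h \<noteq> 0"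
    and f_faithful: "\<And>f. f \<noteq> 0 \<Longrightarrow> \<exists>x z h. a x f z h \<noteq> 0"
    and kernel_z: "\<And>g :: 'z \<Rightarrow> complex. clin g \<Longrightarrow> \<exists>z. z \<noteq> 0 \<and> g z = 0"
    and kernel_h: "\<And>g :: 'h \<Rightarrow> complex. clin g \<Longrightarrow> \<exists>h. h \<noteq> 0 \<and> g h = 0"
begin

lemmas x_simps = clin_simps[OF lin_x] and f_simps = clin_simps[OF lin_f]
  and z_simps = clin_simps[OF lin_z] and h_simps = clin_simps[OF lin_h]

lemma swap: "rank_one_forms (\<lambda>x f h z. a x f z h)"
proof
  show "\<exists>x f. a x f z h \<noteq> 0" if "h \<noteq> 0" "z \<noteq> 0" for h z
    using nondegenerate[OF that(2,1)] .
  show "\<exists>x h z. a x f z h \<noteq> 0" if "f \<noteq> 0" for f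
    using f_faithful[OF that] by blast
qed (use lin_x lin_f lin_z lin_h rank_one kernel_z kernel_h in \<open>auto simp: mult.commute\<close>)

text \<open>Vanishing on the kernel of \<open>g\<close> expresses that every form \<open>a x f\<close> is the product of \<open>g\<close> and a
  functional of \<open>h\<close>.\<close>

definition type_z :: "'f \<Rightarrow> ('z \<Rightarrow> complex) \<Rightarrow> bool"
  where "type_z f g \<longleftrightarrow> clin g \<and> (\<exists>z. g z \<noteq> 0) \<and> (\<forall>x z h. g z = 0 \<longrightarrow> a x f z h = 0)"

definition type_h :: "'f \<Rightarrow> ('h \<Rightarrow> complex) \<Rightarrow> bool"
  where "type_h f g \<longleftrightarrow> clin g \<and> (\<exists>h. g h \<noteq> 0) \<and> (\<forall>x z h. g h = 0 \<longrightarrow> a x f z h = 0)"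

lemma type_zD:
  assumes "type_z f g" "g z0 = 1"
  shows "a x f z h = g z * a x f z0 h"
proof -
  have g: "clin g" using assms by (simp add: type_z_def)
  have "g (z - g z *\<^sub>C z0) = 0" by (simp add: clin_simps[OF g] assms)
  then have "a x f (z - g z *\<^sub>C z0) h = 0" using assms by (simp add: type_z_def)
  then show ?thesis by (simp add: z_simps)
qed

lemma type_hD:
  assumes "type_h f g" "g h0 = 1"
  shows "a x f z h = g h * a x f z h0"
proof -
  have g: "clin g" using assms by (simp add: type_h_def)
  have "g (h - g h *\<^sub>C h0) = 0" by (simp add: clin_simps[OF g] assms)
  then have "a x f z (h - g h *\<^sub>C h0) = 0" using assms by (simp add: type_h_def)
  then show ?thesis by (simp add: h_simps)
qed

lemma normalize:
  assumes "clin (g :: 'v::complex_normed_vector \<Rightarrow> complex)" "g v \<noteq> 0"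
  obtains v1 where "g v1 = 1"
  using that[of "inverse (g v) *\<^sub>C v"] assms by (simp add: clin_simps[OF assms(1)])

text \<open>If the second form neither factors through \<open>g\<close> nor through \<open>e\<close>, then a two-by-two minor of the
  sum is \<open>g z1 * e h1 * a x2 f2 z2 h2 \<noteq> 0\<close>.\<close>

lemma rank_one_sum:
  assumes A: "\<And>z h. a x1 f1 z h = g z * e h" and g: "g z1 \<noteq> 0" and e: "e h1 \<noteq> 0"
    and sum: "\<And>z h. a x1 f1 z h + a x2 f2 z h = a x3 f3 z h"
  shows "(\<forall>z h. g z = 0 \<longrightarrow> a x2 f2 z h = 0) \<or> (\<forall>z h. e h = 0 \<longrightarrow> a x2 f2 z h = 0)"
proof (rule ccontr)
  assume "\<not> ?thesis"
  then obtain z2 h3 z3 h2 where 2: "g z2 = 0" "a x2 f2 z2 h3 \<noteq> 0" "e h2 = 0" "a x2 f2 z3 h2 \<noteq> 0"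
    by blast
  have nz: "a x2 f2 z2 h2 \<noteq> 0"
    using rank_one[of x2 f2 z2 h3 z3 h2] 2 by auto
  have "a x3 f3 z1 h1 * a x3 f3 z2 h2 = a x3 f3 z1 h2 * a x3 f3 z2 h1" by (rule rank_one)
  then have "(g z1 * e h1 + a x2 f2 z1 h1) * a x2 f2 z2 h2 = a x2 f2 z1 h2 * a x2 f2 z2 h1"
    unfolding sum[symmetric] A by (simp add: 2)
  then have "g z1 * e h1 * a x2 f2 z2 h2 = 0"
    using rank_one[of x2 f2 z1 h1 z2 h2] by (simp add: algebra_simps)
  then show False using g e nz by simp
qed

text \<open>The forms \<open>a x f\<close> with fixed \<open>f\<close> have rank at most one together with all their sums, so each of them shares a
  factor with a fixed nonzero one; a linear space is not the union of two proper subspaces.\<close>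

lemma type_z_or_type_h:
  assumes f: "f \<noteq> 0"
  shows "(\<exists>g. type_z f g) \<or> (\<exists>g. type_h f g)"
proof -
  obtain x0 z0 h0 where n: "a x0 f z0 h0 \<noteq> 0" using f_faithful[OF f] by blast
  define g where "g z = a x0 f z h0 / a x0 f z0 h0" for z
  define e where "e h = a x0 f z0 h" for h
  have lin: "clin g" "clin e"
    using lin_z[of x0 f h0] lin_h[of x0 f z0]
    by (auto simp: g_def e_def clin_def add_divide_distrib)
  have A: "a x0 f z h = g z * e h" for z h
    using rank_one[of x0 f z h z0 h0] n by (simp add: g_def e_def field_simps)
  have "(\<forall>x. \<forall>z h. g z = 0 \<longrightarrow> a x f z h = 0) \<or> (\<forall>x. \<forall>z h. e h = 0 \<longrightarrow> a x f z h = 0)"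
  proof (rule covered_by_two_subspaces)
    fix x
    show "(\<forall>z h. g z = 0 \<longrightarrow> a x f z h = 0) \<or> (\<forall>z h. e h = 0 \<longrightarrow> a x f z h = 0)"
      by (rule rank_one_sum[OF A, of z0 h0 x f "x0 + x" f])
        (use n in \<open>simp_all add: g_def e_def x_simps\<close>)
  qed (simp_all add: x_simps)
  moreover have "g z0 \<noteq> 0" "e h0 \<noteq> 0" using n by (simp_all add: g_def e_def)
  ultimately show ?thesis
    unfolding type_z_def type_h_def using lin by metis
qed

text \<open>With both types, \<open>a x f\<close> would be \<open>l x * g z * e h\<close>. Adding \<open>a x k\<close> for any other \<open>k\<close> keeps the rank,
  so all forms would factor through the same \<open>g\<close>, or all through the same \<open>e\<close>; a vector in the kernel
  then contradicts nondegeneracy.\<close>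

lemma not_both_types:
  assumes f: "f \<noteq> 0" and z: "type_z f g" and h: "type_h f e"
  shows False
proof -
  have lin: "clin g" "clin e" using z h by (auto simp: type_z_def type_h_def)
  obtain z1 where z1: "g z1 = 1" using z normalize[OF lin(1)] by (auto simp: type_z_def)
  obtain h1 where h1: "e h1 = 1" using h normalize[OF lin(2)] by (auto simp: type_h_def)
  define l where "l x = a x f z1 h1" for x
  have A: "a x f z h' = (l x * g z) * e h'" for x z h'
    using type_zD[OF z z1, of x z h'] type_hD[OF h h1, of x z1 h'] by (simp add: l_def)
  obtain x0 where x0: "l x0 \<noteq> 0" using f_faithful[OF f] A by force
  have lin_l: "clin l" unfolding l_def by (rule lin_x)
  define P Q where "P k x \<longleftrightarrow> (\<forall>z h. g z = 0 \<longrightarrow> a x k z h = 0)"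
    and "Q k x \<longleftrightarrow> (\<forall>z h. e h = 0 \<longrightarrow> a x k z h = 0)" for k x
  have PQ0: "P k x \<or> Q k x" if "l x \<noteq> 0" for k x
    using rank_one_sum[OF A[of x], of z1 h1 x k x "f + k"] that z1 h1
    by (simp add: f_simps P_def Q_def)
  have PQ: "(\<forall>x. P k x) \<or> (\<forall>x. Q k x)" for k
  proof (rule ccontr)
    assume "\<not> ?thesis"
    then obtain x2 z2 h2 x3 z3 h3 where 2: "g z2 = 0" "a x2 k z2 h2 \<noteq> 0"
      and 3: "e h3 = 0" "a x3 k z3 h3 \<noteq> 0"
      by (auto simp: P_def Q_def)
    \<comment> \<open>If both alternatives fail, a common non-zero of three linear functions violates \<open>PQ0\<close>.\<close>
    have "\<exists>x. \<forall>L\<in>{l, \<lambda>x. a x k z2 h2, \<lambda>x. a x k z3 h3}. L x \<noteq> 0"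
      by (rule common_nonzero) (use 2 3 x0 lin_l lin_x in auto)
    then obtain x where x: "l x \<noteq> 0" "a x k z2 h2 \<noteq> 0" "a x k z3 h3 \<noteq> 0" by auto
    show False using PQ0[OF x(1), of k] x 2 3 by (auto simp: P_def Q_def)
  qed
  have "(\<forall>k. \<forall>x. P k x) \<or> (\<forall>k. \<forall>x. Q k x)"
    by (rule covered_by_two_subspaces[OF PQ]) (simp_all add: P_def Q_def f_simps)
  then show False
  proof
    assume "\<forall>k x. P k x"
    obtain z where z0: "z \<noteq> 0" "g z = 0" using kernel_z[OF lin(1)] by blast
    obtain h where h: "h \<noteq> 0" "e h = 0" using kernel_h[OF lin(2)] by blast
    show False using nondegenerate[OF z0(1) h(1)] \<open>\<forall>k x. P k x\<close> z0 by (simp add: P_def)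
  next
    assume "\<forall>k x. Q k x"
    obtain z where z0: "z \<noteq> 0" "g z = 0" using kernel_z[OF lin(1)] by blast
    obtain h where h: "h \<noteq> 0" "e h = 0" using kernel_h[OF lin(2)] by blast
    show False using nondegenerate[OF z0(1) h(1)] \<open>\<forall>k x. Q k x\<close> h by (simp add: Q_def)
  qed
qed

text \<open>For each \<open>x\<close> the sum of \<open>a x f\<close>, a multiple of \<open>g\<close>, and of \<open>a x k\<close>, a multiple of \<open>e\<close>, has rank at
  most one only if one of them is a multiple of both; this gives \<open>f\<close> or \<open>k\<close> both types.\<close>

lemma no_mixed_types:
  assumes f: "f \<noteq> 0" "type_z f g" and k: "k \<noteq> 0" "type_h k e"
  shows False
proof -
  have lin: "clin g" "clin e" using f k by (auto simp: type_z_def type_h_def)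
  obtain z1 where z1: "g z1 = 1" using f normalize[OF lin(1)] by (auto simp: type_z_def)
  obtain h1 where h1: "e h1 = 1" using k normalize[OF lin(2)] by (auto simp: type_h_def)
  have "(\<forall>x. \<forall>z h. e h = 0 \<longrightarrow> a x f z h = 0) \<or> (\<forall>x. \<forall>z h. g z = 0 \<longrightarrow> a x k z h = 0)"
  proof (rule covered_by_two_subspaces)
    fix x
    show "(\<forall>z h. e h = 0 \<longrightarrow> a x f z h = 0) \<or> (\<forall>z h. g z = 0 \<longrightarrow> a x k z h = 0)"
    proof (rule ccontr)
      assume "\<not> ?thesis"
      then obtain z3 h2 z2 h3 where 2: "e h2 = 0" "a x f z3 h2 \<noteq> 0" "g z2 = 0" "a x k z2 h3 \<noteq> 0"
        by blast
      have "a x f z1 h2 \<noteq> 0" using 2 type_zD[OF f(2) z1, of x z3 h2] by auto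
      moreover have "a x k z2 h1 \<noteq> 0" using 2 type_hD[OF k(2) h1, of x z2 h3] by auto
      moreover have "a x f z2 h = 0" for h using type_zD[OF f(2) z1, of x z2 h] 2 by simp
      moreover have "a x k z h2 = 0" for z using type_hD[OF k(2) h1, of x z h2] 2 by simp
      ultimately show False
        using rank_one[of x "f + k" z1 h1 z2 h2] by (simp add: f_simps)
    qed
  qed (simp_all add: x_simps)
  then show False
  proof
    assume "\<forall>x z h. e h = 0 \<longrightarrow> a x f z h = 0"
    then have "type_h f e" using k by (auto simp: type_h_def)
    then show False by (rule not_both_types[OF f])
  next
    assume "\<forall>x z h. g z = 0 \<longrightarrow> a x k z h = 0"
    then have "type_z k g" using f by (auto simp: type_z_def)
    then show False using not_both_types[OF k(1)] k(2) by blast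
  qed
qed

lemma uniform_type:
  "(\<forall>f. f \<noteq> 0 \<longrightarrow> (\<exists>g. type_z f g)) \<or> (\<forall>f. f \<noteq> 0 \<longrightarrow> (\<exists>e. type_h f e))"
  using type_z_or_type_h no_mixed_types by blast

text \<open>Pointwise proportional linear families are globally proportional as soon as one of them is not
  confined to a line: subtract the multiple that is correct at \<open>x1\<close>; the difference \<open>D\<close> remains
  proportional to \<open>t\<close>, and polarizing with a point where \<open>D\<close> vanishes makes \<open>D x\<close> proportional to both
  \<open>t x1\<close> and \<open>t x2\<close>.\<close>

lemma parallel_families:
  fixes t u :: "'x \<Rightarrow> 'h \<Rightarrow> complex"
  assumes t: "\<And>h. clin (\<lambda>x. t x h)" and u: "\<And>h. clin (\<lambda>x. u x h)"
    and par: "\<And>x h h'. t x h * u x h' = t x h' * u x h"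
    and det: "t x1 h1 * t x2 h2 \<noteq> t x1 h2 * t x2 h1"
  shows "\<exists>c. \<forall>x h. u x h = c * t x h"
proof -
  obtain h0 where h0: "t x1 h0 \<noteq> 0" using det by (metis mult_zero_left)
  define c where "c = u x1 h0 / t x1 h0"
  define D where "D x h = u x h - c * t x h" for x h
  have D1: "D x1 h = 0" for h
    using par[of x1 h0 h] h0 by (simp add: D_def c_def field_simps)
  have D_add: "D (x + y) h = D x h + D y h" for x y h
    by (simp add: D_def clin_simps[OF t] clin_simps[OF u] algebra_simps)
  have t_add: "t (x + y) h = t x h + t y h" for x y h by (rule clin_simps[OF t])
  have par_D: "t x h * D x h' = t x h' * D x h" for x h h'
    using par[of x h h'] by (simp add: D_def algebra_simps)
  have trans: "t y h * D x h' = t y h' * D x h" if "\<And>h. D y h = 0" for x y h h'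
    using par_D[of "x + y" h h'] par_D[of x h h'] by (simp add: D_add t_add that algebra_simps)
  have indep: "D x h = 0" if p1: "\<And>h h'. t x1 h * D x h' = t x1 h' * D x h"
    and p2: "\<And>h h'. t x2 h * D x h' = t x2 h' * D x h" for x h
  proof (rule ccontr)
    assume n: "D x h \<noteq> 0"
    define \<alpha> \<beta> where "\<alpha> = t x1 h / D x h" and "\<beta> = t x2 h / D x h"
    have "t x1 h' = \<alpha> * D x h'" "t x2 h' = \<beta> * D x h'" for h'
      using p1[of h' h] p2[of h' h] n by (simp_all add: \<alpha>_def \<beta>_def field_simps)
    then have "t x1 h1 * t x2 h2 = t x1 h2 * t x2 h1" by (simp add: mult_ac)
    with det show False ..
  qed
  have D2: "D x2 h = 0" for h by (rule indep[OF trans[OF D1] par_D])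
  have "D x h = 0" for x h by (rule indep[OF trans[OF D1] trans[OF D2]])
  then show ?thesis by (auto simp: D_def)
qed

text \<open>The sum of \<open>g \<otimes> t x\<close> and \<open>g' \<otimes> u x\<close> with independent \<open>g\<close>, \<open>g'\<close> has rank at most one only if \<open>t x\<close> and
  \<open>u x\<close> are proportional.\<close>

lemma proportional:
  assumes f: "f \<noteq> 0" "type_z f g" "g z1 = 1" and k: "type_z k g'"
    and np: "g z2 = 0" "g' z2 \<noteq> 0"
  shows "\<exists>c. \<forall>x z h. a x k z h = c * g' z * a x f z1 h"
proof -
  have lin: "clin g" "clin g'" using f k by (auto simp: type_z_def)
  define z3 where "z3 = inverse (g' z2) *\<^sub>C z2"
  have z3: "g z3 = 0" "g' z3 = 1"
    using np by (simp_all add: z3_def clin_simps[OF lin(1)] clin_simps[OF lin(2)])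
  have "\<exists>x1 h1 x2 h2. a x1 f z1 h1 * a x2 f z1 h2 \<noteq> a x1 f z1 h2 * a x2 f z1 h1"
  proof (rule ccontr)
    assume no: "\<not> ?thesis"
    obtain x0 z0 h0 where "a x0 f z0 h0 \<noteq> 0" using f_faithful[OF f(1)] by blast
    then have n: "a x0 f z1 h0 \<noteq> 0" using type_zD[OF f(2,3), of x0 z0 h0] by auto
    define e where "e h = a x0 f z1 h / a x0 f z1 h0" for h
    have e: "clin e" "e h0 \<noteq> 0"
      using lin_h[of x0 f z1] n by (auto simp: e_def clin_def add_divide_distrib)
    have "a x f z h = 0" if "e h = 0" for x z h
    proof -
      have "a x f z1 h * a x0 f z1 h0 = a x f z1 h0 * a x0 f z1 h" using no by auto
      then have "a x f z1 h = 0" using that n by (simp add: e_def)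
      then show ?thesis using type_zD[OF f(2,3), of x z h] by simp
    qed
    then have "type_h f e" using e by (auto simp: type_h_def)
    then show False by (rule not_both_types[OF f(1,2)])
  qed
  then obtain x1 h1 x2 h2 where det: "a x1 f z1 h1 * a x2 f z1 h2 \<noteq> a x1 f z1 h2 * a x2 f z1 h1"
    by blast
  have "\<exists>c. \<forall>x h. a x k z3 h = c * a x f z1 h"
  proof (rule parallel_families[OF lin_x lin_x _ det])
    fix x h h'
    have 0: "a x f z3 h = 0" for h using type_zD[OF f(2,3), of x z3 h] z3 by simp
    have 1: "a x k z1 h = g' z1 * a x k z3 h" for h by (rule type_zD[OF k z3(2)])
    have "a x (f + k) z1 h * a x (f + k) z3 h' = a x (f + k) z1 h' * a x (f + k) z3 h"
      by (rule rank_one)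
    then show "a x f z1 h * a x k z3 h' = a x f z1 h' * a x k z3 h"
      by (simp add: f_simps 0 1 algebra_simps)
  qed
  then show ?thesis using type_zD[OF k z3(2)] by (metis mult.assoc mult.commute)
qed

text \<open>If \<open>g\<close> is not a multiple of \<open>g0\<close>, then \<open>proportional\<close> compares \<open>f\<close> with \<open>f0\<close> directly. Otherwise
  nondegeneracy provides some \<open>j\<close> whose functional is not a multiple of \<open>g0\<close>, and the comparison passes
  through \<open>j\<close>.\<close>

lemma factor_if_type_z:
  assumes all: "\<And>f. f \<noteq> 0 \<Longrightarrow> \<exists>g. type_z f g"
  shows "\<exists>x1 f0 z0 h1. a x1 f0 z0 h1 \<noteq> 0 \<and>
    (\<forall>x f z h. a x f z h * a x1 f0 z0 h1 = a x f0 z0 h * a x1 f z h1)"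
proof -
  obtain f0 :: 'f where f0: "f0 \<noteq> 0"
  proof -
    have 0: "clin (\<lambda>z :: 'z. 0 :: complex)" "clin (\<lambda>h :: 'h. 0 :: complex)" by (auto simp: clin_def)
    obtain z :: 'z and h :: 'h where "z \<noteq> 0" "h \<noteq> 0"
      using kernel_z[OF 0(1)] kernel_h[OF 0(2)] by blast
    then obtain x f where "a x f z h \<noteq> 0" using nondegenerate by blast
    then have "f \<noteq> 0" by (auto simp: f_simps)
    then show ?thesis by (rule that)
  qed
  obtain g0 where g0: "type_z f0 g0" using all[OF f0] by blast
  have lin0: "clin g0" using g0 by (simp add: type_z_def)
  obtain z0 where z0: "g0 z0 = 1" using g0 normalize[OF lin0] by (auto simp: type_z_def)
  have factor: "\<exists>d. \<forall>x z h. a x f z h = a x f0 z0 h * d z" for f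
  proof (cases "f = 0")
    case True
    then show ?thesis by (intro exI[of _ "\<lambda>_. 0"]) (simp add: f_simps)
  next
    case False
    obtain g where g: "type_z f g" using all[OF False] by blast
    show ?thesis
    proof (cases "\<exists>z. g0 z = 0 \<and> g z \<noteq> 0")
      case True
      then obtain c where "\<forall>x z h. a x f z h = c * g z * a x f0 z0 h"
        using proportional[OF f0 g0 z0 g] by blast
      then show ?thesis by (intro exI[of _ "\<lambda>z. c * g z"]) (simp add: mult.commute)
    next
      case par: False
      have ling: "clin g" using g by (simp add: type_z_def)
      obtain z1 where z1: "g z1 = 1" using g normalize[OF ling] by (auto simp: type_z_def)
      have "\<exists>j g' z. j \<noteq> 0 \<and> type_z j g' \<and> g0 z = 0 \<and> g' z \<noteq> 0"
      proof (rule ccontr)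
        assume no: "\<not> ?thesis"
        obtain z where z: "z \<noteq> 0" "g0 z = 0" using kernel_z[OF lin0] by blast
        have 0: "clin (\<lambda>h :: 'h. 0 :: complex)" by (auto simp: clin_def)
        obtain h :: 'h where h: "h \<noteq> 0" using kernel_h[OF 0] by blast
        obtain x k where xk: "a x k z h \<noteq> 0" using nondegenerate[OF z(1) h] by blast
        then have "k \<noteq> 0" by (auto simp: f_simps)
        then obtain g' where "type_z k g'" using all by blast
        then show False using no \<open>k \<noteq> 0\<close> z xk unfolding type_z_def by blast
      qed
      then obtain j g' z2 where j: "j \<noteq> 0" "type_z j g'" "g0 z2 = 0" "g' z2 \<noteq> 0" by blast
      have "g z2 = 0" using par j by blast
      obtain c where c: "\<And>x z h. a x j z h = c * g' z * a x f0 z0 h"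
        using proportional[OF f0 g0 z0 j(2-4)] by blast
      obtain c' where c': "\<And>x z h. a x j z h = c' * g' z * a x f z1 h"
        using proportional[OF False g z1 j(2) \<open>g z2 = 0\<close> j(4)] by blast
      have "c' \<noteq> 0" using c' f_faithful[OF j(1)] by auto
      have "c * g' z2 * a x f0 z0 h = c' * g' z2 * a x f z1 h" for x h
        using c c' by metis
      then have "a x f z1 h = c / c' * a x f0 z0 h" for x h
        using j(4) \<open>c' \<noteq> 0\<close> by (simp add: field_simps)
      then have "a x f z h = a x f0 z0 h * (c / c' * g z)" for x z h
        using type_zD[OF g z1, of x z h] by (simp add: mult_ac)
      then show ?thesis by (intro exI[of _ "\<lambda>z. c / c' * g z"]) blast
    qed
  qed
  obtain x1 z h1 where "a x1 f0 z h1 \<noteq> 0" using f_faithful[OF f0] by blast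
  then have n: "a x1 f0 z0 h1 \<noteq> 0" using type_zD[OF g0 z0, of x1 z h1] by auto
  have "a x f z h * a x1 f0 z0 h1 = a x f0 z0 h * a x1 f z h1" for x f z h
  proof -
    obtain d where "\<And>x z h. a x f z h = a x f0 z0 h * d z" using factor[of f] by blast
    then show ?thesis by (simp add: mult_ac)
  qed
  with n show ?thesis by blast
qed

theorem factorization:
  "(\<exists>x1 f0 z0 h1. a x1 f0 z0 h1 \<noteq> 0 \<and>
     (\<forall>x f z h. a x f z h * a x1 f0 z0 h1 = a x f0 z0 h * a x1 f z h1)) \<or>
   (\<exists>x1 f0 z0 h1. a x1 f0 z0 h1 \<noteq> 0 \<and>
     (\<forall>x f z h. a x f z h * a x1 f0 z0 h1 = a x f0 z h1 * a x1 f z0 h))"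
  using uniform_type
proof
  assume "\<forall>f. f \<noteq> 0 \<longrightarrow> (\<exists>g. type_z f g)"
  then show ?thesis using factor_if_type_z by blast
next
  interpret sw: rank_one_forms "\<lambda>x f h z. a x f z h" by (rule swap)
  assume "\<forall>f. f \<noteq> 0 \<longrightarrow> (\<exists>e. type_h f e)"
  then have "\<And>f. f \<noteq> 0 \<Longrightarrow> \<exists>e. sw.type_z f e"
    unfolding type_h_def sw.type_z_def by blast
  then show ?thesis using sw.factor_if_type_z by blast
qed

end

section \<open>Rank and dimension\<close>

lemma rank_at_most_I:
  fixes A :: "'a::complex_normed_vector \<Rightarrow>\<^sub>C\<^sub>L 'b::complex_normed_vector"
  assumes "finite B" "card B \<le> n" "\<And>x. A x \<in> cvec.span B"
  shows "rank_at_most n A"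
  unfolding rank_at_most_def
proof
  show "finite_rank A" using assms by (auto simp: finite_rank_def)
  have "cvec.dim (range (cblinfun_apply A)) \<le> card B"
    by (rule cvec.dim_le_card) (use assms in auto)
  then show "cvec.dim (range (cblinfun_apply A)) \<le> n" using assms by simp
qed

lemma rank_at_most_tensor: "rank_at_most 1 (tensor x f)"
  by (rule rank_at_most_I[of "{x}"]) (auto intro: cvec.span_scale cvec.span_base)

lemma rank_at_most_three:
  "rank_at_most 3 (tensor x1 f1 + tensor x2 f2 + tensor x3 f3)"
proof (rule rank_at_most_I[of "{x1, x2, x3}"])
  show "card {x1, x2, x3} \<le> 3"
    by (simp add: card_insert_if)
qed (simp_all add: cvec.span_scale cvec.span_base cvec.span_add)

lemma rank_at_most_zero: "rank_at_most 1 0"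
  by (rule rank_at_most_I[of "{}"]) auto

lemma kernel_vector:
  fixes g :: "'v::complex_normed_vector \<Rightarrow> complex" and x y :: 'v
  assumes "indep2 x y" "clin g"
  shows "\<exists>v. v \<noteq> 0 \<and> g v = 0"
proof (cases "g x = 0")
  case True
  then show ?thesis using indep2_nonzero(1)[OF assms(1)] by blast
next
  case False
  have "g (g y *\<^sub>C x - g x *\<^sub>C y) = 0" by (simp add: clin_simps[OF assms(2)])
  moreover have "g y *\<^sub>C x - g x *\<^sub>C y \<noteq> 0"
    using indep2D[OF assms(1), of "g y" "- g x"] False by auto
  ultimately show ?thesis by blast
qed

text \<open>The trace of a rank-one operator is its nonzero spectral value, if there is one.\<close>

lemma tensor_trace:
  fixes g g' :: "'a::complex_normed_vector cdual"
  assumes "tensor v g = tensor v' g'"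
  shows "g v = g' v'"
  using nzspec_rank_one[of "g v" v g] nzspec_rank_one[of "g v" v' g']
    nzspec_rank_one[of "g' v'" v g] nzspec_rank_one[of "g' v'" v' g'] assms
  by metis

lemma nzspec_zero: "nzspec (0 :: 'a::complex_normed_vector \<Rightarrow>\<^sub>C\<^sub>L 'a) = {}"
proof -
  have "tensor 0 0 = (0 :: 'a \<Rightarrow>\<^sub>C\<^sub>L 'a)" by (rule cblinfun_eqI) simp
  then show ?thesis
    using nzspec_rank_one[of _ "0 :: 'a" 0] by (auto simp: nzspec_def)
qed

lemma jordan_pair_idempotent_self:
  assumes fx: "cblinfun_apply f x = 1"
  shows "cblinfun_apply f y = 0 \<Longrightarrow> y \<noteq> 0 \<Longrightarrow> 0 \<in> spectrum (jordan_pair r s (tensor x f) (tensor x f))"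
    and "2 \<in> spectrum (jordan_pair r s (tensor x f) (tensor x f))"
proof -
  define P where "P = tensor x f"
  show "0 \<in> spectrum (jordan_pair r s (tensor x f) (tensor x f))" if y: "cblinfun_apply f y = 0" "y \<noteq> 0"
  proof -
    have "P y = 0" using y by (simp add: P_def)
    then have "opow P n (P (opow P n' y)) = 0" for n n'
      using opow_commute1[of P n' y] by simp
    then have "jordan_pair r s P P y = 0 *\<^sub>C y" by (simp add: jordan_pair_apply)
    then show ?thesis unfolding P_def by (rule eigenvalue_in_spectrum) (rule y)
  qed
  have "P x = 1 *\<^sub>C x" by (simp add: P_def fx)
  then have "opow P n x = x" for n using opow_eigen[of P x 1 n] by simp
  then have "jordan_pair r s P P x = 2 *\<^sub>C x"
    using \<open>P x = 1 *\<^sub>C x\<close> scaleC_add_left[of 1 1 x] by (simp add: jordan_pair_apply)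
  moreover have "x \<noteq> 0" using fx by auto
  ultimately show "2 \<in> spectrum (jordan_pair r s (tensor x f) (tensor x f))"
    unfolding P_def by (rule eigenvalue_in_spectrum)
qed

lemma jordan_pair_zero: "jordan_pair r s 0 B = 0"
  by (rule cblinfun_eqI) (simp add: jordan_pair_apply)

lemma jordan_pair_scaleC: "jordan_pair r s A (c *\<^sub>C B) = jordan_pair r s (c ^ (r + s) *\<^sub>C A) B"
  by (rule cblinfun_eqI)
    (simp add: jordan_pair_apply opow_scaleC scaleC_scaleC power_add mult.commute)

text \<open>Along a line \<open>u + t x\<close> of vectors with \<open>f (u + t x) = 1\<close> the form is affine in \<open>t\<close> and takes only
  values of modulus one; so it is constant and \<open>\<beta> x f = 0\<close> whenever \<open>f x = 0\<close>. Such a form is a multiple of the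
  evaluation.\<close>

lemma trace_form_eq:
  fixes \<beta> :: "'a::complex_normed_vector \<Rightarrow> 'a cdual \<Rightarrow> complex"
  assumes \<beta>: "bilin \<beta>" and n: "n \<ge> 1"
    and root: "\<And>x f. cblinfun_apply f x = 1 \<Longrightarrow> \<beta> x f ^ n = 1"
    and nontrivial: "(x0 :: 'a) \<noteq> 0"
  obtains \<kappa> where "\<kappa> ^ n = 1" "\<And>x f. \<beta> x f = \<kappa> * f x"
proof -
  note bx = clin_simps[OF bilinD(1)[OF \<beta>]] and bf = clin_simps[OF bilinD(2)[OF \<beta>]]
  have kill: "\<beta> x f = 0" if fx: "cblinfun_apply f x = 0" for x f
  proof (cases "f = 0")
    case True
    then show ?thesis by (simp add: bf)
  next
    case False
    then obtain y where "cblinfun_apply f y \<noteq> 0" by (metis cblinfun_eqI zero_cblinfun.rep_eq)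
    then have y: "cblinfun_apply f (inverse (f y) *\<^sub>C y) = 1" by simp
    define u where "u = inverse (f y) *\<^sub>C y"
    have u: "f u = 1" using y by (simp add: u_def)
    show ?thesis
    proof (rule ccontr)
      assume ne: "\<beta> x f \<noteq> 0"
      \<comment> \<open>The parameter at which the affine function takes the value \<open>2\<close>, which is no root of unity.\<close>
      define t where "t = (2 - \<beta> u f) / \<beta> x f"
      have "\<beta> (u + t *\<^sub>C x) f ^ n = 1" by (rule root) (simp add: u fx)
      then have "(2 :: complex) ^ n = 1" using ne by (simp add: bx t_def)
      then have "norm ((2 :: complex) ^ n) = 1" by simp
      then have "(2 :: real) ^ n = 1" by (simp add: norm_power)
      moreover have "(2 :: real) ^ n > 1" using n by (intro one_less_power) auto
      ultimately show False by simp
    qed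
  qed
  obtain f0 :: "'a cdual" where f0: "f0 x0 = 1" using separating_functional[OF nontrivial] by metis
  define \<kappa> where "\<kappa> = \<beta> x0 f0"
  have 1: "\<beta> x f0 = f0 x * \<kappa>" for x
  proof -
    have "\<beta> (x - f0 x *\<^sub>C x0) f0 = 0" by (rule kill) (simp add: f0)
    then show ?thesis by (simp add: bx \<kappa>_def)
  qed
  have 2: "\<beta> x f = \<kappa> * f x" if "f0 x \<noteq> 0" for x f
  proof -
    have "\<beta> x (f - (f x / f0 x) *\<^sub>C f0) = 0" by (rule kill) (use that in simp)
    then show ?thesis using that by (simp add: bf 1)
  qed
  have "\<beta> x f = \<kappa> * f x" for x f
  proof (cases "f0 x = 0")
    case True
    then have "\<beta> (x + x0) f = \<kappa> * f (x + x0)" "\<beta> x0 f = \<kappa> * f x0" using f0 by (simp_all add: 2)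
    then show ?thesis by (simp add: bx algebra_simps)
  qed (rule 2)
  moreover have "\<kappa> ^ n = 1" unfolding \<kappa>_def by (rule root[OF f0])
  ultimately show ?thesis using that by blast
qed

section \<open>The trace identity and its bilinear extension\<close>

text \<open>The hypotheses of the theorem after the specialization to two operators.\<close>

locale preserver =
  fixes \<A>\<^sub>1 :: "('a::complex_banach \<Rightarrow>\<^sub>C\<^sub>L 'a) set"
    and \<A>\<^sub>2 :: "('b::complex_banach \<Rightarrow>\<^sub>C\<^sub>L 'b) set"
    and \<Phi> :: "('a \<Rightarrow>\<^sub>C\<^sub>L 'a) \<Rightarrow> ('b \<Rightarrow>\<^sub>C\<^sub>L 'b)"
    and r s :: nat
  assumes algebra1: "standard_operator_algebra \<A>\<^sub>1"
    and algebra2: "standard_operator_algebra \<A>\<^sub>2"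
    and r1: "r \<ge> 1" and s_le_r: "s \<le> r"
    and preserves: "\<And>A B. A \<in> \<A>\<^sub>1 \<Longrightarrow> B \<in> \<A>\<^sub>1 \<Longrightarrow> rank_at_most 1 A \<or> rank_at_most 1 B \<Longrightarrow>
      spectrum (jordan_pair r s (\<Phi> A) (\<Phi> B)) = spectrum (jordan_pair r s A B)"
    and onto: "\<And>B. B \<in> \<A>\<^sub>2 \<Longrightarrow> rank_at_most 3 B \<Longrightarrow> B \<in> \<Phi> ` \<A>\<^sub>1"
begin

lemma tensor_mem: "tensor x f \<in> \<A>\<^sub>1"
  using algebra1 rank_at_most_tensor[of x f]
  by (auto simp: standard_operator_algebra_def rank_at_most_def)

lemma zero_mem: "0 \<in> \<A>\<^sub>1"
  using algebra1 by (auto simp: standard_operator_algebra_def cvec.subspace_def)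

lemma onto_rank_three:
  obtains A where "A \<in> \<A>\<^sub>1" "\<Phi> A = tensor z1 h1 + tensor z2 h2 + tensor z3 h3"
proof -
  have "tensor z1 h1 + tensor z2 h2 + tensor z3 h3 \<in> \<A>\<^sub>2"
    using algebra2 rank_at_most_three[of z1 h1 z2 h2 z3 h3]
    by (auto simp: standard_operator_algebra_def rank_at_most_def)
  from onto[OF this rank_at_most_three] show ?thesis using that by auto
qed

lemma onto_tensor:
  obtains A where "A \<in> \<A>\<^sub>1" "\<Phi> A = tensor z h"
proof -
  have "tensor z h + tensor 0 h + tensor 0 h = tensor z h"
    by (rule cblinfun_eqI) simp
  then show ?thesis using onto_rank_three[of z h 0 h 0 h] that by metis
qed

end

locale preserver_dim2 = preserver \<A>\<^sub>1 \<A>\<^sub>2 \<Phi> r s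
  for \<A>\<^sub>1 :: "('a::complex_banach \<Rightarrow>\<^sub>C\<^sub>L 'a) set"
    and \<A>\<^sub>2 :: "('b::complex_banach \<Rightarrow>\<^sub>C\<^sub>L 'b) set"
    and \<Phi> r s +
  assumes dim1: "\<exists>x y :: 'a. indep2 x y" and dim2: "\<exists>x y :: 'b. indep2 x y"
begin

lemma kernel1: "clin (g :: 'a \<Rightarrow> complex) \<Longrightarrow> \<exists>v. v \<noteq> 0 \<and> g v = 0"
  using kernel_vector dim1 by blast

lemma kernel2: "clin (g :: 'b \<Rightarrow> complex) \<Longrightarrow> \<exists>v. v \<noteq> 0 \<and> g v = 0"
  using kernel_vector dim2 by blast

lemma kernel2': "clin (g :: 'b cdual \<Rightarrow> complex) \<Longrightarrow> \<exists>v. v \<noteq> 0 \<and> g v = 0"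
proof -
  assume g: "clin g"
  obtain x y :: 'b where "indep2 x y" using dim2 by blast
  then obtain f1 f2 :: "'b cdual" where f: "f1 x = 1" "f1 y = 0" "f2 x = 0" "f2 y = 1"
    using dual_pair by metis
  have "indep2 f1 f2"
    unfolding indep2_def
  proof (intro allI impI)
    fix a b assume 0: "a *\<^sub>C f1 + b *\<^sub>C f2 = 0"
    then have "(a *\<^sub>C f1 + b *\<^sub>C f2) x = 0" "(a *\<^sub>C f1 + b *\<^sub>C f2) y = 0" by simp_all
    then show "a = 0 \<and> b = 0" using f by simp
  qed
  then show ?thesis using kernel_vector g by blast
qed

lemma nzspec_preserved:
  assumes "A \<in> \<A>\<^sub>1" "cblinfun_apply f x = 1"
  shows "nzspec (jordan_pair r s (\<Phi> A) (\<Phi> (tensor x f))) =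
    root_set (f (A x)) (sq_term s (f (A x)) (f (A (A x))))"
  using preserves[OF assms(1) tensor_mem[of x f]] rank_at_most_tensor[of x f]
    nzspec_jordan_pair_idempotent[of f x r s A, OF assms(2) r1] by (simp add: nzspec_def)

text \<open>All products with \<open>0\<close> vanish, so \<open>\<Phi> 0\<close> is indistinguishable from \<open>0\<close> by idempotents of rank one,
  which are all in the range of \<open>\<Phi>\<close>.\<close>

lemma \<Phi>_zero: "\<Phi> 0 = 0"
proof (rule jordan_pair_determines_operator[OF r1])
  fix z and h :: "'b cdual"
  obtain B where B: "B \<in> \<A>\<^sub>1" "\<Phi> B = tensor z h" by (rule onto_tensor)
  have "nzspec (jordan_pair r s (\<Phi> 0) (\<Phi> B)) = nzspec (jordan_pair r s 0 B)"
    using preserves[OF zero_mem B(1) disjI1[OF rank_at_most_zero]] by (simp add: nzspec_def)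
  then show "nzspec (jordan_pair r s (\<Phi> 0) (tensor z h)) = nzspec (jordan_pair r s 0 (tensor z h))"
    by (simp add: B(2) jordan_pair_zero nzspec_zero)
qed

lemma idempotent_image:
  assumes fx: "cblinfun_apply f x = 1"
  shows "idempotent_image (\<Phi> (tensor x f)) r s"
proof
  show "\<exists>p q. nzspec (jordan_pair r s (tensor z1 h1 + tensor z2 h2 + tensor z3 h3) (\<Phi> (tensor x f))) =
      root_set p (sq_term s p q)" for z1 h1 z2 h2 z3 h3
  proof -
    obtain A where "A \<in> \<A>\<^sub>1" "\<Phi> A = tensor z1 h1 + tensor z2 h2 + tensor z3 h3"
      by (rule onto_rank_three)
    then show ?thesis using nzspec_preserved[OF _ fx, of A] by metis
  qed
  show "nzspec (jordan_pair r s (\<Phi> (tensor x f)) (\<Phi> (tensor x f))) = {2}"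
  proof -
    have "sq_term s 1 1 = 1\<^sup>2" by (simp add: sq_term_def)
    then show ?thesis
      using nzspec_preserved[OF tensor_mem[of x f] fx] root_set_square[of 1] by (simp add: fx)
  qed
  obtain y where y: "y \<noteq> 0" "f y = 0" using kernel1[OF clin_apply] by blast
  then have "0 \<in> spectrum (jordan_pair r s (tensor x f) (tensor x f))"
    using jordan_pair_idempotent_self(1)[OF fx] by blast
  then show "0 \<in> spectrum (jordan_pair r s (\<Phi> (tensor x f)) (\<Phi> (tensor x f)))"
    using preserves[OF tensor_mem tensor_mem] rank_at_most_tensor by blast
qed (use r1 s_le_r in auto)

text \<open>For idempotent \<open>x \<otimes> f\<close> this is the operator of rank one produced by \<open>power_rank_one\<close>.\<close>

definition M :: "'a \<Rightarrow> 'a cdual \<Rightarrow> 'b \<Rightarrow>\<^sub>C\<^sub>L 'b"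
  where "M x f = opow (\<Phi> (tensor x f)) (r + s)"

definition represents :: "'a \<Rightarrow> 'a cdual \<Rightarrow> 'b \<Rightarrow> 'b cdual \<Rightarrow> bool"
  where "represents x f v g \<longleftrightarrow> M x f = tensor v g \<and> (g v) ^ (r + s + 1) = 1 \<and>
    (\<forall>z h. nzspec (jordan_pair r s (tensor z h) (\<Phi> (tensor x f))) =
      root_set (h (M x f z)) (sq_term s (h (M x f z)) (g v * h z * h (M x f z))))"

lemma ex_represents:
  assumes fx: "cblinfun_apply f x = 1"
  shows "\<exists>v g. represents x f v g"
proof -
  interpret idempotent_image "\<Phi> (tensor x f)" r s by (rule idempotent_image[OF fx])
  show ?thesis using power_rank_one unfolding represents_def M_def by metis
qed

lemma representsD:
  assumes "represents x f v g"
  shows "M x f = tensor v g" "(g v) ^ (r + s + 1) = 1" "g v \<noteq> 0"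
    "nzspec (jordan_pair r s (tensor z h) (\<Phi> (tensor x f))) =
      root_set (h (M x f z)) (sq_term s (h (M x f z)) (g v * h z * h (M x f z)))"
  using assms by (auto simp: represents_def)

lemma M_rank_one:
  assumes fx: "cblinfun_apply f x = 1"
  obtains v g where "M x f = tensor v g" "g v \<noteq> 0"
  using ex_represents[OF fx] representsD(1,3) by blast

text \<open>Otherwise \<open>z \<otimes> h = \<Phi> A\<close> where all products of \<open>A\<close> with idempotents of rank one have no nonzero
  spectral value; then \<open>A = 0\<close> and \<open>z \<otimes> h = \<Phi> 0 = 0\<close>.\<close>

lemma M_separates:
  fixes z :: 'b and h :: "'b cdual"
  assumes "z \<noteq> 0" "h \<noteq> 0"
  shows "\<exists>x f. cblinfun_apply f x = 1 \<and> h (M x f z) \<noteq> 0"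
proof (rule ccontr)
  assume no: "\<not> ?thesis"
  obtain A where A: "A \<in> \<A>\<^sub>1" "\<Phi> A = tensor z h" by (rule onto_tensor)
  have "A = 0"
  proof (rule jordan_pair_determines_operator[OF r1])
    fix x and f :: "'a cdual" assume fx: "f x = 1"
    obtain v g where vg: "represents x f v g"
      using ex_represents[OF fx] by blast
    moreover have "h (M x f z) = 0" using no fx by blast
    ultimately have "nzspec (jordan_pair r s (\<Phi> A) (\<Phi> (tensor x f))) = {}"
      by (auto simp: A representsD(4)[OF vg] sq_term_def root_set_def)
    then show "nzspec (jordan_pair r s A (tensor x f)) = nzspec (jordan_pair r s 0 (tensor x f))"
      using preserves[OF A(1) tensor_mem[of x f]] rank_at_most_tensor[of x f]
      by (simp add: nzspec_def[of "jordan_pair r s A (tensor x f)"] nzspec_def[of "jordan_pair r s (\<Phi> A) _"]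
          jordan_pair_zero nzspec_zero)
  qed
  then have "tensor z h = 0" using A(2) \<Phi>_zero by simp
  moreover obtain y where "cblinfun_apply h y \<noteq> 0"
    using assms(2) by (metis cblinfun_eqI zero_cblinfun.rep_eq)
  moreover have "tensor z h y = h y *\<^sub>C z" by simp
  ultimately show False using assms(1) by (metis scaleC_eq_0_iff zero_cblinfun.rep_eq)
qed

text \<open>The genericity conditions say that on the side of \<open>\<Phi> A\<close> the roots are distinct and nonzero if
  \<open>s = 0\<close>; this excludes the ambiguity of the root sets, and the means agree.\<close>

lemma generic_trace_identity:
  fixes h :: "'b cdual" and f :: "'a cdual"
  assumes A: "A \<in> \<A>\<^sub>1" "\<Phi> A = tensor z h" and fx: "f x = 1" and M: "M x f = tensor v g"
    and generic: "h z \<noteq> 0" "h (M x f z) \<noteq> 0" "h (M x f z) \<noteq> g v * h z"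
  shows "f (A x) = h (M x f z)"
proof -
  obtain v' g' where vg: "represents x f v' g'"
    using ex_represents[OF fx] by blast
  note M' = representsD[OF vg]
  have b: "g' v' = g v" by (rule tensor_trace) (use M M'(1) in simp)
  have "root_set (f (A x)) (sq_term s (f (A x)) (f (A (A x)))) =
      root_set (h (M x f z)) (sq_term s (h (M x f z)) (g v * h z * h (M x f z)))"
    using nzspec_preserved[OF A(1) fx] A(2) M'(4)[of z h] b by simp
  from root_set_eqD[OF this] show ?thesis
    using generic M'(3) b by (auto simp: sq_term_def power2_eq_square split: if_splits)
qed

text \<open>If the trace identity at finitely many probes forces \<open>h (D z) = 0\<close>, then \<open>D = 0\<close>: the conditions that
  make the trace identity valid at the probes exclude the zeros of finitely many nonzero bilinear forms in
  \<open>(z, h)\<close>, and if \<open>D \<noteq> 0\<close> the form \<open>h (D z)\<close> could be added to them.\<close>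

lemma generic_test:
  fixes D :: "'b \<Rightarrow>\<^sub>C\<^sub>L 'b"
  assumes I: "finite I" "\<And>x f. (x, f) \<in> I \<Longrightarrow> cblinfun_apply f x = 1"
    and D: "\<And>A z h. A \<in> \<A>\<^sub>1 \<Longrightarrow> (\<And>x f. (x, f) \<in> I \<Longrightarrow> cblinfun_apply f (A x) = cblinfun_apply h (M x f z))
      \<Longrightarrow> cblinfun_apply h (D z) = 0"
  shows "D = 0"
proof (rule ccontr)
  assume "D \<noteq> 0"
  define b where "b x f = (SOME c. \<exists>v g. M x f = tensor v g \<and> g v = c \<and> c \<noteq> 0)" for x f
  have b: "\<exists>v g. M x f = tensor v g \<and> g v = b x f \<and> b x f \<noteq> 0" if xf: "(x, f) \<in> I" for x f
  proof -
    obtain v g where "M x f = tensor v g" "g v \<noteq> 0" using M_rank_one[OF I(2)[OF xf]] by metis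
    then have "\<exists>c. \<exists>v g. M x f = tensor v g \<and> g v = c \<and> c \<noteq> 0" by blast
    then show ?thesis unfolding b_def by (rule someI_ex)
  qed
  \<comment> \<open>The forms whose non-vanishing makes \<open>(z, h)\<close> generic for all probes at once.\<close>
  define E :: "('b \<Rightarrow> 'b cdual \<Rightarrow> complex) set" where "E = {\<lambda>z h. cblinfun_apply h z, \<lambda>z h. cblinfun_apply h (D z)} \<union>
    (\<lambda>(x, f) z h. cblinfun_apply h (M x f z)) ` I \<union> (\<lambda>(x, f) z h. cblinfun_apply h (M x f z) - b x f * cblinfun_apply h z) ` I"
  have functional: "\<exists>h :: 'b cdual. h y \<noteq> 0" if "y \<noteq> 0" for y
    using eq_0_if_functionals_0 that by blast
  have "\<exists>z h. \<forall>e\<in>E. e z h \<noteq> 0"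
  proof (rule common_nonzero_bilin)
    show "finite E" using I(1) by (auto simp: E_def)
    fix e assume e: "e \<in> E"
    show "bilin e" using e by (auto simp: E_def bilin_def clin_def algebra_simps)
    obtain y :: 'b where y: "y \<noteq> 0" using dim2 indep2_nonzero by blast
    obtain y' where y': "D y' \<noteq> 0" using \<open>D \<noteq> 0\<close> by (metis cblinfun_eqI zero_cblinfun.rep_eq)
    from e consider "e = (\<lambda>z h. cblinfun_apply h z)" | "e = (\<lambda>z h. cblinfun_apply h (D z))"
      | x f where "(x, f) \<in> I" "e = (\<lambda>z h. cblinfun_apply h (M x f z))"
      | x f where "(x, f) \<in> I" "e = (\<lambda>z h. cblinfun_apply h (M x f z) - b x f * cblinfun_apply h z)"
      by (auto simp: E_def)
    then show "\<exists>z h. e z h \<noteq> 0"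
    proof cases
      case (3 x f)
      obtain v g where "M x f = tensor v g" "g v \<noteq> 0" using b[OF 3(1)] by force
      then have "M x f v \<noteq> 0" by auto
      then show ?thesis using functional 3 by blast
    next
      case (4 x f)
      obtain v g where M: "M x f = tensor v g" "b x f \<noteq> 0" using b[OF 4(1)] by force
      obtain w where w: "w \<noteq> 0" "g w = 0" using kernel2[OF clin_apply] by blast
      obtain h :: "'b cdual" where "h w \<noteq> 0" using functional[OF w(1)] by blast
      then have "e w h \<noteq> 0" using M w by (simp add: 4)
      then show ?thesis by blast
    qed (use functional y y' in blast)+
  qed
  then obtain z h where zh: "\<And>e. e \<in> E \<Longrightarrow> e z h \<noteq> 0" by blast
  obtain A where A: "A \<in> \<A>\<^sub>1" "\<Phi> A = tensor z h" by (rule onto_tensor)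
  have "cblinfun_apply h (D z) = 0"
  proof (rule D[OF A(1)])
    fix x f assume xf: "(x, f) \<in> I"
    obtain v g where M: "M x f = tensor v g" "g v = b x f" using b[OF xf] by blast
    have "h z \<noteq> 0" using zh[of "\<lambda>z h. cblinfun_apply h z"] by (simp add: E_def)
    moreover have "h (M x f z) \<noteq> 0"
      using zh[of "\<lambda>z h. cblinfun_apply h (M x f z)"] xf by (force simp: E_def)
    moreover have "h (M x f z) - b x f * h z \<noteq> 0"
      using zh[of "\<lambda>z h. cblinfun_apply h (M x f z) - b x f * h z"] xf by (force simp: E_def)
    ultimately show "cblinfun_apply f (A x) = h (M x f z)"
      using generic_trace_identity[OF A I(2)[OF xf] M(1)] M(2) by simp
  qed
  moreover have "h (D z) \<noteq> 0" using zh[of "\<lambda>z h. cblinfun_apply h (D z)"] by (simp add: E_def)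
  ultimately show False by simp
qed

subsection \<open>Bilinear extension\<close>

definition unit :: "'a cdual \<Rightarrow> 'a"
  where "unit f = (SOME y. f y = 1)"

lemma unit: "f \<noteq> 0 \<Longrightarrow> f (unit f) = 1"
proof -
  assume "f \<noteq> 0"
  then obtain y where "cblinfun_apply f y \<noteq> 0" by (metis cblinfun_eqI zero_cblinfun.rep_eq)
  then have "cblinfun_apply f (inverse (f y) *\<^sub>C y) = 1" by simp
  then show ?thesis unfolding unit_def by (rule someI)
qed

text \<open>The combination of two values of \<open>M\<close> at idempotents for which the trace identity yields
  \<open>f (A x)\<close>: the vectors \<open>x + (1 - f x) *\<^sub>C unit f\<close> and \<open>unit f\<close> have value \<open>1\<close> under \<open>f\<close>.\<close>

definition G :: "'a \<Rightarrow> 'a cdual \<Rightarrow> 'b \<Rightarrow>\<^sub>C\<^sub>L 'b"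
  where "G x f = (if f = 0 then 0 else
    M (x + (1 - f x) *\<^sub>C unit f) f - (1 - f x) *\<^sub>C M (unit f) f)"

definition probes :: "'a \<Rightarrow> 'a cdual \<Rightarrow> ('a \<times> 'a cdual) set"
  where "probes x f = (if f = 0 then {} else {(x + (1 - f x) *\<^sub>C unit f, f), (unit f, f)})"

lemma finite_probes: "finite (probes x f)"
  by (simp add: probes_def)

lemma probes_unit: "(y, k) \<in> probes x f \<Longrightarrow> k y = 1"
  by (auto simp: probes_def unit split: if_splits)

lemma G_test:
  fixes h :: "'b cdual" and A :: "'a \<Rightarrow>\<^sub>C\<^sub>L 'a"
  assumes "\<And>y k. (y, k) \<in> probes x f \<Longrightarrow> cblinfun_apply k (A y) = h (M y k z)"
  shows "h (G x f z) = f (A x)"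
proof (cases "f = 0")
  case False
  then have "f (A (x + (1 - f x) *\<^sub>C unit f)) = h (M (x + (1 - f x) *\<^sub>C unit f) f z)"
    "f (A (unit f)) = h (M (unit f) f z)"
    using assms[of "x + (1 - f x) *\<^sub>C unit f" f] assms[of "unit f" f]
    by (simp_all add: probes_def)
  then show ?thesis using False by (simp add: G_def algebra_simps)
qed (simp add: G_def)

lemma G_eq_M: "cblinfun_apply f x = 1 \<Longrightarrow> G x f = M x f"
  by (auto simp: G_def)

text \<open>Every linear relation among the functionals \<open>A \<mapsto> f (A x)\<close> carries over to \<open>G\<close>; bilinearity of \<open>G\<close> is
  the special case of the obvious relations.\<close>

lemma G_relation:
  assumes "finite I" and "\<And>A :: 'a \<Rightarrow>\<^sub>C\<^sub>L 'a. (\<Sum>i\<in>I. c i * cblinfun_apply (f i) (A (x i))) = 0"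
  shows "(\<Sum>i\<in>I. c i *\<^sub>C G (x i) (f i)) = 0"
proof -
  have sum_apply: "cblinfun_apply h ((\<Sum>i\<in>I. c i *\<^sub>C G (x i) (f i)) z) =
      (\<Sum>i\<in>I. c i * h (G (x i) (f i) z))" for h :: "'b cdual" and z
    using assms(1) by (induction I rule: finite_induct) simp_all
  show ?thesis
  proof (rule generic_test[of "\<Union>i\<in>I. probes (x i) (f i)"])
    show "finite (\<Union>i\<in>I. probes (x i) (f i))" using assms(1) finite_probes by blast
    fix A :: "'a \<Rightarrow>\<^sub>C\<^sub>L 'a" and z and h :: "'b cdual"
    assume *: "\<And>y k. (y, k) \<in> (\<Union>i\<in>I. probes (x i) (f i)) \<Longrightarrow>
      cblinfun_apply k (A y) = cblinfun_apply h (M y k z)"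
    have "h (G (x i) (f i) z) = f i (A (x i))" if "i \<in> I" for i
      by (rule G_test) (use * that in blast)
    then show "h ((\<Sum>i\<in>I. c i *\<^sub>C G (x i) (f i)) z) = 0"
      unfolding sum_apply using assms(2)[of A] by simp
  qed (use probes_unit in blast)
qed

lemma G_add_left: "G (x + y) f = G x f + G y f"
proof -
  have "(\<Sum>i\<in>{0,1,2::nat}. (if i = 0 then 1 else -1) *\<^sub>C G (if i = 0 then x + y else if i = 1 then x else y) f) = 0"
    by (rule G_relation) simp_all
  then show ?thesis by (simp add: algebra_simps)
qed

lemma G_scaleC_left: "G (c *\<^sub>C x) f = c *\<^sub>C G x f"
proof -
  have "(\<Sum>i\<in>{0,1::nat}. (if i = 0 then 1 else - c) *\<^sub>C G (if i = 0 then c *\<^sub>C x else x) f) = 0"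
    by (rule G_relation) simp_all
  then show ?thesis by simp
qed

lemma G_add_right: "G x (f + g) = G x f + G x g"
proof -
  have "(\<Sum>i\<in>{0,1,2::nat}. (if i = 0 then 1 else -1) *\<^sub>C G x (if i = 0 then f + g else if i = 1 then f else g)) = 0"
    by (rule G_relation) simp_all
  then show ?thesis by (simp add: algebra_simps)
qed

lemma G_scaleC_right: "G x (c *\<^sub>C f) = c *\<^sub>C G x f"
proof -
  have "(\<Sum>i\<in>{0,1::nat}. (if i = 0 then 1 else - c) *\<^sub>C G x (if i = 0 then c *\<^sub>C f else f)) = 0"
    by (rule G_relation) simp_all
  then show ?thesis by simp
qed

lemmas G_linear = G_add_left G_scaleC_left G_add_right G_scaleC_right

text \<open>For \<open>f x \<noteq> 0\<close> the operator is a multiple of a value of \<open>M\<close>. For \<open>f x = 0\<close> it is the direction of a line of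
  operators of rank one, and the minors of a line are quadratic polynomials whose leading coefficient is the
  minor of the direction.\<close>

lemma G_minor:
  fixes h h' :: "'b cdual"
  shows "h (G x f z) * h' (G x f z') = h' (G x f z) * h (G x f z')"
proof -
  have 1: "h (G x f z) * h' (G x f z') = h' (G x f z) * h (G x f z')" if fx: "f x = 1" for x
  proof -
    obtain v g where "M x f = tensor v g" using M_rank_one[OF fx] by metis
    then show ?thesis using fx by (simp add: G_eq_M mult_ac)
  qed
  show ?thesis
  proof (cases "f x = 0")
    case False
    have "f (inverse (f x) *\<^sub>C x) = 1" using False by simp
    from 1[OF this] have "inverse (f x) * inverse (f x) * (h (G x f z) * h' (G x f z')) =
        inverse (f x) * inverse (f x) * (h' (G x f z) * h (G x f z'))"
      by (simp add: G_linear mult_ac)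
    then show ?thesis using False by simp
  next
    case True
    show ?thesis
    proof (cases "f = 0")
      case False
      define y where "y = unit f"
      have y: "f y = 1" using unit[OF False] by (simp add: y_def)
      define m where "m u w = h (G u f z) * h' (G w f z') - h' (G u f z) * h (G w f z')" for u w
      have *: "m y y + (m y x + m x y) * t + m x x * t\<^sup>2 = 0" if "t \<notin> {}" for t
      proof -
        have "m (y + t *\<^sub>C x) (y + t *\<^sub>C x) = 0"
          unfolding m_def using 1[of "y + t *\<^sub>C x"] by (simp add: y True)
        then show ?thesis by (simp add: m_def G_linear algebra_simps power2_eq_square)
      qed
      from quadratic_zero[OF finite.emptyI *] have "m x x = 0" by blast
      then show ?thesis by (simp add: m_def)
    qed (simp add: G_def)
  qed
qed

sublocale forms: rank_one_forms "\<lambda>x f z (h :: 'b cdual). h (G x f z)"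
proof
  show "\<exists>x f. cblinfun_apply h (G x f z) \<noteq> 0" if "z \<noteq> 0" "h \<noteq> 0" for z and h :: "'b cdual"
    using M_separates[OF that] G_eq_M by metis
  show "\<exists>x z h. cblinfun_apply (h :: 'b cdual) (G x f z) \<noteq> 0" if f: "f \<noteq> 0" for f
  proof -
    have 1: "f (unit f) = 1" by (rule unit[OF f])
    obtain v g where "M (unit f) f = tensor v g" "g v \<noteq> 0" using M_rank_one[OF 1] by metis
    then have "G (unit f) f v \<noteq> 0" using G_eq_M[OF 1] by auto
    then obtain h :: "'b cdual" where "h (G (unit f) f v) \<noteq> 0" using eq_0_if_functionals_0 by blast
    then show ?thesis by blast
  qed
qed (use kernel2 kernel2' G_minor in \<open>auto simp: clin_def G_linear mult.commute\<close>)

section \<open>From the bilinear extension to the two forms\<close>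

text \<open>For fixed \<open>z\<close>, \<open>h\<close> and \<open>A\<close> both sides are now bilinear in \<open>(x, f)\<close>, and the exceptions to the generic
  identity are the zeros of the forms \<open>f x\<close>, \<open>h (G x f z)\<close> and \<open>h (G x f z) - \<kappa> * h z * f x\<close>. The last one is not
  identically zero because \<open>h (G x f z)\<close> vanishes at some point with \<open>f x \<noteq> 0\<close>.\<close>

lemma trace_identity:
  fixes h :: "'b cdual" and f :: "'a cdual"
  assumes A: "A \<in> \<A>\<^sub>1" "\<Phi> A = tensor z h" and hz: "h z \<noteq> 0"
    and \<kappa>: "\<And>x f v g. cblinfun_apply f x = 1 \<Longrightarrow> M x f = tensor v g \<Longrightarrow> g v = \<kappa>"
    and zero: "cblinfun_apply f' x' \<noteq> 0" "h (G x' f' z) = 0"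
  shows "f (A x) = h (G x f z)"
proof (rule ccontr)
  assume ne: "f (A x) \<noteq> h (G x f z)"
  define e2 where "e2 x f = h (G x f z)" for x and f :: "'a cdual"
  define e3 where "e3 x f = h (G x f z) - \<kappa> * h z * f x" for x and f :: "'a cdual"
  define e4 where "e4 x f = f (A x) - h (G x f z)" for x and f :: "'a cdual"
  have one: "cblinfun_apply f' (inverse (f' x') *\<^sub>C x') = 1" using zero by simp
  have \<kappa>0: "\<kappa> \<noteq> 0" using M_rank_one[OF one] \<kappa>[OF one] by metis
  have "z \<noteq> 0" "h \<noteq> 0" using hz by auto
  then obtain x2 f2 where 2: "cblinfun_apply f2 x2 = 1" "h (M x2 f2 z) \<noteq> 0" using M_separates by blast
  have "\<exists>x f. \<forall>e\<in>{\<lambda>x f. cblinfun_apply f x, e2, e3, e4}. e x f \<noteq> 0"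
  proof (rule common_nonzero_bilin)
    fix e assume "e \<in> {\<lambda>x f. cblinfun_apply f x, e2, e3, e4}"
    then consider "e = (\<lambda>x f. cblinfun_apply f x)" | "e = e2" | "e = e3" | "e = e4" by blast
    note c = this
    show "bilin e"
      using c by cases (auto simp: bilin_def clin_def e2_def e3_def e4_def G_linear algebra_simps)
    show "\<exists>x f. e x f \<noteq> 0"
      using c
    proof cases
      case 1
      then show ?thesis using zero(1) by blast
    next
      case 2
      then have "e x2 f2 \<noteq> 0" using \<open>f2 x2 = 1\<close> \<open>h (M x2 f2 z) \<noteq> 0\<close> by (simp add: e2_def G_eq_M)
      then show ?thesis by blast
    next
      case 3
      then have "e x' f' \<noteq> 0" using zero hz \<kappa>0 by (simp add: e3_def)
      then show ?thesis by blast
    next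
      case 4
      then have "e x f \<noteq> 0" using ne by (simp add: e4_def)
      then show ?thesis by blast
    qed
  qed simp
  then obtain x f where xf: "cblinfun_apply f x \<noteq> 0" "e2 x f \<noteq> 0" "e3 x f \<noteq> 0" "e4 x f \<noteq> 0"
    by auto
  define y where "y = inverse (f x) *\<^sub>C x"
  have fy: "f y = 1" using xf by (simp add: y_def)
  have x: "x = f x *\<^sub>C y" using xf by (simp add: y_def scaleC_scaleC)
  obtain v g where M: "M y f = tensor v g" using M_rank_one[OF fy] by metis
  have Gy: "G x f = f x *\<^sub>C M y f"
    using x G_scaleC_left G_eq_M[OF fy] by metis
  have "f (A y) = h (M y f z)"
  proof (rule generic_trace_identity[OF A fy M hz])
    show "h (M y f z) \<noteq> 0" using xf by (simp add: e2_def Gy)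
    show "h (M y f z) \<noteq> g v * h z" using xf \<kappa>[OF fy M] by (auto simp: e3_def Gy)
  qed
  moreover have "f (A x) = f x * f (A y)" by (subst (1) x) simp
  ultimately have "e4 x f = 0" by (simp add: e4_def Gy)
  with xf show False by simp
qed

text \<open>The assumption on \<open>\<Theta>\<close> says that \<open>c *\<^sub>C \<Theta>\<close> agrees with \<open>\<Phi>\<close> on idempotents of rank one, all of which have
  the form \<open>\<Theta> P\<close>, and that \<open>\<Theta>\<close> respects the pairings which describe the spectra. Then \<open>c\<^bsup>r+s\<^esup> *\<^sub>C \<Phi> A\<close> and
  \<open>\<Theta> A\<close> have the same products with all idempotents of rank one, as far as spectra can tell.\<close>

lemma determined_by_idempotents:
  fixes \<Theta> :: "('a \<Rightarrow>\<^sub>C\<^sub>L 'a) \<Rightarrow> 'b \<Rightarrow>\<^sub>C\<^sub>L 'b"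
  assumes c: "c ^ (r + s + 1) = 1"
    and \<Theta>: "\<And>z h. cblinfun_apply h z = 1 \<Longrightarrow> \<exists>x f. cblinfun_apply f x = 1 \<and>
      \<Phi> (tensor x f) = c *\<^sub>C tensor z h \<and>
      (\<forall>A. h (\<Theta> A z) = f (A x) \<and> h (\<Theta> A (\<Theta> A z)) = f (A (A x)))"
    and A: "A \<in> \<A>\<^sub>1"
  shows "\<Phi> A = c *\<^sub>C \<Theta> A"
proof -
  have "c ^ (r + s) *\<^sub>C \<Phi> A = \<Theta> A"
  proof (rule jordan_pair_determines_operator[OF r1])
    fix z and h :: "'b cdual" assume hz: "h z = 1"
    obtain x f where xf: "cblinfun_apply f x = 1" "\<Phi> (tensor x f) = c *\<^sub>C tensor z h"
      "h (\<Theta> A z) = f (A x)" "h (\<Theta> A (\<Theta> A z)) = f (A (A x))"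
      using \<Theta>[OF hz] by blast
    have "nzspec (jordan_pair r s (c ^ (r + s) *\<^sub>C \<Phi> A) (tensor z h)) =
        nzspec (jordan_pair r s (\<Phi> A) (\<Phi> (tensor x f)))"
      by (simp add: xf(2) jordan_pair_scaleC)
    also have "\<dots> = root_set (f (A x)) (sq_term s (f (A x)) (f (A (A x))))"
      by (rule nzspec_preserved[OF A xf(1)])
    also have "\<dots> = nzspec (jordan_pair r s (\<Theta> A) (tensor z h))"
      unfolding nzspec_jordan_pair_idempotent[of h z, OF hz r1] xf(3,4) ..
    finally show "nzspec (jordan_pair r s (c ^ (r + s) *\<^sub>C \<Phi> A) (tensor z h)) =
        nzspec (jordan_pair r s (\<Theta> A) (tensor z h))" .
  qed
  then have "c *\<^sub>C \<Theta> A = (c * c ^ (r + s)) *\<^sub>C \<Phi> A" by (simp add: scaleC_scaleC flip: \<open>_ = \<Theta> A\<close>)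
  then show ?thesis using c by simp
qed

lemma G_factors:
  "(\<exists>T S. clin T \<and> clin S \<and> (\<forall>x f. G x f = tensor (T x) (S f))) \<or>
   (\<exists>T S. clin T \<and> clin S \<and> (\<forall>x f. G x f = tensor (T f) (S x)))"
  using forms.factorization
proof (elim disjE exE conjE)
  fix x1 f0 z0 and h1 :: "'b cdual"
  assume n: "h1 (G x1 f0 z0) \<noteq> 0"
    and eq: "\<forall>x f z (h :: 'b cdual). h (G x f z) * h1 (G x1 f0 z0) = h (G x f0 z0) * h1 (G x1 f z)"
  define T where "T x = G x f0 z0" for x
  define S where "S f = inverse (h1 (G x1 f0 z0)) *\<^sub>C (h1 o\<^sub>C\<^sub>L G x1 f)" for f
  have "clin T" by (simp add: clin_def T_def G_linear)
  moreover have "clin S"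
    by (auto simp: clin_def S_def G_linear algebra_simps intro!: cblinfun_eqI)
  moreover have "G x f = tensor (T x) (S f)" for x f
  proof (rule cblinfun_eqI, rule eq_if_functionals_eq)
    fix z and h :: "'b cdual"
    show "h (G x f z) = h (tensor (T x) (S f) z)"
      using eq[rule_format, of h x f z] n by (simp add: T_def S_def field_simps)
  qed
  ultimately show ?thesis by blast
next
  fix x1 f0 z0 and h1 :: "'b cdual"
  assume n: "h1 (G x1 f0 z0) \<noteq> 0"
    and eq: "\<forall>x f z (h :: 'b cdual). h (G x f z) * h1 (G x1 f0 z0) = h1 (G x f0 z) * h (G x1 f z0)"
  define T where "T f = G x1 f z0" for f
  define S where "S x = inverse (h1 (G x1 f0 z0)) *\<^sub>C (h1 o\<^sub>C\<^sub>L G x f0)" for x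
  have "clin T" by (simp add: clin_def T_def G_linear)
  moreover have "clin S"
    by (auto simp: clin_def S_def G_linear algebra_simps intro!: cblinfun_eqI)
  moreover have "G x f = tensor (T f) (S x)" for x f
  proof (rule cblinfun_eqI, rule eq_if_functionals_eq)
    fix z and h :: "'b cdual"
    show "h (G x f z) = h (tensor (T f) (S x) z)"
      using eq[rule_format, of h x f z] n by (simp add: T_def S_def field_simps)
  qed
  ultimately show ?thesis by blast
qed

lemma nonzero1: "\<exists>x :: 'a. x \<noteq> 0"
  using dim1 indep2_nonzero by blast

lemma G_separates:
  fixes z :: 'b and h :: "'b cdual"
  assumes "z \<noteq> 0" "h \<noteq> 0"
  shows "\<exists>x f. h (G x f z) \<noteq> 0"
  using M_separates[OF assms] G_eq_M by metis

lemma G_trace: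
  assumes \<beta>: "bilin \<beta>" and G: "\<And>x f. \<exists>v g. G x f = tensor v g \<and> \<beta> x f = g v"
  shows "\<exists>\<kappa>. \<kappa> ^ (r + s + 1) = 1 \<and> (\<forall>x f. \<beta> x f = \<kappa> * cblinfun_apply f x) \<and>
    (\<forall>x f v g. cblinfun_apply f x = 1 \<longrightarrow> M x f = tensor v g \<longrightarrow> g v = \<kappa>)"
proof -
  have tr: "\<beta> x f = g v" if "cblinfun_apply f x = 1" "M x f = tensor v g" for x f v g
    using G[of x f] G_eq_M[OF that(1)] that(2) tensor_trace by metis
  obtain x0 :: 'a where x0: "x0 \<noteq> 0" using nonzero1 by blast
  have root: "\<beta> x f ^ (r + s + 1) = 1" if fx: "cblinfun_apply f x = 1" for x f
  proof -
    obtain v g where vg: "represents x f v g" using ex_represents[OF fx] by blast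
    show ?thesis using tr[OF fx representsD(1)[OF vg]] representsD(2)[OF vg] by simp
  qed
  obtain \<kappa> where k: "\<kappa> ^ (r + s + 1) = 1" "\<And>x f. \<beta> x f = \<kappa> * f x"
    using trace_form_eq[OF \<beta> _ root x0] by auto
  moreover have "g v = \<kappa>" if "cblinfun_apply f x = 1" "M x f = tensor v g" for x f v g
    using tr[OF that] k(2)[of x f] that(1) by simp
  ultimately show ?thesis by blast
qed

lemma inverse_root: "\<kappa> ^ n = (1 :: complex) \<Longrightarrow> inverse \<kappa> ^ n = 1"
  by (simp add: power_inverse)

text \<open>By the trace identity, \<open>z \<otimes> h = \<Phi> A\<close> gives \<open>f (A x) = h (T x) * S f z\<close>. With \<open>h (T x) \<noteq> 0\<close> this represents
  \<open>f \<mapsto> S f z\<close> by a vector, whose image under \<open>T\<close> is \<open>\<kappa> z\<close>, so \<open>T\<close> is onto; with \<open>S f z \<noteq> 0\<close> it shows that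
  \<open>h \<circ> T\<close> is bounded. Finally \<open>(z / \<kappa>) \<otimes> h\<close> with \<open>h z = 1\<close> can only come from \<open>T\<^bsup>-1\<^esup> z \<otimes> (h \<circ> T)\<close>.\<close>

theorem direct_form:
  assumes T: "clin T" and S: "clin S" and G: "\<And>x f. G x f = tensor (T x) (S f)"
  shows "\<exists>c (T :: 'a \<Rightarrow>\<^sub>C\<^sub>L 'b). c ^ (r + s + 1) = 1 \<and> cblinfun_invertible T \<and>
    (\<forall>A\<in>\<A>\<^sub>1. \<Phi> A = c *\<^sub>C (T o\<^sub>C\<^sub>L A o\<^sub>C\<^sub>L cblinfun_inv T))"
proof -
  note lin = clin_simps[OF T] clin_simps[OF S]
  have bil: "bilin (\<lambda>x f. S f (T x))" by (auto simp: bilin_def clin_def lin)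
  have "\<exists>v g. G x f = tensor v g \<and> S f (T x) = g v" for x f using G by blast
  from G_trace[OF bil this] obtain \<kappa> where \<kappa>: "\<kappa> ^ (r + s + 1) = 1"
    and tr: "S f (T x) = \<kappa> * f x"
    and \<kappa>M: "cblinfun_apply f x = 1 \<Longrightarrow> M x f = tensor v g \<Longrightarrow> g v = \<kappa>" for x f v g
    by blast
  have \<kappa>0: "\<kappa> \<noteq> 0" using \<kappa> by auto
  have key: "f (A x) = h (T x) * S f z"
    if "A \<in> \<A>\<^sub>1" "\<Phi> A = tensor z h" "cblinfun_apply h z \<noteq> 0" for A z h x and f :: "'a cdual"
  proof -
    have "clin (\<lambda>x. cblinfun_apply h (T x))" by (simp add: clin_def lin)
    then obtain x1 where x1: "x1 \<noteq> 0" "cblinfun_apply h (T x1) = 0" using kernel1 by blast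
    obtain f1 :: "'a cdual" where "f1 x1 = 1" using separating_functional[OF x1(1)] by metis
    then have "f (A x) = h (G x f z)"
      by (intro trace_identity[OF that \<kappa>M, where f' = f1 and x' = x1]) (auto simp: G x1)
    then show ?thesis by (simp add: G mult.commute)
  qed
  have sep: "\<exists>x f. cblinfun_apply h (T x) \<noteq> 0 \<and> S f z \<noteq> 0" if "z \<noteq> 0" "h \<noteq> 0" for z and h :: "'b cdual"
    using G_separates[OF that] by (auto simp: G)
  have S_sep: "w = 0" if "\<And>f. S f w = 0" for w
  proof (rule ccontr)
    assume w: "w \<noteq> 0"
    obtain h :: "'b cdual" where "h w = 1" using separating_functional[OF w] by metis
    then have "h \<noteq> 0" by auto
    then show False using sep[OF w] that by blast
  qed
  have pre: "\<exists>x. \<forall>f. cblinfun_apply f x = S f z" for z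
  proof (cases "z = 0")
    case True
    then show ?thesis by (intro exI[of _ 0]) simp
  next
    case False
    then obtain h :: "'b cdual" where h: "h z = 1" using separating_functional by metis
    then have "h \<noteq> 0" by auto
    then obtain x1 where x1: "cblinfun_apply h (T x1) \<noteq> 0" using sep[OF False] by blast
    obtain A where A: "A \<in> \<A>\<^sub>1" "\<Phi> A = tensor z h" by (rule onto_tensor)
    have "f (A x1) = h (T x1) * S f z" for f :: "'a cdual" by (rule key[OF A]) (simp add: h)
    then show ?thesis using x1 by (intro exI[of _ "inverse (h (T x1)) *\<^sub>C A x1"]) simp
  qed
  then obtain U where U: "\<And>z (f :: 'a cdual). cblinfun_apply f (U z) = S f z" by metis
  have TU: "T (U z) = \<kappa> *\<^sub>C z" for z
  proof -
    have "S f (T (U z) - \<kappa> *\<^sub>C z) = 0" for f by (simp add: tr U)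
    then have "T (U z) - \<kappa> *\<^sub>C z = 0" by (rule S_sep)
    then show ?thesis by simp
  qed
  have UT: "U (T x) = \<kappa> *\<^sub>C x" for x
    by (rule eq_if_functionals_eq) (simp add: U tr)
  have "bounded_clinear T"
  proof (rule weakly_bounded_imp_bounded)
    fix h :: "'b cdual"
    show "\<exists>k :: 'a cdual. \<forall>x. h (T x) = k x"
    proof (cases "h = 0")
      case True
      then show ?thesis by (intro exI[of _ 0]) simp
    next
      case False
      then obtain y where "cblinfun_apply h y \<noteq> 0" by (metis cblinfun_eqI zero_cblinfun.rep_eq)
      then have y: "cblinfun_apply h y \<noteq> 0" "y \<noteq> 0" by auto
      obtain f where f: "S f y \<noteq> 0" using sep[OF y(2) False] by blast
      obtain A where A: "A \<in> \<A>\<^sub>1" "\<Phi> A = tensor y h" by (rule onto_tensor)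
      have "f (A x) = h (T x) * S f y" for x by (rule key[OF A y(1)])
      then show ?thesis using f by (intro exI[of _ "inverse (S f y) *\<^sub>C (f o\<^sub>C\<^sub>L A)"]) simp
    qed
  qed (simp_all add: lin)
  then obtain T' :: "'a \<Rightarrow>\<^sub>C\<^sub>L 'b" where T': "\<And>x. T' x = T x" using ex_cblinfunI by blast
  have "bounded_clinear U"
  proof (rule weakly_bounded_imp_bounded)
    show "U (x + y) = U x + U y" "U (c *\<^sub>C x) = c *\<^sub>C U x" for x y c
      by (rule eq_if_functionals_eq, simp add: U)+
  qed (use U in blast)
  then obtain U' where U': "\<And>x. cblinfun_apply U' x = U x" using ex_cblinfunI by blast
  define V where "V = inverse \<kappa> *\<^sub>C U'"
  have VT: "V (T' x) = x" and TV: "T' (V z) = z" for x z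
    using \<kappa>0 by (simp_all add: V_def T' U' UT TU scaleC_scaleC lin)
  have inv: "cblinfun_inv T' = V" by (rule cblinfun_inv_eqI[OF VT TV])
  have "\<Phi> A = inverse \<kappa> *\<^sub>C (T' o\<^sub>C\<^sub>L A o\<^sub>C\<^sub>L V)" if A: "A \<in> \<A>\<^sub>1" for A
  proof (rule determined_by_idempotents[OF inverse_root[OF \<kappa>] _ A, where \<Theta> = "\<lambda>A. T' o\<^sub>C\<^sub>L A o\<^sub>C\<^sub>L V"])
    fix z and h :: "'b cdual" assume hz: "h z = 1"
    define x f where "x = V z" and "f = h o\<^sub>C\<^sub>L T'"
    have fx: "f x = 1" by (simp add: x_def f_def TV hz)
    obtain B where B: "B \<in> \<A>\<^sub>1" "\<Phi> B = tensor (inverse \<kappa> *\<^sub>C z) h" by (rule onto_tensor)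
    have kB: "k (B y) = k (tensor x f y)" for k :: "'a cdual" and y
    proof -
      have "S k z = \<kappa> * k x" using U[of k z] by (simp add: x_def V_def U' \<kappa>0)
      then have "k (B y) = h (T y) * k x"
        using key[OF B, of k y] hz \<kappa>0 by simp
      then show ?thesis by (simp add: f_def T')
    qed
    have "B = tensor x f"
      by (rule cblinfun_eqI, rule eq_if_functionals_eq) (rule kB)
    then have "\<Phi> (tensor x f) = inverse \<kappa> *\<^sub>C tensor z h"
      using B(2) by (auto intro!: cblinfun_eqI simp: scaleC_scaleC mult.commute)
    then show "\<exists>x f. cblinfun_apply f x = 1 \<and> \<Phi> (tensor x f) = inverse \<kappa> *\<^sub>C tensor z h \<and>
      (\<forall>A. h ((T' o\<^sub>C\<^sub>L A o\<^sub>C\<^sub>L V) z) = f (A x) \<and>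
        h ((T' o\<^sub>C\<^sub>L A o\<^sub>C\<^sub>L V) ((T' o\<^sub>C\<^sub>L A o\<^sub>C\<^sub>L V) z)) = f (A (A x)))"
      using fx by (intro exI[of _ x] exI[of _ f]) (simp add: x_def f_def VT)
  qed
  moreover have "cblinfun_invertible T'" by (rule cblinfun_invertibleI[OF VT TV])
  ultimately show ?thesis using inverse_root[OF \<kappa>] unfolding inv[symmetric] by blast
qed

text \<open>As before \<open>f (A x) = h (T f) * S x z\<close>. Now \<open>x \<mapsto> S x z\<close> is a bounded functional \<open>U z\<close>, and \<open>f \<mapsto> h (T f)\<close> is
  the evaluation at a vector \<open>W h\<close>. So every functional on the dual of the first space, written as \<open>h \<circ> T\<close>, is an
  evaluation, which is reflexivity; for the second space a functional \<open>\<psi>\<close> on its dual is pulled back along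
  \<open>S\<close>, which is onto because \<open>S (W h) = \<kappa> h\<close>.\<close>

theorem dual_form:
  assumes T: "clin T" and S: "clin S" and G: "\<And>x f. G x f = tensor (T f) (S x)"
  shows "creflexive TYPE('a) \<and> creflexive TYPE('b) \<and>
    (\<exists>c (T :: 'a cdual \<Rightarrow>\<^sub>C\<^sub>L 'b). c ^ (r + s + 1) = 1 \<and> cblinfun_invertible T \<and>
    (\<forall>A\<in>\<A>\<^sub>1. \<Phi> A = c *\<^sub>C (T o\<^sub>C\<^sub>L cadjoint A o\<^sub>C\<^sub>L cblinfun_inv T)))"
proof -
  note lin = clin_simps[OF T] clin_simps[OF S]
  have bil: "bilin (\<lambda>x f. S x (T f))" by (auto simp: bilin_def clin_def lin)
  have "\<exists>v g. G x f = tensor v g \<and> S x (T f) = g v" for x f using G by blast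
  from G_trace[OF bil this] obtain \<kappa> where \<kappa>: "\<kappa> ^ (r + s + 1) = 1"
    and tr: "S x (T f) = \<kappa> * f x"
    and \<kappa>M: "cblinfun_apply f x = 1 \<Longrightarrow> M x f = tensor v g \<Longrightarrow> g v = \<kappa>" for x f v g
    by blast
  have \<kappa>0: "\<kappa> \<noteq> 0" using \<kappa> by auto
  have key: "f (A x) = h (T f) * S x z"
    if "A \<in> \<A>\<^sub>1" "\<Phi> A = tensor z h" "cblinfun_apply h z \<noteq> 0" for A z h x and f :: "'a cdual"
  proof -
    have "clin (\<lambda>x. cblinfun_apply (S x) z)" by (simp add: clin_def lin)
    then obtain x1 where x1: "x1 \<noteq> 0" "cblinfun_apply (S x1) z = 0" using kernel1 by blast
    obtain f1 :: "'a cdual" where "f1 x1 = 1" using separating_functional[OF x1(1)] by metis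
    then have "f (A x) = h (G x f z)"
      by (intro trace_identity[OF that \<kappa>M, where f' = f1 and x' = x1]) (auto simp: G x1)
    then show ?thesis by (simp add: G mult.commute)
  qed
  have sep: "\<exists>x f. cblinfun_apply h (T f) \<noteq> 0 \<and> S x z \<noteq> 0" if "z \<noteq> 0" "h \<noteq> 0" for z and h :: "'b cdual"
    using G_separates[OF that] by (auto simp: G)
  have S_sep: "w = 0" if "\<And>x. S x w = 0" for w
  proof (rule ccontr)
    assume w: "w \<noteq> 0"
    obtain h :: "'b cdual" where "h w = 1" using separating_functional[OF w] by metis
    then have "h \<noteq> 0" by auto
    then show False using sep[OF w] that by blast
  qed
  have "\<exists>f. \<forall>x. cblinfun_apply f x = S x z" for z
  proof (cases "z = 0")
    case True
    then show ?thesis by (intro exI[of _ 0]) simp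
  next
    case False
    then obtain h :: "'b cdual" where h: "h z = 1" using separating_functional by metis
    then have "h \<noteq> 0" by auto
    then obtain f1 where f1: "cblinfun_apply h (T f1) \<noteq> 0" using sep[OF False] by blast
    obtain A where A: "A \<in> \<A>\<^sub>1" "\<Phi> A = tensor z h" by (rule onto_tensor)
    have "f1 (A x) = h (T f1) * S x z" for x by (rule key[OF A]) (simp add: h)
    then show ?thesis using f1 by (intro exI[of _ "inverse (h (T f1)) *\<^sub>C (f1 o\<^sub>C\<^sub>L A)"]) simp
  qed
  then obtain U where U: "\<And>z x. cblinfun_apply (U z) x = S x z" by metis
  have "\<exists>x. \<forall>f. cblinfun_apply h (T f) = cblinfun_apply f x" for h :: "'b cdual"
  proof (cases "h = 0")
    case True
    then show ?thesis by (intro exI[of _ 0]) simp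
  next
    case False
    then obtain y where "cblinfun_apply h y \<noteq> 0" by (metis cblinfun_eqI zero_cblinfun.rep_eq)
    then have y: "cblinfun_apply h y \<noteq> 0" "y \<noteq> 0" by auto
    obtain x where x: "S x y \<noteq> 0" using sep[OF y(2) False] by blast
    obtain A where A: "A \<in> \<A>\<^sub>1" "\<Phi> A = tensor y h" by (rule onto_tensor)
    have "f (A x) = h (T f) * S x y" for f :: "'a cdual" by (rule key[OF A y(1)])
    then show ?thesis using x by (intro exI[of _ "inverse (S x y) *\<^sub>C A x"]) simp
  qed
  then obtain W where W: "\<And>h f. cblinfun_apply (h :: 'b cdual) (T f) = cblinfun_apply f (W h)" by metis
  have TU: "T (U z) = \<kappa> *\<^sub>C z" for z
  proof -
    have "S x (T (U z) - \<kappa> *\<^sub>C z) = 0" for x by (simp add: tr U)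
    then have "T (U z) - \<kappa> *\<^sub>C z = 0" by (rule S_sep)
    then show ?thesis by simp
  qed
  have UT: "U (T f) = \<kappa> *\<^sub>C f" for f
    by (rule cblinfun_eqI) (simp add: U tr)
  have "bounded_clinear T"
  proof (rule weakly_bounded_imp_bounded)
    fix h :: "'b cdual"
    show "\<exists>k :: 'a cdual cdual. \<forall>f. h (T f) = k f"
      by (rule exI[of _ "canonical_embedding (W h)"]) (simp add: canonical_embedding.rep_eq W)
  qed (simp_all add: lin)
  then obtain T' :: "'a cdual \<Rightarrow>\<^sub>C\<^sub>L 'b" where T': "\<And>f. T' f = T f" using ex_cblinfunI by blast
  have "bounded_clinear U"
  proof (rule pointwise_bounded_imp_bounded)
    show "U (x + y) = U x + U y" "U (c *\<^sub>C x) = c *\<^sub>C U x" for x y c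
      by (rule cblinfun_eqI, simp add: U)+
  qed (use U in blast)
  then obtain U' where U': "\<And>z. cblinfun_apply U' z = U z" using ex_cblinfunI by blast
  have "bounded_clinear S"
    by (rule pointwise_bounded_imp_bounded) (use U in \<open>auto simp: lin intro: sym\<close>)
  then obtain S' where S': "\<And>x. cblinfun_apply S' x = S x" using ex_cblinfunI by blast
  define V where "V = inverse \<kappa> *\<^sub>C U'"
  have VT: "V (T' f) = f" and TV: "T' (V z) = z" for f z
    using \<kappa>0 by (simp_all add: V_def T' U' UT TU scaleC_scaleC lin)
  have inv: "cblinfun_inv T' = V" by (rule cblinfun_inv_eqI[OF VT TV])
  have SW: "S (W h) = \<kappa> *\<^sub>C h" for h
  proof (rule cblinfun_eqI)
    fix z
    have "S (W h) (T (V z)) = \<kappa> * h (T (V z))" by (simp only: tr W[of h])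
    moreover have "T (V z) = z" using TV[of z] by (simp add: T')
    ultimately show "S (W h) z = (\<kappa> *\<^sub>C h) z" by simp
  qed
  have "creflexive TYPE('a)"
    unfolding creflexive_def
  proof (rule surjI)
    fix \<psi> :: "'a cdual cdual"
    show "canonical_embedding (W (\<psi> o\<^sub>C\<^sub>L V)) = \<psi>"
    proof (rule cblinfun_eqI)
      fix f
      have "canonical_embedding (W (\<psi> o\<^sub>C\<^sub>L V)) f = (\<psi> o\<^sub>C\<^sub>L V) (T f)"
        by (simp only: canonical_embedding.rep_eq W)
      also have "\<dots> = \<psi> f" using VT[of f] by (simp add: T')
      finally show "canonical_embedding (W (\<psi> o\<^sub>C\<^sub>L V)) f = \<psi> f" .
    qed
  qed
  moreover have "creflexive TYPE('b)"
    unfolding creflexive_def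
  proof (rule surjI)
    fix \<psi> :: "'b cdual cdual"
    show "canonical_embedding (inverse \<kappa> *\<^sub>C T (\<psi> o\<^sub>C\<^sub>L S')) = \<psi>"
    proof (rule cblinfun_eqI)
      fix h :: "'b cdual"
      have "h (T (\<psi> o\<^sub>C\<^sub>L S')) = \<psi> (S (W h))" by (simp add: W S')
      then show "canonical_embedding (inverse \<kappa> *\<^sub>C T (\<psi> o\<^sub>C\<^sub>L S')) h = \<psi> h"
        using \<kappa>0 by (simp add: canonical_embedding.rep_eq SW)
    qed
  qed
  moreover have "\<Phi> A = inverse \<kappa> *\<^sub>C (T' o\<^sub>C\<^sub>L cadjoint A o\<^sub>C\<^sub>L V)" if A: "A \<in> \<A>\<^sub>1" for A
  proof (rule determined_by_idempotents[OF inverse_root[OF \<kappa>] _ A,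
        where \<Theta> = "\<lambda>A. T' o\<^sub>C\<^sub>L cadjoint A o\<^sub>C\<^sub>L V"])
    fix z and h :: "'b cdual" assume hz: "h z = 1"
    define x f where "x = W h" and "f = V z"
    have hT: "h (T' k) = k x" for k by (simp add: T' W x_def)
    have fx: "f x = 1" using hT[of f] by (simp add: f_def TV hz)
    obtain B where B: "B \<in> \<A>\<^sub>1" "\<Phi> B = tensor (inverse \<kappa> *\<^sub>C z) h" by (rule onto_tensor)
    have kB: "k (B y) = k (tensor x f y)" for k :: "'a cdual" and y
    proof -
      have "S y z = \<kappa> * f y" using U[of z y] by (simp add: f_def V_def U' \<kappa>0)
      then have "k (B y) = h (T k) * f y"
        using key[OF B, of k y] hz \<kappa>0 by simp
      then show ?thesis using hT[of k] by (simp add: T')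
    qed
    have "B = tensor x f"
      by (rule cblinfun_eqI, rule eq_if_functionals_eq) (rule kB)
    then have "\<Phi> (tensor x f) = inverse \<kappa> *\<^sub>C tensor z h"
      using B(2) by (auto intro!: cblinfun_eqI simp: scaleC_scaleC mult.commute)
    then show "\<exists>x f. cblinfun_apply f x = 1 \<and> \<Phi> (tensor x f) = inverse \<kappa> *\<^sub>C tensor z h \<and>
      (\<forall>A. h ((T' o\<^sub>C\<^sub>L cadjoint A o\<^sub>C\<^sub>L V) z) = f (A x) \<and>
        h ((T' o\<^sub>C\<^sub>L cadjoint A o\<^sub>C\<^sub>L V) ((T' o\<^sub>C\<^sub>L cadjoint A o\<^sub>C\<^sub>L V) z)) = f (A (A x)))"
      using fx by (intro exI[of _ x] exI[of _ f]) (simp add: hT f_def[symmetric] VT cadjoint.rep_eq)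
  qed
  moreover have "cblinfun_invertible T'" by (rule cblinfun_invertibleI[OF VT TV])
  ultimately show ?thesis using inverse_root[OF \<kappa>] unfolding inv[symmetric] by blast
qed

end

section \<open>Dimension at most one\<close>

lemma dim_le_1_cases:
  assumes "\<not> (\<exists>x y :: 'a::complex_normed_vector. indep2 x y)"
  obtains "\<And>x :: 'a::complex_normed_vector. x = 0"
    | e and f :: "'a::complex_normed_vector cdual" where "f e = 1" "\<And>x. x = f x *\<^sub>C e"
proof (cases "\<exists>e :: 'a. e \<noteq> 0")
  case True
  then obtain e :: 'a where e: "e \<noteq> 0" by blast
  obtain f :: "'a cdual" where f: "f e = 1" using separating_functional[OF e] by metis
  have "x = f x *\<^sub>C e" for x
  proof -
    obtain c where "x = c *\<^sub>C e" using not_indep2[of e x] assms e by blast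
    then show ?thesis by (simp add: f)
  qed
  with f show ?thesis using that(2) by blast
next
  case False
  then show ?thesis using that(1) by blast
qed

lemma spectrum_dim_le_1:
  assumes "\<not> (\<exists>x y :: 'a::complex_normed_vector. indep2 x y)"
    and "c \<in> spectrum (A :: 'a \<Rightarrow>\<^sub>C\<^sub>L 'a)" "d \<in> spectrum A"
  shows "c = d"
proof (rule dim_le_1_cases[OF assms(1)])
  assume 0: "\<And>x :: 'a. x = 0"
  have "cblinfun_invertible (A - c *\<^sub>C cblinfun_id)"
    by (rule cblinfun_invertibleI[of 0]) (metis 0)+
  then show ?thesis using assms(2) by (simp add: spectrum_def)
next
  fix e and f :: "'a cdual" assume f: "f e = 1" and x: "\<And>x. x = f x *\<^sub>C e"
  have A: "A x = f (A e) *\<^sub>C x" for x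
  proof -
    have "A x = f x *\<^sub>C A e" by (subst x[of x]) simp
    also have "\<dots> = f x *\<^sub>C f (A e) *\<^sub>C e" by (subst x[of "A e"]) simp
    also have "\<dots> = f (A e) *\<^sub>C f x *\<^sub>C e" by (simp add: scaleC_scaleC mult.commute)
    finally show ?thesis by (simp only: x[of x, symmetric])
  qed
  define a where "a = f (A e)"
  have A: "A x = a *\<^sub>C x" for x using A[of x] by (simp only: a_def)
  have "k = a" if k: "k \<in> spectrum A" for k
  proof (rule ccontr)
    assume ne: "k \<noteq> a"
    have "(A - k *\<^sub>C cblinfun_id) x = (a - k) *\<^sub>C x" for x by (simp add: A cvec_simps)
    then have "cblinfun_invertible (A - k *\<^sub>C cblinfun_id)"
      by (intro cblinfun_invertibleI[of "inverse (a - k) *\<^sub>C cblinfun_id"])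
        (use ne in \<open>simp_all only: cblinfun_rep scaleC_scaleC\<close>, simp_all)
    then show False using k by (simp add: spectrum_def)
  qed
  then show ?thesis using assms(2,3) by metis
qed

lemma idempotent_two_point_spectrum:
  fixes u v :: "'a::complex_normed_vector"
  assumes "indep2 u v"
  obtains x and f :: "'a cdual" where "f x = 1" "0 \<in> spectrum (jordan_pair r s (tensor x f) (tensor x f))"
    "2 \<in> spectrum (jordan_pair r s (tensor x f) (tensor x f))"
proof -
  obtain f g :: "'a cdual" where f: "f u = 1" "f v = 0" using dual_pair[OF assms] by metis
  show ?thesis
    using that[OF f(1) jordan_pair_idempotent_self(1)[OF f indep2_nonzero(2)[OF assms]]
        jordan_pair_idempotent_self(2)[OF f(1)]] .
qed

context preserver
begin

text \<open>In dimension at least two an idempotent \<open>P\<close> of rank one has a kernel, so its product with itself has the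
  spectral values \<open>0\<close> and \<open>2\<close>; a scalar operator has at most one.\<close>

lemma dim_agree: "(\<exists>x y :: 'a. indep2 x y) \<longleftrightarrow> (\<exists>x y :: 'b. indep2 x y)"
proof
  assume "\<exists>x y :: 'a. indep2 x y"
  then obtain x and f :: "'a cdual" where xf: "f x = 1" "0 \<in> spectrum (jordan_pair r s (tensor x f) (tensor x f))"
    "2 \<in> spectrum (jordan_pair r s (tensor x f) (tensor x f))"
    using idempotent_two_point_spectrum by metis
  then have "{0, 2} \<subseteq> spectrum (jordan_pair r s (\<Phi> (tensor x f)) (\<Phi> (tensor x f)))"
    using preserves[OF tensor_mem[of x f] tensor_mem[of x f]] rank_at_most_tensor[of x f] by simp
  then show "\<exists>x y :: 'b. indep2 x y" using spectrum_dim_le_1 by fastforce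
next
  assume "\<exists>x y :: 'b. indep2 x y"
  then obtain z and h :: "'b cdual" where zh: "h z = 1" "0 \<in> spectrum (jordan_pair r s (tensor z h) (tensor z h))"
    "2 \<in> spectrum (jordan_pair r s (tensor z h) (tensor z h))"
    using idempotent_two_point_spectrum by metis
  obtain A where A: "A \<in> \<A>\<^sub>1" "\<Phi> A = tensor z h" by (rule onto_tensor)
  show "\<exists>x y :: 'a. indep2 x y"
  proof (rule ccontr)
    assume no: "\<not> ?thesis"
    have "rank_at_most 1 A"
      using no
    proof (rule dim_le_1_cases)
      assume 0: "\<And>x :: 'a. x = 0"
      have "A = 0" by (rule cblinfun_eqI) (metis 0)
      then show ?thesis using rank_at_most_zero by metis
    next
      fix e and f :: "'a cdual" assume x: "\<And>x. x = f x *\<^sub>C e"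
      show ?thesis
      proof (rule rank_at_most_I[of "{e}"])
        show "A y \<in> cvec.span {e}" for y
          by (subst x[of "A y"]) (simp add: cvec.span_scale cvec.span_base)
      qed auto
    qed
    then have "{0, 2} \<subseteq> spectrum (jordan_pair r s A A)"
      using preserves[OF A(1) A(1)] A(2) zh by simp
    then show False using spectrum_dim_le_1[OF no] by fastforce
  qed
qed

text \<open>On a line the spectra give \<open>b (\<Phi> A) * b (\<Phi> B)\<^bsup>r+s\<^esup> = a A * a B\<^bsup>r+s\<^esup>\<close> for the scalars \<open>a\<close> and \<open>b\<close> of the
  operators; \<open>B = 1\<close> shows that \<open>\<Phi>\<close> multiplies the scalar by \<open>b (\<Phi> 1)\<close>.\<close>

lemma dim_le_1_form:
  assumes no1: "\<not> (\<exists>x y :: 'a. indep2 x y)"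
  shows "\<exists>c (T :: 'a \<Rightarrow>\<^sub>C\<^sub>L 'b). c ^ (r + s + 1) = 1 \<and> cblinfun_invertible T \<and>
    (\<forall>A\<in>\<A>\<^sub>1. \<Phi> A = c *\<^sub>C (T o\<^sub>C\<^sub>L A o\<^sub>C\<^sub>L cblinfun_inv T))"
proof -
  have no2: "\<not> (\<exists>x y :: 'b. indep2 x y)" using no1 dim_agree by blast
  show ?thesis
    using no1
  proof (rule dim_le_1_cases)
    assume 0: "\<And>x :: 'a. x = 0"
    have op0: "A = 0" for A :: "'a \<Rightarrow>\<^sub>C\<^sub>L 'a" 
      by (rule cblinfun_eqI) (metis 0)
    have zero_b: "y = 0" for y :: 'b
    proof (rule ccontr)
      assume y: "y \<noteq> 0"
      obtain h :: "'b cdual" where h: "h y = 1" using separating_functional[OF y] by metis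
      obtain A where "\<Phi> A = tensor y h" by (rule onto_tensor)
      moreover obtain B where "\<Phi> B = tensor 0 h" by (rule onto_tensor)
      ultimately have "tensor y h y = tensor 0 h y" using op0 by metis
      then show False using h y by simp
    qed
    have all_eq: "x = x'" "y = y'" for x x' :: 'a and y y' :: 'b
      by (rule trans[OF 0 0[symmetric]], rule trans[OF zero_b zero_b[symmetric]])
    have "cblinfun_invertible (0 :: 'a \<Rightarrow>\<^sub>C\<^sub>L 'b)"
      by (rule cblinfun_invertibleI[of 0]) (rule all_eq)+
    moreover have "B = C" for B C :: "'b \<Rightarrow>\<^sub>C\<^sub>L 'b" by (rule cblinfun_eqI) (rule all_eq)
    ultimately show ?thesis by (intro exI[of _ 1] exI[of _ 0]) auto
  next
    fix e and f :: "'a cdual" assume f: "f e = 1" and x: "\<And>x. x = f x *\<^sub>C e"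
    show ?thesis
      using no2
    proof (rule dim_le_1_cases)
      assume 0: "\<And>y :: 'b. y = 0"
      have "0 \<in> spectrum (jordan_pair r s 0 (0 :: 'a \<Rightarrow>\<^sub>C\<^sub>L 'a))"
        by (rule eigenvalue_in_spectrum[of _ e]) (use f in \<open>auto simp: jordan_pair_apply\<close>)
      then have "0 \<in> spectrum (jordan_pair r s (\<Phi> 0) (\<Phi> 0))"
        using preserves[OF zero_mem zero_mem disjI1[OF rank_at_most_zero]] by simp
      moreover have "cblinfun_invertible (B :: 'b \<Rightarrow>\<^sub>C\<^sub>L 'b)" for B
        by (rule cblinfun_invertibleI[of 0]) (metis 0)+
      ultimately show ?thesis by (simp add: spectrum_def)
    next
      fix e' and g :: "'b cdual" assume g: "g e' = 1" and y: "\<And>y. y = g y *\<^sub>C e'"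
      define a where "a A = f (A e)" for A :: "'a \<Rightarrow>\<^sub>C\<^sub>L 'a"
      define b where "b B = g (B e')" for B :: "'b \<Rightarrow>\<^sub>C\<^sub>L 'b"
      have a: "cblinfun_apply A e = a A *\<^sub>C e" for A unfolding a_def by (rule x)
      have b: "cblinfun_apply B e' = b B *\<^sub>C e'" for B unfolding b_def by (rule y)
      have "e \<noteq> 0" "e' \<noteq> 0" using f g by auto
      have eig: "jordan_pair r s A B e = (2 * a A * a B ^ (r + s)) *\<^sub>C e" for A B
        by (simp only: jordan_pair_apply opow_eigen[OF a[of B]] a[of A] cblinfun_apply_simps scaleC_scaleC
            flip: scaleC_add_left) (simp add: power_add mult_ac)
      have eig': "jordan_pair r s A B e' = (2 * b A * b B ^ (r + s)) *\<^sub>C e'" for A B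
        by (simp only: jordan_pair_apply opow_eigen[OF b[of B]] b[of A] cblinfun_apply_simps scaleC_scaleC
            flip: scaleC_add_left) (simp add: power_add mult_ac)
      have rank: "rank_at_most 1 (tensor e f)" by (rule rank_at_most_tensor)
      have eq: "b (\<Phi> A) * b (\<Phi> (tensor e f)) ^ (r + s) = a A" if A: "A \<in> \<A>\<^sub>1" for A
      proof -
        have "2 * a A * a (tensor e f) ^ (r + s) \<in> spectrum (jordan_pair r s A (tensor e f))"
          by (rule eigenvalue_in_spectrum[OF eig \<open>e \<noteq> 0\<close>])
        moreover have "2 * b (\<Phi> A) * b (\<Phi> (tensor e f)) ^ (r + s) \<in>
            spectrum (jordan_pair r s A (tensor e f))"
          unfolding preserves[OF A tensor_mem disjI2[OF rank], symmetric]
          by (rule eigenvalue_in_spectrum[OF eig' \<open>e' \<noteq> 0\<close>])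
        ultimately have "2 * b (\<Phi> A) * b (\<Phi> (tensor e f)) ^ (r + s) =
            2 * a A * a (tensor e f) ^ (r + s)"
          using spectrum_dim_le_1[OF no1] by blast
        moreover have "a (tensor e f) = 1" by (simp add: a_def f)
        ultimately show ?thesis by simp
      qed
      define c where "c = b (\<Phi> (tensor e f))"
      have c: "c ^ (r + s + 1) = 1"
        using eq[OF tensor_mem[of e f]] by (simp add: c_def a_def f)
      have VT: "tensor e g (tensor e' f x) = x" for x by (simp add: g x[of x, symmetric])
      have TV: "tensor e' f (tensor e g y) = y" for y by (simp add: f y[of y, symmetric])
      have "\<Phi> A = c *\<^sub>C (tensor e' f o\<^sub>C\<^sub>L A o\<^sub>C\<^sub>L tensor e g)" if A: "A \<in> \<A>\<^sub>1" for A
      proof (rule cblinfun_eqI)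
        fix w
        have "c * a A = b (\<Phi> A) * c ^ (r + s + 1)" using eq[OF A] by (simp add: c_def mult_ac)
        then have ca: "c * a A = b (\<Phi> A)" by (simp only: c) simp
        have "\<Phi> A w = g w *\<^sub>C \<Phi> A e'" by (subst y[of w]) simp
        then show "\<Phi> A w = (c *\<^sub>C (tensor e' f o\<^sub>C\<^sub>L A o\<^sub>C\<^sub>L tensor e g)) w"
          by (simp add: b a f scaleC_scaleC mult_ac flip: ca)
      qed
      then show ?thesis
        using c cblinfun_invertibleI[OF VT TV] unfolding cblinfun_inv_eqI[OF VT TV, symmetric] by blast
    qed
  qed
qed

theorem preserver_form:
  "(\<exists>c (T :: 'a \<Rightarrow>\<^sub>C\<^sub>L 'b). c ^ (r + s + 1) = 1 \<and> cblinfun_invertible T \<and>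
      (\<forall>A\<in>\<A>\<^sub>1. \<Phi> A = c *\<^sub>C (T o\<^sub>C\<^sub>L A o\<^sub>C\<^sub>L cblinfun_inv T))) \<or>
   (creflexive TYPE('a) \<and> creflexive TYPE('b) \<and>
    (\<exists>c (T :: 'a cdual \<Rightarrow>\<^sub>C\<^sub>L 'b). c ^ (r + s + 1) = 1 \<and> cblinfun_invertible T \<and>
      (\<forall>A\<in>\<A>\<^sub>1. \<Phi> A = c *\<^sub>C (T o\<^sub>C\<^sub>L cadjoint A o\<^sub>C\<^sub>L cblinfun_inv T))))"
proof (cases "\<exists>x y :: 'a. indep2 x y")
  case True
  interpret preserver_dim2 \<A>\<^sub>1 \<A>\<^sub>2 \<Phi> r s
    by unfold_locales (use True dim_agree in blast)+
  show ?thesis using G_factors direct_form dual_form by blast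
next
  case False
  then show ?thesis using dim_le_1_form by blast
qed

end

section \<open>Reduction of the generalized Jordan product\<close>

lemma cblinfun_prod_append: "cblinfun_prod (xs @ ys) = cblinfun_prod xs o\<^sub>C\<^sub>L cblinfun_prod ys"
  by (induction xs) (auto simp: cblinfun_prod_def intro!: cblinfun_eqI)

lemma jordan_pair_commute: "jordan_pair r s A B = jordan_pair s r A B"
  by (simp add: jordan_pair_def add.commute)

text \<open>Around the position \<open>p\<close> of the single index there are \<open>p\<close> factors on the left and
  \<open>length idx - 1 - p\<close> on the right.\<close>

lemma jordan_product_single_index:
  assumes p: "p < length idx" and unique: "\<forall>q<length idx. q \<noteq> p \<longrightarrow> idx ! p \<noteq> idx ! q"
    and T: "T (idx ! p) = A" "\<And>j. j \<noteq> idx ! p \<Longrightarrow> T j = B"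
  shows "jordan_product idx T = jordan_pair p (length idx - 1 - p) A B"
proof -
  define q where "q = length idx - 1 - p"
  have "map T idx = replicate p B @ [A] @ replicate q B"
  proof (rule nth_equalityI)
    show "length (map T idx) = length (replicate p B @ [A] @ replicate q B)"
      using p by (simp add: q_def)
    fix i assume i: "i < length (map T idx)"
    have "(replicate p B @ [A] @ replicate q B) ! i = (if i = p then A else B)"
      using i p by (auto simp: nth_append nth_Cons' q_def)
    moreover have "T (idx ! i) = (if i = p then A else B)"
      using i unique T by auto
    ultimately show "map T idx ! i = (replicate p B @ [A] @ replicate q B) ! i"
      using i by simp
  qed
  moreover from this have "map T (rev idx) = replicate q B @ [A] @ replicate p B"
    by (simp add: rev_map[symmetric])
  moreover have "cblinfun_prod (A # xs) = A o\<^sub>C\<^sub>L cblinfun_prod xs" for xs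
    by (simp add: cblinfun_prod_def)
  ultimately have "jordan_product idx T = jordan_pair p q A B"
    by (auto intro!: cblinfun_eqI simp: jordan_product_def cblinfun_prod_append jordan_pair_def opow_def)
  then show ?thesis by (simp only: q_def)
qed

theorem theorem1p2:
  fixes \<A>\<^sub>1 :: "('a::complex_banach \<Rightarrow>\<^sub>C\<^sub>L 'a) set"
    and \<A>\<^sub>2 :: "('b::complex_banach \<Rightarrow>\<^sub>C\<^sub>L 'b) set"
    and k :: nat
    and idx :: "nat list"
    and \<Phi> :: "('a \<Rightarrow>\<^sub>C\<^sub>L 'a) \<Rightarrow> ('b \<Rightarrow>\<^sub>C\<^sub>L 'b)"
  assumes "standard_operator_algebra \<A>\<^sub>1"
    and "standard_operator_algebra \<A>\<^sub>2"
    and "k \<ge> 2"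
    and "set idx = {1..k}"
    and "\<exists>p<length idx. \<forall>q<length idx. q \<noteq> p \<longrightarrow> idx ! p \<noteq> idx ! q"
    and "\<Phi> \<in> \<A>\<^sub>1 \<rightarrow> \<A>\<^sub>2"
    and "\<And>A :: nat \<Rightarrow> 'a \<Rightarrow>\<^sub>C\<^sub>L 'a.
          \<forall>j\<in>{1..k}. A j \<in> \<A>\<^sub>1 \<Longrightarrow> \<exists>j\<in>{1..k}. rank_at_most 1 (A j) \<Longrightarrow>
          spectrum (jordan_product idx (\<lambda>j. \<Phi> (A j))) = spectrum (jordan_product idx A)"
    and "{B \<in> \<A>\<^sub>2. rank_at_most 3 B} \<subseteq> \<Phi> ` \<A>\<^sub>1"
  shows
    "(\<exists>(c::complex) (T :: 'a \<Rightarrow>\<^sub>C\<^sub>L 'b).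
        c ^ length idx = 1 \<and> cblinfun_invertible T \<and>
        (\<forall>A\<in>\<A>\<^sub>1. \<Phi> A = c *\<^sub>C (T o\<^sub>C\<^sub>L A o\<^sub>C\<^sub>L cblinfun_inv T))) \<or>
     (creflexive TYPE('a) \<and> creflexive TYPE('b) \<and>
      (\<exists>(c::complex) (T :: 'a cdual \<Rightarrow>\<^sub>C\<^sub>L 'b).
        c ^ length idx = 1 \<and> cblinfun_invertible T \<and>
        (\<forall>A\<in>\<A>\<^sub>1. \<Phi> A = c *\<^sub>C (T o\<^sub>C\<^sub>L cadjoint A o\<^sub>C\<^sub>L cblinfun_inv T))))"
proof -
  obtain p where p: "p < length idx" and unique: "\<forall>q<length idx. q \<noteq> p \<longrightarrow> idx ! p \<noteq> idx ! q"
    using assms(5) by blast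
  define q where "q = length idx - 1 - p"
  define r s where "r = max p q" and "s = min p q"
  have "card (set idx) \<le> length idx" by (rule card_length)
  then have "length idx \<ge> 2" using assms(3,4) by simp
  then have len: "r + s + 1 = length idx" and r1: "r \<ge> 1"
    using p by (auto simp: r_def s_def q_def)
  have product: "jordan_product idx T = jordan_pair r s A B"
    if "T (idx ! p) = A" "\<And>j. j \<noteq> idx ! p \<Longrightarrow> T j = B"
    for T :: "nat \<Rightarrow> 'c \<Rightarrow>\<^sub>C\<^sub>L 'c::complex_normed_vector" and A B
    using jordan_product_single_index[OF p unique, of T A B] that jordan_pair_commute[of p q]
    by (auto simp: r_def s_def q_def max_def min_def)
  have idx_p: "idx ! p \<in> {1..k}" using p assms(4) nth_mem by blast
  obtain j0 where j0: "j0 \<in> {1..k}" "j0 \<noteq> idx ! p"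
  proof (cases "idx ! p = 1")
    case True
    then show ?thesis using that[of 2] assms(3) by simp
  next
    case False
    then show ?thesis using that[of 1] assms(3) by simp
  qed
  interpret preserver \<A>\<^sub>1 \<A>\<^sub>2 \<Phi> r s
  proof
    fix A B assume AB: "A \<in> \<A>\<^sub>1" "B \<in> \<A>\<^sub>1" "rank_at_most 1 A \<or> rank_at_most 1 B"
    define T where "T j = (if j = idx ! p then A else B)" for j
    have "\<exists>j\<in>{1..k}. rank_at_most 1 (T j)"
      using AB(3) idx_p j0 by (auto simp: T_def)
    then have "spectrum (jordan_product idx (\<lambda>j. \<Phi> (T j))) = spectrum (jordan_product idx T)"
      using AB by (intro assms(7)) (auto simp: T_def)
    moreover have "jordan_product idx T = jordan_pair r s A B"
      by (rule product) (simp_all add: T_def)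
    moreover have "jordan_product idx (\<lambda>j. \<Phi> (T j)) = jordan_pair r s (\<Phi> A) (\<Phi> B)"
      by (rule product) (simp_all add: T_def)
    ultimately show "spectrum (jordan_pair r s (\<Phi> A) (\<Phi> B)) = spectrum (jordan_pair r s A B)" by simp
  qed (use assms(1,2,8) r1 in \<open>auto simp: r_def s_def\<close>)
  show ?thesis using preserver_form unfolding len .
qed

end
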